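(* Let $\mathcal{C}$ be a small coherent category. A coherent functor $M:\mathcal{C}\to\mathbf{Set}$ is positively closed iff $LM=\mathbf{2}$, the two-element distributive lattice.
   Context: $M:\mathcal{C}\to\mathbf{Set}$ is positively closed if for each subobject $\varphi\hookrightarrow x$ in $\mathcal{C}$ we have $M(x)=M\varphi\cup\bigcup_{\psi\hookrightarrow x,\ \psi\cap\varphi=\emptyset}M\psi$ ($\emptyset$ the least subobject). $Sub_{\mathcal{C}}:\mathcal{C}^{op}\to\mathbf{DLat}$ sends $x$ to its (bounded distributive) lattice of subobjects and $f$ to pullback $f^*$. $LM=\mathrm{colim}\big((\int M)^{op}\to\mathcal{C}^{op}\xrightarrow{Sub_{\mathcal{C}}}\mathbf{DLat}\big)$, where $\int M$ is the category of elements of $M$ (objects $(x,a)$ with $a\in Mx$; arrows $(x,a)\to(y,b)$ are $f:x\to y$ with $Mf(a)=b$). *)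

theory Defs
  imports "HOL-Algebra.Lattice"
begin

section \<open>Categories and functors\<close>

text \<open>
  Categories are given by carrier sets of objects and arrows inside types; such a category is
  small. \<open>g \<cdot> f\<close> is composition in the applicative order.
\<close>

record ('o, 'a) cat =
  Obj :: "'o set"
  Arr :: "'a set"
  Dom :: "'a \<Rightarrow> 'o"
  Cod :: "'a \<Rightarrow> 'o"
  Ident :: "'o \<Rightarrow> 'a"
  Comp :: "'a \<Rightarrow> 'a \<Rightarrow> 'a" (infixr \<open>\<cdot>\<index>\<close> 70)

definition Hom :: "('o, 'a) cat \<Rightarrow> 'o \<Rightarrow> 'o \<Rightarrow> 'a set" where
  "Hom C x y = {f \<in> Arr C. Dom C f = x \<and> Cod C f = y}"

locale category =
  fixes C :: "('o, 'a) cat"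
  assumes dom_closed: "f \<in> Arr C \<Longrightarrow> Dom C f \<in> Obj C"
    and cod_closed: "f \<in> Arr C \<Longrightarrow> Cod C f \<in> Obj C"
    and ident_closed: "x \<in> Obj C \<Longrightarrow> Ident C x \<in> Hom C x x"
    and comp_closed: "f \<in> Hom C x y \<Longrightarrow> g \<in> Hom C y z \<Longrightarrow> g \<cdot>\<^bsub>C\<^esub> f \<in> Hom C x z"
    and comp_ident: "f \<in> Hom C x y \<Longrightarrow> f \<cdot>\<^bsub>C\<^esub> Ident C x = f"
    and ident_comp: "f \<in> Hom C x y \<Longrightarrow> Ident C y \<cdot>\<^bsub>C\<^esub> f = f"
    and comp_assoc: "f \<in> Hom C w x \<Longrightarrow> g \<in> Hom C x y \<Longrightarrow> h \<in> Hom C y z \<Longrightarrow>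
      (h \<cdot>\<^bsub>C\<^esub> g) \<cdot>\<^bsub>C\<^esub> f = h \<cdot>\<^bsub>C\<^esub> (g \<cdot>\<^bsub>C\<^esub> f)"

definition op_cat :: "('o, 'a) cat \<Rightarrow> ('o, 'a) cat" where
  "op_cat C = \<lparr> Obj = Obj C, Arr = Arr C, Dom = Cod C, Cod = Dom C, Ident = Ident C,
     Comp = (\<lambda>g f. f \<cdot>\<^bsub>C\<^esub> g) \<rparr>"

record ('o, 'a, 'p, 'b) functor_data =
  omap :: "'o \<Rightarrow> 'p"
  amap :: "'a \<Rightarrow> 'b"

definition is_functor ::
    "('o, 'a) cat \<Rightarrow> ('p, 'b) cat \<Rightarrow> ('o, 'a, 'p, 'b) functor_data \<Rightarrow> bool" where
  "is_functor C D F \<longleftrightarrow> category C \<and> category D \<and>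
     (\<forall>x\<in>Obj C. omap F x \<in> Obj D \<and> amap F (Ident C x) = Ident D (omap F x)) \<and>
     (\<forall>f\<in>Arr C. amap F f \<in> Hom D (omap F (Dom C f)) (omap F (Cod C f))) \<and>
     (\<forall>f\<in>Arr C. \<forall>g\<in>Arr C. Cod C f = Dom C g \<longrightarrow>
        amap F (g \<cdot>\<^bsub>C\<^esub> f) = amap F g \<cdot>\<^bsub>D\<^esub> amap F f)"

definition functor_comp ::
    "('p, 'b, 'q, 'c) functor_data \<Rightarrow> ('o, 'a, 'p, 'b) functor_data \<Rightarrow>
     ('o, 'a, 'q, 'c) functor_data" where
  "functor_comp G F = \<lparr> omap = omap G \<circ> omap F, amap = amap G \<circ> amap F \<rparr>"


section \<open>Limits, subobjects and images\<close>

definition is_terminal :: "('o, 'a) cat \<Rightarrow> 'o \<Rightarrow> bool" where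
  "is_terminal C t \<longleftrightarrow> t \<in> Obj C \<and> (\<forall>x\<in>Obj C. \<exists>!f. f \<in> Hom C x t)"

text \<open>\<open>p\<close> and \<open>q\<close> are the projections to the domains of \<open>f\<close> and \<open>g\<close>, respectively.\<close>

definition is_pullback :: "('o, 'a) cat \<Rightarrow> 'a \<Rightarrow> 'a \<Rightarrow> 'a \<Rightarrow> 'a \<Rightarrow> bool" where
  "is_pullback C f g p q \<longleftrightarrow>
     f \<in> Arr C \<and> g \<in> Arr C \<and> Cod C f = Cod C g \<and>
     p \<in> Hom C (Dom C p) (Dom C f) \<and> q \<in> Hom C (Dom C p) (Dom C g) \<and>
     f \<cdot>\<^bsub>C\<^esub> p = g \<cdot>\<^bsub>C\<^esub> q \<and>
     (\<forall>w\<in>Obj C. \<forall>u\<in>Hom C w (Dom C f). \<forall>v\<in>Hom C w (Dom C g).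
        f \<cdot>\<^bsub>C\<^esub> u = g \<cdot>\<^bsub>C\<^esub> v \<longrightarrow>
        (\<exists>!k. k \<in> Hom C w (Dom C p) \<and> p \<cdot>\<^bsub>C\<^esub> k = u \<and> q \<cdot>\<^bsub>C\<^esub> k = v))"

definition is_mono :: "('o, 'a) cat \<Rightarrow> 'a \<Rightarrow> bool" where
  "is_mono C m \<longleftrightarrow> m \<in> Arr C \<and>
     (\<forall>w\<in>Obj C. \<forall>u\<in>Hom C w (Dom C m). \<forall>v\<in>Hom C w (Dom C m).
        m \<cdot>\<^bsub>C\<^esub> u = m \<cdot>\<^bsub>C\<^esub> v \<longrightarrow> u = v)"

definition is_iso :: "('o, 'a) cat \<Rightarrow> 'a \<Rightarrow> bool" where
  "is_iso C f \<longleftrightarrow> f \<in> Arr C \<and>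
     (\<exists>g\<in>Hom C (Cod C f) (Dom C f).
        g \<cdot>\<^bsub>C\<^esub> f = Ident C (Dom C f) \<and> f \<cdot>\<^bsub>C\<^esub> g = Ident C (Cod C f))"

definition factors :: "('o, 'a) cat \<Rightarrow> 'a \<Rightarrow> 'a \<Rightarrow> bool" where
  "factors C f m \<longleftrightarrow> f \<in> Arr C \<and> m \<in> Arr C \<and> Cod C f = Cod C m \<and>
     (\<exists>k\<in>Hom C (Dom C f) (Dom C m). f = m \<cdot>\<^bsub>C\<^esub> k)"

definition monos_into :: "('o, 'a) cat \<Rightarrow> 'o \<Rightarrow> 'a set" where
  "monos_into C x = {m. is_mono C m \<and> Cod C m = x}"

definition sub_equiv :: "('o, 'a) cat \<Rightarrow> 'o \<Rightarrow> ('a \<times> 'a) set" where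
  "sub_equiv C x = {(m, n). m \<in> monos_into C x \<and> n \<in> monos_into C x \<and>
     factors C m n \<and> factors C n m}"

text \<open>A subobject is an equivalence class of monomorphisms.\<close>

definition Sub :: "('o, 'a) cat \<Rightarrow> 'o \<Rightarrow> 'a set gorder" where
  "Sub C x = \<lparr> carrier = monos_into C x // sub_equiv C x, eq = (=),
     le = (\<lambda>A B. \<exists>m\<in>A. \<exists>n\<in>B. factors C m n) \<rparr>"

text \<open>The class of all pullbacks along \<open>f\<close> of representatives of a subobject of the codomain.\<close>

definition sub_pullback :: "('o, 'a) cat \<Rightarrow> 'a \<Rightarrow> 'a set \<Rightarrow> 'a set" where
  "sub_pullback C f A = {n. \<exists>m\<in>A. \<exists>q. is_pullback C f m n q}"

text \<open>The image of an arrow is the least subobject of its codomain through which it factors.\<close>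

definition is_image :: "('o, 'a) cat \<Rightarrow> 'a \<Rightarrow> 'a \<Rightarrow> bool" where
  "is_image C f m \<longleftrightarrow> is_mono C m \<and> factors C f m \<and>
     (\<forall>n. is_mono C n \<and> factors C f n \<longrightarrow> factors C m n)"

text \<open>A cover is an arrow whose image is its whole codomain.\<close>

definition is_cover :: "('o, 'a) cat \<Rightarrow> 'a \<Rightarrow> bool" where
  "is_cover C f \<longleftrightarrow> f \<in> Arr C \<and> (\<forall>m. is_mono C m \<and> factors C f m \<longrightarrow> is_iso C m)"


section \<open>Coherent categories and coherent functors\<close>

text \<open>
  A coherent category has finite limits, images, pullback-stable covers, and pullback-stable finite
  unions of subobjects.
\<close>

locale coherent_category = category C for C :: "('o, 'a) cat" +
  assumes has_terminal: "\<exists>t. is_terminal C t"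
    and has_pullbacks: "f \<in> Arr C \<Longrightarrow> g \<in> Arr C \<Longrightarrow> Cod C f = Cod C g \<Longrightarrow>
      \<exists>p q. is_pullback C f g p q"
    and has_images: "f \<in> Arr C \<Longrightarrow> \<exists>m. is_image C f m"
    and covers_stable: "is_cover C g \<Longrightarrow> is_pullback C f g p q \<Longrightarrow> is_cover C p"
    and has_least_sub: "x \<in> Obj C \<Longrightarrow> \<exists>Z. least (Sub C x) Z (carrier (Sub C x))"
    and has_unions: "x \<in> Obj C \<Longrightarrow> A \<in> carrier (Sub C x) \<Longrightarrow> B \<in> carrier (Sub C x) \<Longrightarrow>
      \<exists>U. is_lub (Sub C x) U {A, B}"
    and least_sub_stable: "f \<in> Hom C y x \<Longrightarrow> least (Sub C x) Z (carrier (Sub C x)) \<Longrightarrow>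
      least (Sub C y) (sub_pullback C f Z) (carrier (Sub C y))"
    and unions_stable: "f \<in> Hom C y x \<Longrightarrow> A \<in> carrier (Sub C x) \<Longrightarrow> B \<in> carrier (Sub C x) \<Longrightarrow>
      is_lub (Sub C x) U {A, B} \<Longrightarrow>
      is_lub (Sub C y) (sub_pullback C f U) {sub_pullback C f A, sub_pullback C f B}"

text \<open>The subobject of \<open>F x\<close> represented by the images under \<open>F\<close> of the representatives of \<open>A\<close>.\<close>

definition functor_sub ::
    "('p, 'b) cat \<Rightarrow> ('o, 'a, 'p, 'b) functor_data \<Rightarrow> 'o \<Rightarrow> 'a set \<Rightarrow> 'b set" where
  "functor_sub D F x A = sub_equiv D (omap F x) `` (amap F ` A)"

definition coherent_functor ::
    "('o, 'a) cat \<Rightarrow> ('p, 'b) cat \<Rightarrow> ('o, 'a, 'p, 'b) functor_data \<Rightarrow> bool" where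
  "coherent_functor C D F \<longleftrightarrow> is_functor C D F \<and>
     (\<forall>t. is_terminal C t \<longrightarrow> is_terminal D (omap F t)) \<and>
     (\<forall>f g p q. is_pullback C f g p q \<longrightarrow>
        is_pullback D (amap F f) (amap F g) (amap F p) (amap F q)) \<and>
     (\<forall>f m. is_image C f m \<longrightarrow> is_image D (amap F f) (amap F m)) \<and>
     (\<forall>x\<in>Obj C. \<forall>Z. least (Sub C x) Z (carrier (Sub C x)) \<longrightarrow>
        least (Sub D (omap F x)) (functor_sub D F x Z) (carrier (Sub D (omap F x)))) \<and>
     (\<forall>x\<in>Obj C. \<forall>A\<in>carrier (Sub C x). \<forall>B\<in>carrier (Sub C x). \<forall>U.
        is_lub (Sub C x) U {A, B} \<longrightarrow>
        is_lub (Sub D (omap F x)) (functor_sub D F x U)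
          {functor_sub D F x A, functor_sub D F x B})"


section \<open>Set-valued functors\<close>

text \<open>
  Arrows of concrete categories are triples (domain, codomain, function), the function being
  extensional so that equality of arrows is equality of maps.
\<close>

abbreviation fn :: "'p \<times> 'p \<times> ('e \<Rightarrow> 'e) \<Rightarrow> 'e \<Rightarrow> 'e" where
  "fn t \<equiv> snd (snd t)"

definition Set_cat :: "('e set, 'e set \<times> 'e set \<times> ('e \<Rightarrow> 'e)) cat" where
  "Set_cat = \<lparr> Obj = UNIV, Arr = {(X, Y, f). f \<in> X \<rightarrow>\<^sub>E Y},
     Dom = fst, Cod = fst \<circ> snd, Ident = (\<lambda>X. (X, X, restrict (\<lambda>a. a) X)),
     Comp = (\<lambda>g f. (fst f, fst (snd g), compose (fst f) (fn g) (fn f))) \<rparr>"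

type_synonym ('o, 'a, 'e) set_functor =
  "('o, 'a, 'e set, 'e set \<times> 'e set \<times> ('e \<Rightarrow> 'e)) functor_data"

text \<open>The subset \<open>M \<phi>\<close> of \<open>M x\<close>, for a subobject \<open>\<phi>\<close> of \<open>x\<close>.\<close>

definition sub_elements :: "('o, 'a) cat \<Rightarrow> ('o, 'a, 'e) set_functor \<Rightarrow> 'a set \<Rightarrow> 'e set" where
  "sub_elements C M \<phi> = (\<Union>m\<in>\<phi>. fn (amap M m) ` omap M (Dom C m))"

definition positively_closed :: "('o, 'a) cat \<Rightarrow> ('o, 'a, 'e) set_functor \<Rightarrow> bool" where
  "positively_closed C M \<longleftrightarrow> (\<forall>x\<in>Obj C. \<forall>\<phi>\<in>carrier (Sub C x).
     omap M x = sub_elements C M \<phi> \<union>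
       (\<Union>\<psi>\<in>{\<psi> \<in> carrier (Sub C x). \<psi> \<sqinter>\<^bsub>Sub C x\<^esub> \<phi> = \<bottom>\<^bsub>Sub C x\<^esub>}. sub_elements C M \<psi>))"

definition elements_cat :: "('o, 'a) cat \<Rightarrow> ('o, 'a, 'e) set_functor \<Rightarrow>
    ('o \<times> 'e, ('o \<times> 'e) \<times> 'a \<times> ('o \<times> 'e)) cat" where
  "elements_cat C M = \<lparr>
     Obj = {(x, a). x \<in> Obj C \<and> a \<in> omap M x},
     Arr = {((x, a), f, (y, b)). f \<in> Hom C x y \<and> a \<in> omap M x \<and> b \<in> omap M y \<and>
              fn (amap M f) a = b},
     Dom = fst, Cod = snd \<circ> snd, Ident = (\<lambda>(x, a). ((x, a), Ident C x, (x, a))),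
     Comp = (\<lambda>(q, g, r) (p, f, q'). (p, g \<cdot>\<^bsub>C\<^esub> f, r)) \<rparr>"

definition elements_proj ::
    "('o \<times> 'e, ('o \<times> 'e) \<times> 'a \<times> ('o \<times> 'e), 'o, 'a) functor_data" where
  "elements_proj = \<lparr> omap = fst, amap = fst \<circ> snd \<rparr>"


section \<open>Bounded distributive lattices\<close>

locale dlat = bounded_lattice L for L :: "'l gorder" (structure) +
  assumes distrib: "x \<in> carrier L \<Longrightarrow> y \<in> carrier L \<Longrightarrow> z \<in> carrier L \<Longrightarrow>
    x \<sqinter> (y \<squnion> z) = (x \<sqinter> y) \<squnion> (x \<sqinter> z)"

definition dlat_hom :: "'l gorder \<Rightarrow> 'k gorder \<Rightarrow> ('l \<Rightarrow> 'k) \<Rightarrow> bool" where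
  "dlat_hom L K h \<longleftrightarrow> h \<in> carrier L \<rightarrow> carrier K \<and>
     h \<bottom>\<^bsub>L\<^esub> = \<bottom>\<^bsub>K\<^esub> \<and> h \<top>\<^bsub>L\<^esub> = \<top>\<^bsub>K\<^esub> \<and>
     (\<forall>x\<in>carrier L. \<forall>y\<in>carrier L.
        h (x \<sqinter>\<^bsub>L\<^esub> y) = h x \<sqinter>\<^bsub>K\<^esub> h y \<and> h (x \<squnion>\<^bsub>L\<^esub> y) = h x \<squnion>\<^bsub>K\<^esub> h y)"

definition dlat_isomorphic :: "'l gorder \<Rightarrow> 'k gorder \<Rightarrow> bool" where
  "dlat_isomorphic L K \<longleftrightarrow> dlat L \<and> dlat K \<and>
     (\<exists>h. dlat_hom L K h \<and> bij_betw h (carrier L) (carrier K))"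

definition two :: "bool gorder" where
  "two = \<lparr> carrier = UNIV, eq = (=), le = (\<le>) \<rparr>"

definition DLat_cat :: "('l gorder, 'l gorder \<times> 'l gorder \<times> ('l \<Rightarrow> 'l)) cat" where
  "DLat_cat = \<lparr> Obj = {L. dlat L},
     Arr = {(L, K, h). dlat L \<and> dlat K \<and> dlat_hom L K h \<and> h \<in> extensional (carrier L)},
     Dom = fst, Cod = fst \<circ> snd, Ident = (\<lambda>L. (L, L, restrict (\<lambda>a. a) (carrier L))),
     Comp = (\<lambda>g f. (fst f, fst (snd g), compose (carrier (fst f)) (fn g) (fn f))) \<rparr>"

type_synonym ('i, 'j, 'l) dlat_diagram =
  "('i, 'j, 'l gorder, 'l gorder \<times> 'l gorder \<times> ('l \<Rightarrow> 'l)) functor_data"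

text \<open>The functor from the opposite of \<open>C\<close> to distributive lattices; an arrow \<open>f\<close> goes to
  \<open>f\<^sup>*\<close> from the subobjects of its codomain in \<open>C\<close> to those of its domain.\<close>

definition Sub_functor :: "('o, 'a) cat \<Rightarrow> ('o, 'a, 'a set) dlat_diagram" where
  "Sub_functor C = \<lparr> omap = Sub C,
     amap = (\<lambda>f. (Sub C (Cod C f), Sub C (Dom C f),
                  restrict (sub_pullback C f) (carrier (Sub C (Cod C f))))) \<rparr>"


section \<open>Colimits of bounded distributive lattices\<close>

text \<open>
  The colimit of a diagram is presented by generators and relations: lattice terms over the disjoint
  union of the lattices of the diagram, modulo the least preorder that satisfies the axioms of
  bounded distributive lattices, makes each coprojection a homomorphism, and identifies each element
  with its images along the arrows of the diagram. \<open>colim_universal\<close> below is the universal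
  property, for test lattices carried by an arbitrary type.
\<close>

datatype 'g lterm = Gen 'g | LBot | LTop | LMeet "'g lterm" "'g lterm" | LJoin "'g lterm" "'g lterm"

definition colim_terms ::
    "('i, 'j) cat \<Rightarrow> ('i, 'j, 'l) dlat_diagram \<Rightarrow> ('i \<times> 'l) lterm set" where
  "colim_terms J D = {t. set_lterm t \<subseteq> {(i, u). i \<in> Obj J \<and> u \<in> carrier (omap D i)}}"

inductive colim_le ::
    "('i, 'j) cat \<Rightarrow> ('i, 'j, 'l) dlat_diagram \<Rightarrow> ('i \<times> 'l) lterm \<Rightarrow> ('i \<times> 'l) lterm \<Rightarrow> bool"
  for J :: "('i, 'j) cat" and D :: "('i, 'j, 'l) dlat_diagram" where
  refl: "t \<in> colim_terms J D \<Longrightarrow> colim_le J D t t"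
| trans: "colim_le J D r s \<Longrightarrow> colim_le J D s t \<Longrightarrow> colim_le J D r t"
| bot: "t \<in> colim_terms J D \<Longrightarrow> colim_le J D LBot t"
| top: "t \<in> colim_terms J D \<Longrightarrow> colim_le J D t LTop"
| meet1: "s \<in> colim_terms J D \<Longrightarrow> t \<in> colim_terms J D \<Longrightarrow> colim_le J D (LMeet s t) s"
| meet2: "s \<in> colim_terms J D \<Longrightarrow> t \<in> colim_terms J D \<Longrightarrow> colim_le J D (LMeet s t) t"
| meet: "colim_le J D r s \<Longrightarrow> colim_le J D r t \<Longrightarrow> colim_le J D r (LMeet s t)"
| join1: "s \<in> colim_terms J D \<Longrightarrow> t \<in> colim_terms J D \<Longrightarrow> colim_le J D s (LJoin s t)"
| join2: "s \<in> colim_terms J D \<Longrightarrow> t \<in> colim_terms J D \<Longrightarrow> colim_le J D t (LJoin s t)"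
| join: "colim_le J D s r \<Longrightarrow> colim_le J D t r \<Longrightarrow> colim_le J D (LJoin s t) r"
| distrib: "r \<in> colim_terms J D \<Longrightarrow> s \<in> colim_terms J D \<Longrightarrow> t \<in> colim_terms J D \<Longrightarrow>
    colim_le J D (LMeet r (LJoin s t)) (LJoin (LMeet r s) (LMeet r t))"
| gen_mono: "i \<in> Obj J \<Longrightarrow> u \<in> carrier (omap D i) \<Longrightarrow> v \<in> carrier (omap D i) \<Longrightarrow>
    u \<sqsubseteq>\<^bsub>omap D i\<^esub> v \<Longrightarrow> colim_le J D (Gen (i, u)) (Gen (i, v))"
| gen_bot: "i \<in> Obj J \<Longrightarrow> colim_le J D (Gen (i, \<bottom>\<^bsub>omap D i\<^esub>)) LBot"
| gen_top: "i \<in> Obj J \<Longrightarrow> colim_le J D LTop (Gen (i, \<top>\<^bsub>omap D i\<^esub>))"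
| gen_meet: "i \<in> Obj J \<Longrightarrow> u \<in> carrier (omap D i) \<Longrightarrow> v \<in> carrier (omap D i) \<Longrightarrow>
    colim_le J D (LMeet (Gen (i, u)) (Gen (i, v))) (Gen (i, u \<sqinter>\<^bsub>omap D i\<^esub> v))"
| gen_join: "i \<in> Obj J \<Longrightarrow> u \<in> carrier (omap D i) \<Longrightarrow> v \<in> carrier (omap D i) \<Longrightarrow>
    colim_le J D (Gen (i, u \<squnion>\<^bsub>omap D i\<^esub> v)) (LJoin (Gen (i, u)) (Gen (i, v)))"
| gen_arr1: "f \<in> Hom J i j \<Longrightarrow> u \<in> carrier (omap D i) \<Longrightarrow>
    colim_le J D (Gen (i, u)) (Gen (j, fn (amap D f) u))"
| gen_arr2: "f \<in> Hom J i j \<Longrightarrow> u \<in> carrier (omap D i) \<Longrightarrow>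
    colim_le J D (Gen (j, fn (amap D f) u)) (Gen (i, u))"

definition colim_equiv ::
    "('i, 'j) cat \<Rightarrow> ('i, 'j, 'l) dlat_diagram \<Rightarrow> (('i \<times> 'l) lterm \<times> ('i \<times> 'l) lterm) set" where
  "colim_equiv J D = {(s, t). colim_le J D s t \<and> colim_le J D t s}"

definition dlat_colim ::
    "('i, 'j) cat \<Rightarrow> ('i, 'j, 'l) dlat_diagram \<Rightarrow> ('i \<times> 'l) lterm set gorder" where
  "dlat_colim J D = \<lparr> carrier = colim_terms J D // colim_equiv J D, eq = (=),
     le = (\<lambda>A B. \<exists>s\<in>A. \<exists>t\<in>B. colim_le J D s t) \<rparr>"

definition coproj ::
    "('i, 'j) cat \<Rightarrow> ('i, 'j, 'l) dlat_diagram \<Rightarrow> 'i \<Rightarrow> 'l \<Rightarrow> ('i \<times> 'l) lterm set" where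
  "coproj J D i u = colim_equiv J D `` {Gen (i, u)}"

definition LM :: "('o, 'a) cat \<Rightarrow> ('o, 'a, 'e) set_functor \<Rightarrow>
    (('o \<times> 'e) \<times> 'a set) lterm set gorder" where
  "LM C M = dlat_colim (op_cat (elements_cat C M)) (functor_comp (Sub_functor C) elements_proj)"


section \<open>The universal property of the colimit\<close>

lemma is_glbI:
  assumes "a \<in> carrier L" "b \<in> carrier L" "c \<in> carrier L" "c \<sqsubseteq>\<^bsub>L\<^esub> a" "c \<sqsubseteq>\<^bsub>L\<^esub> b"
    "\<And>r. r \<in> carrier L \<Longrightarrow> r \<sqsubseteq>\<^bsub>L\<^esub> a \<Longrightarrow> r \<sqsubseteq>\<^bsub>L\<^esub> b \<Longrightarrow> r \<sqsubseteq>\<^bsub>L\<^esub> c"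
  shows "is_glb L c {a, b}"
  using assms by (auto simp: greatest_def Lower_def)

lemma is_lubI:
  assumes "a \<in> carrier L" "b \<in> carrier L" "c \<in> carrier L" "a \<sqsubseteq>\<^bsub>L\<^esub> c" "b \<sqsubseteq>\<^bsub>L\<^esub> c"
    "\<And>r. r \<in> carrier L \<Longrightarrow> a \<sqsubseteq>\<^bsub>L\<^esub> r \<Longrightarrow> b \<sqsubseteq>\<^bsub>L\<^esub> r \<Longrightarrow> c \<sqsubseteq>\<^bsub>L\<^esub> r"
  shows "is_lub L c {a, b}"
  using assms by (auto simp: least_def Upper_def)

lemma dlat_two: "dlat two"
proof -
  have g: "is_lub two (x \<or> y) {x, y}" "is_glb two (x \<and> y) {x, y}" for x y
    by (auto simp: least_def greatest_def Upper_def Lower_def two_def)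
  interpret bounded_lattice two
    apply unfold_locales
    apply (auto simp: two_def)[8]
    using g apply blast
    using g apply blast
    apply (rule exI[of _ False], simp add: least_def two_def)
    apply (rule exI[of _ True], simp add: greatest_def two_def)
    done
  have j: "x \<squnion>\<^bsub>two\<^esub> y = (x \<or> y)" for x y
    using g(1)[of x y] sup_of_two_least[of x y] least_unique[of "x \<squnion>\<^bsub>two\<^esub> y" "Upper two {x,y}" "x \<or> y"]
    by (simp add: join_def eq_is_equal two_def)
  have m: "x \<sqinter>\<^bsub>two\<^esub> y = (x \<and> y)" for x y
    using g(2)[of x y] inf_of_two_greatest[of x y] greatest_unique[of "x \<sqinter>\<^bsub>two\<^esub> y" "Lower two {x,y}" "x \<and> y"]
    by (simp add: meet_def eq_is_equal two_def)
  show ?thesis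
    by unfold_locales (auto simp: j m)
qed

locale diagram =
  fixes J :: "('i, 'j) cat" and D :: "('i, 'j, 'l) dlat_diagram"
  assumes D: "is_functor J DLat_cat D"
begin

lemma obD: "i \<in> Obj J \<Longrightarrow> dlat (omap D i)"
  using D by (auto simp: is_functor_def DLat_cat_def)

lemma arD: "f \<in> Hom J i j \<Longrightarrow> i \<in> Obj J \<and> j \<in> Obj J \<and> dlat_hom (omap D i) (omap D j) (fn (amap D f))"
proof -
  assume f: "f \<in> Hom J i j"
  have c: "category J" and "amap D f \<in> Hom DLat_cat (omap D (Dom J f)) (omap D (Cod J f))"
    using D f by (auto simp: is_functor_def Hom_def)
  then have "dlat_hom (omap D i) (omap D j) (fn (amap D f))"
    using f by (cases "amap D f") (auto simp: DLat_cat_def Hom_def)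
  then show ?thesis using category.dom_closed[OF c] category.cod_closed[OF c] f by (auto simp: Hom_def)
qed

lemma botD: "i \<in> Obj J \<Longrightarrow> \<bottom>\<^bsub>omap D i\<^esub> \<in> carrier (omap D i)"
  using obD[of i] dlat.axioms(1) bounded_lattice.axioms(2)
    weak_partial_order_bottom.bottom_closed by blast
lemma topD: "i \<in> Obj J \<Longrightarrow> \<top>\<^bsub>omap D i\<^esub> \<in> carrier (omap D i)"
  using obD[of i] dlat.axioms(1) bounded_lattice.axioms(3)
    weak_partial_order_top.top_closed by blast
lemma lat: "i \<in> Obj J \<Longrightarrow> lattice (omap D i)"
  using obD[of i] dlat.axioms(1) bounded_lattice.axioms(1) by blast
lemma meetD: "i \<in> Obj J \<Longrightarrow> u \<in> carrier (omap D i) \<Longrightarrow> v \<in> carrier (omap D i) \<Longrightarrow> u \<sqinter>\<^bsub>omap D i\<^esub> v \<in> carrier (omap D i)"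
proof -
  assume a: "i \<in> Obj J" "u \<in> carrier (omap D i)" "v \<in> carrier (omap D i)"
  interpret lattice "omap D i" using lat a(1) .
  show ?thesis using a by simp
qed
lemma joinD: "i \<in> Obj J \<Longrightarrow> u \<in> carrier (omap D i) \<Longrightarrow> v \<in> carrier (omap D i) \<Longrightarrow> u \<squnion>\<^bsub>omap D i\<^esub> v \<in> carrier (omap D i)"
proof -
  assume a: "i \<in> Obj J" "u \<in> carrier (omap D i)" "v \<in> carrier (omap D i)"
  interpret lattice "omap D i" using lat a(1) .
  show ?thesis using a by simp
qed

lemma terms_simps [simp]:
  "Gen (i, u) \<in> colim_terms J D \<longleftrightarrow> i \<in> Obj J \<and> u \<in> carrier (omap D i)"
  "LBot \<in> colim_terms J D" "LTop \<in> colim_terms J D"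
  "LMeet s t \<in> colim_terms J D \<longleftrightarrow> s \<in> colim_terms J D \<and> t \<in> colim_terms J D"
  "LJoin s t \<in> colim_terms J D \<longleftrightarrow> s \<in> colim_terms J D \<and> t \<in> colim_terms J D"
  by (auto simp: colim_terms_def)

lemma le_terms: "colim_le J D s t \<Longrightarrow> s \<in> colim_terms J D \<and> t \<in> colim_terms J D"
  by (induction rule: colim_le.induct)
     (auto simp: botD topD meetD joinD dest!: arD simp: dlat_hom_def)

lemma equiv: "equiv (colim_terms J D) (colim_equiv J D)"
  unfolding equiv_def refl_on_def sym_def trans_def colim_equiv_def
  using le_terms by (auto intro: colim_le.refl colim_le.trans)

definition cl where "cl t = colim_equiv J D `` {t}"

lemma carr: "carrier (dlat_colim J D) = cl ` colim_terms J D"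
  by (auto simp: dlat_colim_def quotient_def cl_def)

lemma coproj_cl: "coproj J D i u = cl (Gen (i, u))"
  by (simp add: coproj_def cl_def)

lemma cl_carr: "t \<in> colim_terms J D \<Longrightarrow> cl t \<in> carrier (dlat_colim J D)"
  unfolding carr by (rule imageI)

lemma cl_le: 
  assumes "s \<in> colim_terms J D" "t \<in> colim_terms J D"
  shows "cl s \<sqsubseteq>\<^bsub>dlat_colim J D\<^esub> cl t \<longleftrightarrow> colim_le J D s t"
proof
  assume "cl s \<sqsubseteq>\<^bsub>dlat_colim J D\<^esub> cl t"
  then obtain s' t' where "colim_le J D s s'" "colim_le J D s' t'" "colim_le J D t' t"
    by (auto simp: dlat_colim_def colim_equiv_def cl_def)
  then show "colim_le J D s t" using colim_le.trans by blast
next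
  assume "colim_le J D s t"
  moreover have "s \<in> cl s" "t \<in> cl t" 
    using assms by (auto simp: colim_equiv_def cl_def intro: colim_le.refl)
  ultimately show "cl s \<sqsubseteq>\<^bsub>dlat_colim J D\<^esub> cl t"
    by (auto simp: dlat_colim_def)
qed

lemma cl_eq: "s \<in> colim_terms J D \<Longrightarrow> t \<in> colim_terms J D \<Longrightarrow>
  cl s = cl t \<longleftrightarrow> colim_le J D s t \<and> colim_le J D t s"
  using eq_equiv_class_iff[OF equiv] by (auto simp: colim_equiv_def cl_def)

lemma carrE:
  assumes "A \<in> carrier (dlat_colim J D)"
  obtains t where "t \<in> colim_terms J D" "A = cl t"
  using assms unfolding carr by (rule imageE)

lemma glb:
  assumes st: "s \<in> colim_terms J D" "t \<in> colim_terms J D"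
  shows "is_glb (dlat_colim J D) (cl (LMeet s t)) {cl s, cl t}"
proof (rule is_glbI)
  fix r assume r: "r \<in> carrier (dlat_colim J D)" "r \<sqsubseteq>\<^bsub>dlat_colim J D\<^esub> cl s" "r \<sqsubseteq>\<^bsub>dlat_colim J D\<^esub> cl t"
  from r(1) show "r \<sqsubseteq>\<^bsub>dlat_colim J D\<^esub> cl (LMeet s t)"
    by (rule carrE) (use r st colim_le.meet in \<open>simp add: cl_le\<close>)
qed (use st colim_le.meet1 colim_le.meet2 in \<open>simp_all add: cl_le cl_carr\<close>)

lemma lub:
  assumes st: "s \<in> colim_terms J D" "t \<in> colim_terms J D"
  shows "is_lub (dlat_colim J D) (cl (LJoin s t)) {cl s, cl t}"
proof (rule is_lubI)
  fix r assume r: "r \<in> carrier (dlat_colim J D)" "cl s \<sqsubseteq>\<^bsub>dlat_colim J D\<^esub> r" "cl t \<sqsubseteq>\<^bsub>dlat_colim J D\<^esub> r"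
  from r(1) show "cl (LJoin s t) \<sqsubseteq>\<^bsub>dlat_colim J D\<^esub> r"
    by (rule carrE) (use r st colim_le.join in \<open>simp add: cl_le\<close>)
qed (use st colim_le.join1 colim_le.join2 in \<open>simp_all add: cl_le cl_carr\<close>)

lemma po: "partial_order (dlat_colim J D)"
proof
  fix x y z assume "x \<in> carrier (dlat_colim J D)" "y \<in> carrier (dlat_colim J D)" "z \<in> carrier (dlat_colim J D)"
    and "x \<sqsubseteq>\<^bsub>dlat_colim J D\<^esub> y" "y \<sqsubseteq>\<^bsub>dlat_colim J D\<^esub> z"
  then show "x \<sqsubseteq>\<^bsub>dlat_colim J D\<^esub> z"
    by (auto simp: carr cl_le intro: colim_le.trans)
next
  fix x y assume "x \<in> carrier (dlat_colim J D)" "y \<in> carrier (dlat_colim J D)"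
    and "x \<sqsubseteq>\<^bsub>dlat_colim J D\<^esub> y" "y \<sqsubseteq>\<^bsub>dlat_colim J D\<^esub> x"
  then have "x = y" by (elim carrE) (simp add: cl_le cl_eq)
  then show "x .=\<^bsub>dlat_colim J D\<^esub> y" by (simp add: dlat_colim_def)
next
  fix x assume "x \<in> carrier (dlat_colim J D)"
  then show "x \<sqsubseteq>\<^bsub>dlat_colim J D\<^esub> x" by (auto simp: carr cl_le intro: colim_le.refl)
qed (simp_all add: dlat_colim_def)

lemma bl: "bounded_lattice (dlat_colim J D)"
proof -
  interpret partial_order "dlat_colim J D" by (rule po)
  show ?thesis
  proof unfold_locales
    show "\<exists>s. is_lub (dlat_colim J D) s {x, y}" if "x \<in> carrier (dlat_colim J D)" "y \<in> carrier (dlat_colim J D)" for x y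
      using that lub by (force simp: carr)
    show "\<exists>s. is_glb (dlat_colim J D) s {x, y}" if "x \<in> carrier (dlat_colim J D)" "y \<in> carrier (dlat_colim J D)" for x y
      using that glb by (force simp: carr)
    show "\<exists>x. least (dlat_colim J D) x (carrier (dlat_colim J D))"
      by (rule exI[of _ "cl LBot"]) (auto simp: least_def carr cl_le intro: colim_le.bot)
    show "\<exists>x. greatest (dlat_colim J D) x (carrier (dlat_colim J D))"
      by (rule exI[of _ "cl LTop"]) (auto simp: greatest_def carr cl_le intro: colim_le.top)
  qed
qed

sublocale K: bounded_lattice "dlat_colim J D" by (rule bl)

lemma cl_meet: "s \<in> colim_terms J D \<Longrightarrow> t \<in> colim_terms J D \<Longrightarrow>
  cl s \<sqinter>\<^bsub>dlat_colim J D\<^esub> cl t = cl (LMeet s t)"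
  using glb[of s t] K.inf_of_two_greatest[of "cl s" "cl t"] K.greatest_unique
  by (metis K.eq_is_equal meet_def carr imageI)

lemma cl_join: "s \<in> colim_terms J D \<Longrightarrow> t \<in> colim_terms J D \<Longrightarrow>
  cl s \<squnion>\<^bsub>dlat_colim J D\<^esub> cl t = cl (LJoin s t)"
  using lub[of s t] K.sup_of_two_least[of "cl s" "cl t"] K.least_unique
  by (metis K.eq_is_equal join_def carr imageI)

lemma cl_bot: "\<bottom>\<^bsub>dlat_colim J D\<^esub> = cl LBot"
  by (rule K.bottom_eq[symmetric]) (auto simp: carr cl_le intro: colim_le.bot)

lemma cl_top: "\<top>\<^bsub>dlat_colim J D\<^esub> = cl LTop"
  by (rule K.top_eq[symmetric]) (auto simp: carr cl_le intro: colim_le.top)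

lemma distrib_rev:
  assumes "r \<in> colim_terms J D" "s \<in> colim_terms J D" "t \<in> colim_terms J D"
  shows "colim_le J D (LJoin (LMeet r s) (LMeet r t)) (LMeet r (LJoin s t))"
  using assms
  by (intro colim_le.join colim_le.meet)
    (auto intro: colim_le.meet1 colim_le.trans[OF colim_le.meet2] colim_le.join1 colim_le.join2)

lemma dlat_colim: "dlat (dlat_colim J D)"
proof
  fix x y z assume "x \<in> carrier (dlat_colim J D)" "y \<in> carrier (dlat_colim J D)" "z \<in> carrier (dlat_colim J D)"
  then show "x \<sqinter>\<^bsub>dlat_colim J D\<^esub> (y \<squnion>\<^bsub>dlat_colim J D\<^esub> z) = (x \<sqinter>\<^bsub>dlat_colim J D\<^esub> y) \<squnion>\<^bsub>dlat_colim J D\<^esub> (x \<sqinter>\<^bsub>dlat_colim J D\<^esub> z)"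
    by (elim carrE) (simp add: cl_meet cl_join cl_eq colim_le.distrib distrib_rev)
qed

lemma coproj_hom: 
  assumes "i \<in> Obj J" shows "dlat_hom (omap D i) (dlat_colim J D) (coproj J D i)"
proof -
  interpret L: dlat "omap D i" using obD assms .
  note [simp] = botD topD meetD joinD assms
  show ?thesis
    unfolding dlat_hom_def coproj_cl
    by (auto simp: carr cl_bot cl_top cl_meet cl_join cl_eq L.meet_left L.meet_right L.join_left L.join_right
       intro!: colim_le.gen_bot colim_le.gen_top colim_le.bot colim_le.top
         colim_le.gen_meet colim_le.gen_join colim_le.meet colim_le.join
         colim_le.gen_mono)
qed

lemma coproj_arr:
  assumes "f \<in> Hom J i j" "u \<in> carrier (omap D i)"
  shows "coproj J D j (fn (amap D f) u) = coproj J D i u"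
  using colim_le.gen_arr1[OF assms] colim_le.gen_arr2[OF assms] le_terms
  unfolding coproj_cl by (metis cl_eq)

end

primrec lterm_eval :: "'k gorder \<Rightarrow> ('g \<Rightarrow> 'k) \<Rightarrow> 'g lterm \<Rightarrow> 'k" where
  "lterm_eval K h (Gen g) = h g"
| "lterm_eval K h LBot = \<bottom>\<^bsub>K\<^esub>"
| "lterm_eval K h LTop = \<top>\<^bsub>K\<^esub>"
| "lterm_eval K h (LMeet s t) = lterm_eval K h s \<sqinter>\<^bsub>K\<^esub> lterm_eval K h t"
| "lterm_eval K h (LJoin s t) = lterm_eval K h s \<squnion>\<^bsub>K\<^esub> lterm_eval K h t"

context diagram begin

lemma colim_universal:
  fixes K :: "'k gorder"
  assumes K: "dlat K"
    and h: "\<And>i. i \<in> Obj J \<Longrightarrow> dlat_hom (omap D i) K (h i)"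
    and cocone: "\<And>f i j u. f \<in> Hom J i j \<Longrightarrow> u \<in> carrier (omap D i) \<Longrightarrow>
      h j (fn (amap D f) u) = h i u"
  shows "\<exists>!k. k \<in> extensional (carrier (dlat_colim J D)) \<and> dlat_hom (dlat_colim J D) K k \<and>
    (\<forall>i\<in>Obj J. \<forall>u\<in>carrier (omap D i). k (coproj J D i u) = h i u)"
proof -
  interpret L: dlat K by (rule K)
  let ?e = "lterm_eval K (\<lambda>(i, u). h i u)"
  have hc [simp]: "h i u \<in> carrier K" if "i \<in> Obj J" "u \<in> carrier (omap D i)" for i u
    using h[of i] that by (auto simp: dlat_hom_def)
  have ec [simp]: "?e t \<in> carrier K" if "t \<in> colim_terms J D" for t
    using that by (induction t) auto
  have mono: "?e s \<sqsubseteq>\<^bsub>K\<^esub> ?e t" if "colim_le J D s t" for s t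
    using that
  proof (induction rule: colim_le.induct)
    case (trans r s t)
    show ?case using L.le_trans[OF trans.IH] le_terms[OF trans.hyps(1)] le_terms[OF trans.hyps(2)] by simp
  next
    case (meet r s t)
    then show ?case using le_terms[OF meet.hyps(1)] le_terms[OF meet.hyps(2)] by (simp add: L.meet_le)
  next
    case (join r s t)
    then show ?case using le_terms[OF join.hyps(1)] le_terms[OF join.hyps(2)] by (simp add: L.join_le)
  next
    case (distrib r s t)
    then show ?case by (simp add: L.distrib)
  next
    case (gen_mono i u v)
    interpret Li: dlat "omap D i" using obD gen_mono by blast
    have "h i u = h i (u \<sqinter>\<^bsub>omap D i\<^esub> v)"
      using gen_mono Li.le_iff_join[of u v] by simp
    also have "\<dots> = h i u \<sqinter>\<^bsub>K\<^esub> h i v" using gen_mono h by (auto simp: dlat_hom_def)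
    finally have "h i u \<sqsubseteq>\<^bsub>K\<^esub> h i v"
      using L.le_iff_join[OF hc[OF gen_mono(1,2)] hc[OF gen_mono(1,3)]] by simp
    then show ?case by simp
  next
    case (gen_arr1 f i j u)
    then show ?case using cocone[OF gen_arr1] arD[OF gen_arr1(1)] by simp
  next
    case (gen_arr2 f i j u)
    then show ?case using cocone[OF gen_arr2] arD[OF gen_arr2(1)] by simp
  next
    case (gen_bot i)
    then show ?case using h[OF gen_bot] by (simp add: dlat_hom_def)
  next
    case (gen_top i)
    then show ?case using h[OF gen_top] by (simp add: dlat_hom_def)
  next
    case (gen_meet i u v)
    then show ?case using h[OF gen_meet(1)] by (simp add: dlat_hom_def)
  next
    case (gen_join i u v)
    then show ?case using h[OF gen_join(1)] by (simp add: dlat_hom_def)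
  qed (simp_all add: L.meet_left L.meet_right L.join_left L.join_right)
  have eq: "?e s = ?e t" if "cl s = cl t" "s \<in> colim_terms J D" "t \<in> colim_terms J D" for s t
    using that mono cl_eq ec L.le_antisym by metis
  define k where "k = restrict (\<lambda>A. ?e (SOME t. t \<in> colim_terms J D \<and> cl t = A)) (carrier (dlat_colim J D))"
  have k: "k (cl t) = ?e t" if "t \<in> colim_terms J D" for t
    using that unfolding k_def carr
    by simp (metis (mono_tags, lifting) eq someI_ex)
  have "k \<in> extensional (carrier (dlat_colim J D)) \<and> dlat_hom (dlat_colim J D) K k \<and>
    (\<forall>i\<in>Obj J. \<forall>u\<in>carrier (omap D i). k (coproj J D i u) = h i u)"
    by (auto simp: dlat_hom_def cl_bot cl_top k carr cl_meet cl_join coproj_cl) (simp add: k_def carr)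
  moreover have "k' = k''"
    if k': "k' \<in> extensional (carrier (dlat_colim J D))" "dlat_hom (dlat_colim J D) K k'"
         "\<forall>i\<in>Obj J. \<forall>u\<in>carrier (omap D i). k' (coproj J D i u) = h i u"
     and k'': "k'' \<in> extensional (carrier (dlat_colim J D))" "dlat_hom (dlat_colim J D) K k''"
         "\<forall>i\<in>Obj J. \<forall>u\<in>carrier (omap D i). k'' (coproj J D i u) = h i u" for k' k''
  proof -
    have "k' (cl t) = k'' (cl t)" if "t \<in> colim_terms J D" for t
      using that
    proof (induction t)
      case (Gen g) then show ?case using k'(3) k''(3) by (cases g) (auto simp: coproj_cl)
    next
      case LBot then show ?case using k'(2) k''(2) by (simp add: dlat_hom_def cl_bot)
    next
      case LTop then show ?case using k'(2) k''(2) by (simp add: dlat_hom_def cl_top)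
    next
      case (LMeet s t) then show ?case using k'(2) k''(2) 
        by (simp add: dlat_hom_def carr cl_meet[symmetric])
    next
      case (LJoin s t) then show ?case using k'(2) k''(2) 
        by (simp add: dlat_hom_def carr cl_join[symmetric])
    qed
    then show ?thesis using k'(1) k''(1) by (intro extensionalityI[of _ "carrier (dlat_colim J D)"]) (auto simp: carr)
  qed
  ultimately show ?thesis by blast
qed

end


section \<open>Subobjects as a functor to distributive lattices\<close>

context category begin

lemma compA [simp]:
  assumes "f \<in> Arr C" "g \<in> Arr C" "Dom C g = Cod C f"
  shows "g \<cdot>\<^bsub>C\<^esub> f \<in> Arr C" "Dom C (g \<cdot>\<^bsub>C\<^esub> f) = Dom C f" "Cod C (g \<cdot>\<^bsub>C\<^esub> f) = Cod C g"
  using comp_closed[of f "Dom C f" "Cod C f" g "Cod C g"] assms by (auto simp: Hom_def)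

lemma assocA:
  assumes "f \<in> Arr C" "g \<in> Arr C" "h \<in> Arr C" "Dom C g = Cod C f" "Dom C h = Cod C g"
  shows "(h \<cdot>\<^bsub>C\<^esub> g) \<cdot>\<^bsub>C\<^esub> f = h \<cdot>\<^bsub>C\<^esub> (g \<cdot>\<^bsub>C\<^esub> f)"
  using comp_assoc[of f "Dom C f" "Cod C f" g "Cod C g" h "Cod C h"] assms by (auto simp: Hom_def)

lemma identA [simp]: "x \<in> Obj C \<Longrightarrow> Ident C x \<in> Arr C" "x \<in> Obj C \<Longrightarrow> Dom C (Ident C x) = x" "x \<in> Obj C \<Longrightarrow> Cod C (Ident C x) = x"
  using ident_closed by (auto simp: Hom_def)

lemma ident_compA [simp]: "f \<in> Arr C \<Longrightarrow> Cod C f = x \<Longrightarrow> Ident C x \<cdot>\<^bsub>C\<^esub> f = f"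
  and comp_identA [simp]: "f \<in> Arr C \<Longrightarrow> Dom C f = x \<Longrightarrow> f \<cdot>\<^bsub>C\<^esub> Ident C x = f"
  using ident_comp comp_ident by (auto simp: Hom_def)

lemma factorsE:
  assumes "factors C f m"
  obtains k where "f \<in> Arr C" "m \<in> Arr C" "Cod C f = Cod C m" "k \<in> Arr C" "Dom C k = Dom C f" "Cod C k = Dom C m" "f = m \<cdot>\<^bsub>C\<^esub> k"
  using assms unfolding factors_def Hom_def by auto

lemma factors_comp: "m \<in> Arr C \<Longrightarrow> k \<in> Arr C \<Longrightarrow> Dom C m = Cod C k \<Longrightarrow> factors C (m \<cdot>\<^bsub>C\<^esub> k) m"
  unfolding factors_def Hom_def by auto

lemma factors_refl: "m \<in> Arr C \<Longrightarrow> factors C m m"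
  using factors_comp[of m "Ident C (Dom C m)"] dom_closed[of m] by simp

lemma factors_trans:
  assumes fg: "factors C f g" and gh: "factors C g h" shows "factors C f h"
proof -
  from fg obtain k where k: "k \<in> Arr C" "Cod C k = Dom C g" "f = g \<cdot>\<^bsub>C\<^esub> k"
    by (elim factorsE)
  from gh obtain l where l: "h \<in> Arr C" "l \<in> Arr C" "Dom C l = Dom C g" "Cod C l = Dom C h" "g = h \<cdot>\<^bsub>C\<^esub> l"
    by (elim factorsE)
  have "f = h \<cdot>\<^bsub>C\<^esub> (l \<cdot>\<^bsub>C\<^esub> k)"
    unfolding k(3) by (subst l(5), rule assocA) (use k(1,2) l(1-4) in simp_all)
  moreover have "factors C (h \<cdot>\<^bsub>C\<^esub> (l \<cdot>\<^bsub>C\<^esub> k)) h"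
    by (rule factors_comp) (use k(1,2) l(1-4) in simp_all)
  ultimately show ?thesis by simp
qed

lemma factors_precomp:
  assumes "factors C f m" "k \<in> Arr C" "Dom C f = Cod C k"
  shows "factors C (f \<cdot>\<^bsub>C\<^esub> k) m"
  using factors_trans[OF factors_comp[of f k] assms(1)] assms by (auto elim: factorsE)

lemma factors_postcomp:
  assumes "factors C f m" "g \<in> Arr C" "Dom C g = Cod C m"
  shows "factors C (g \<cdot>\<^bsub>C\<^esub> f) (g \<cdot>\<^bsub>C\<^esub> m)"
  using assms(1)
proof (rule factorsE)
  fix k assume k: "f \<in> Arr C" "m \<in> Arr C" "k \<in> Arr C" "Dom C k = Dom C f" "Cod C k = Dom C m" "f = m \<cdot>\<^bsub>C\<^esub> k"
  then have "g \<cdot>\<^bsub>C\<^esub> f = (g \<cdot>\<^bsub>C\<^esub> m) \<cdot>\<^bsub>C\<^esub> k" using assms by (simp add: assocA)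
  then show ?thesis using factors_comp[of "g \<cdot>\<^bsub>C\<^esub> m" k] k assms by simp
qed

lemma monoD:
  assumes "is_mono C m" "u \<in> Arr C" "v \<in> Arr C" "Dom C u = Dom C v" "Cod C u = Dom C m" "Cod C v = Dom C m"
    "m \<cdot>\<^bsub>C\<^esub> u = m \<cdot>\<^bsub>C\<^esub> v"
  shows "u = v"
  using assms dom_closed[of u] unfolding is_mono_def Hom_def by auto

lemma monoI:
  assumes "m \<in> Arr C" "\<And>u v. u \<in> Arr C \<Longrightarrow> v \<in> Arr C \<Longrightarrow> Dom C u = Dom C v \<Longrightarrow> Cod C u = Dom C m \<Longrightarrow> Cod C v = Dom C m \<Longrightarrow>
    m \<cdot>\<^bsub>C\<^esub> u = m \<cdot>\<^bsub>C\<^esub> v \<Longrightarrow> u = v"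
  shows "is_mono C m"
  using assms unfolding is_mono_def Hom_def by auto

lemma mono_arr: "is_mono C m \<Longrightarrow> m \<in> Arr C" by (simp add: is_mono_def)

lemma mono_comp:
  assumes "is_mono C m" "is_mono C n" "Dom C m = Cod C n"
  shows "is_mono C (m \<cdot>\<^bsub>C\<^esub> n)"
proof (rule monoI)
  note [simp] = mono_arr[OF assms(1)] mono_arr[OF assms(2)] assms(3)
  show "m \<cdot>\<^bsub>C\<^esub> n \<in> Arr C" by simp
  fix u v assume a: "u \<in> Arr C" "v \<in> Arr C" "Dom C u = Dom C v" "Cod C u = Dom C (m \<cdot>\<^bsub>C\<^esub> n)" "Cod C v = Dom C (m \<cdot>\<^bsub>C\<^esub> n)"
    "(m \<cdot>\<^bsub>C\<^esub> n) \<cdot>\<^bsub>C\<^esub> u = (m \<cdot>\<^bsub>C\<^esub> n) \<cdot>\<^bsub>C\<^esub> v"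
  then have "m \<cdot>\<^bsub>C\<^esub> (n \<cdot>\<^bsub>C\<^esub> u) = m \<cdot>\<^bsub>C\<^esub> (n \<cdot>\<^bsub>C\<^esub> v)" by (simp add: assocA)
  then have "n \<cdot>\<^bsub>C\<^esub> u = n \<cdot>\<^bsub>C\<^esub> v" using a monoD[OF assms(1), of "n \<cdot>\<^bsub>C\<^esub> u" "n \<cdot>\<^bsub>C\<^esub> v"] by simp
  then show "u = v" using a monoD[OF assms(2), of u v] by simp
qed

lemma mono_ident: "x \<in> Obj C \<Longrightarrow> is_mono C (Ident C x)"
  by (rule monoI) auto

lemma pbD:
  assumes "is_pullback C f g p q"
  shows "f \<in> Arr C" "g \<in> Arr C" "p \<in> Arr C" "q \<in> Arr C" "Cod C f = Cod C g" "Cod C p = Dom C f" "Cod C q = Dom C g"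
    "Dom C q = Dom C p" "f \<cdot>\<^bsub>C\<^esub> p = g \<cdot>\<^bsub>C\<^esub> q"
  using assms unfolding is_pullback_def Hom_def by auto

lemma pb_ex:
  assumes "is_pullback C f g p q" "u \<in> Arr C" "v \<in> Arr C" "Dom C u = Dom C v" "Cod C u = Dom C f" "Cod C v = Dom C g"
    "f \<cdot>\<^bsub>C\<^esub> u = g \<cdot>\<^bsub>C\<^esub> v"
  shows "\<exists>!k. k \<in> Hom C (Dom C u) (Dom C p) \<and> p \<cdot>\<^bsub>C\<^esub> k = u \<and> q \<cdot>\<^bsub>C\<^esub> k = v"
  using assms dom_closed[of u] unfolding is_pullback_def Hom_def by auto

lemma pbI:
  assumes "f \<in> Arr C" "g \<in> Arr C" "p \<in> Arr C" "q \<in> Arr C" "Cod C f = Cod C g" "Cod C p = Dom C f" "Cod C q = Dom C g"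
    "Dom C q = Dom C p" "f \<cdot>\<^bsub>C\<^esub> p = g \<cdot>\<^bsub>C\<^esub> q"
    "\<And>u v. u \<in> Arr C \<Longrightarrow> v \<in> Arr C \<Longrightarrow> Dom C u = Dom C v \<Longrightarrow> Cod C u = Dom C f \<Longrightarrow> Cod C v = Dom C g \<Longrightarrow>
     f \<cdot>\<^bsub>C\<^esub> u = g \<cdot>\<^bsub>C\<^esub> v \<Longrightarrow> \<exists>!k. k \<in> Hom C (Dom C u) (Dom C p) \<and> p \<cdot>\<^bsub>C\<^esub> k = u \<and> q \<cdot>\<^bsub>C\<^esub> k = v"
  shows "is_pullback C f g p q"
proof -
  have "\<exists>!k. k \<in> Hom C w (Dom C p) \<and> p \<cdot>\<^bsub>C\<^esub> k = u \<and> q \<cdot>\<^bsub>C\<^esub> k = v"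
    if "u \<in> Hom C w (Dom C f)" "v \<in> Hom C w (Dom C g)" "f \<cdot>\<^bsub>C\<^esub> u = g \<cdot>\<^bsub>C\<^esub> v" for w u v
    using that assms(10)[of u v] by (simp add: Hom_def)
  moreover have "p \<in> Hom C (Dom C p) (Dom C f)" "q \<in> Hom C (Dom C p) (Dom C g)" using assms by (simp_all add: Hom_def)
  ultimately show ?thesis using assms(1,2,5,9) unfolding is_pullback_def by blast
qed

lemma pb_mono:
  assumes pb: "is_pullback C f m n q" and m: "is_mono C m"
  shows "is_mono C n"
proof (rule monoI)
  note [simp] = pbD(1-8)[OF pb]
  show "n \<in> Arr C" by simp
  fix u v assume a: "u \<in> Arr C" "v \<in> Arr C" "Dom C u = Dom C v" "Cod C u = Dom C n" "Cod C v = Dom C n" "n \<cdot>\<^bsub>C\<^esub> u = n \<cdot>\<^bsub>C\<^esub> v"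
  have "m \<cdot>\<^bsub>C\<^esub> (q \<cdot>\<^bsub>C\<^esub> u) = (f \<cdot>\<^bsub>C\<^esub> n) \<cdot>\<^bsub>C\<^esub> u" using a pbD(9)[OF pb] by (simp add: assocA[symmetric])
  also have "\<dots> = f \<cdot>\<^bsub>C\<^esub> (n \<cdot>\<^bsub>C\<^esub> u)" by (rule assocA) (use a in simp_all)
  also have "\<dots> = f \<cdot>\<^bsub>C\<^esub> (n \<cdot>\<^bsub>C\<^esub> v)" using a(6) by (rule arg_cong)
  also have "\<dots> = (f \<cdot>\<^bsub>C\<^esub> n) \<cdot>\<^bsub>C\<^esub> v" by (rule assocA[symmetric]) (use a in simp_all)
  also have "\<dots> = m \<cdot>\<^bsub>C\<^esub> (q \<cdot>\<^bsub>C\<^esub> v)" using a pbD(9)[OF pb] by (simp add: assocA[symmetric])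
  finally have "q \<cdot>\<^bsub>C\<^esub> u = q \<cdot>\<^bsub>C\<^esub> v" using a monoD[OF m, of "q \<cdot>\<^bsub>C\<^esub> u" "q \<cdot>\<^bsub>C\<^esub> v"] by simp
  moreover have "f \<cdot>\<^bsub>C\<^esub> (n \<cdot>\<^bsub>C\<^esub> u) = m \<cdot>\<^bsub>C\<^esub> (q \<cdot>\<^bsub>C\<^esub> u)" using a(1-5) pbD(9)[OF pb] by (simp add: assocA[symmetric])
  ultimately show "u = v" using pb_ex[OF pb, of "n \<cdot>\<^bsub>C\<^esub> u" "q \<cdot>\<^bsub>C\<^esub> u"] a by (auto simp: Hom_def)
qed

text \<open>An arrow factors through the pullback of \<open>m\<close> along \<open>f\<close> iff its composite with \<open>f\<close>
  factors through \<open>m\<close>.\<close>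

lemma pb_factors:
  assumes pb: "is_pullback C f m n q" and g: "g \<in> Arr C" "Cod C g = Dom C f"
  shows "factors C g n \<longleftrightarrow> factors C (f \<cdot>\<^bsub>C\<^esub> g) m"
proof
  note [simp] = pbD(1-8)[OF pb] g
  assume "factors C g n"
  then have "factors C (f \<cdot>\<^bsub>C\<^esub> g) (f \<cdot>\<^bsub>C\<^esub> n)" by (rule factors_postcomp) auto
  moreover have "factors C (f \<cdot>\<^bsub>C\<^esub> n) m" unfolding pbD(9)[OF pb] by (rule factors_comp) auto
  ultimately show "factors C (f \<cdot>\<^bsub>C\<^esub> g) m" by (rule factors_trans)
next
  note [simp] = pbD(1-8)[OF pb] g
  assume "factors C (f \<cdot>\<^bsub>C\<^esub> g) m"
  then obtain k where k: "k \<in> Arr C" "Dom C k = Dom C (f \<cdot>\<^bsub>C\<^esub> g)" "Cod C k = Dom C m" "f \<cdot>\<^bsub>C\<^esub> g = m \<cdot>\<^bsub>C\<^esub> k"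
    by (elim factorsE)
  have "Dom C k = Dom C g" using k(2) by simp
  with k(1,3,4) obtain l where "l \<in> Arr C" "Dom C l = Dom C g" "Cod C l = Dom C n" "n \<cdot>\<^bsub>C\<^esub> l = g"
    using pb_ex[OF pb, of g k] by (auto simp: Hom_def)
  then show "factors C g n" using factors_comp[of n l] by auto
qed

lemma pb_replace:
  assumes pb: "is_pullback C f m n q" and m: "is_mono C m" and n': "is_mono C n'" 
    and e: "factors C n n'" "factors C n' n"
  shows "\<exists>q'. is_pullback C f m n' q'"
proof -
  note [simp] = pbD(1-8)[OF pb]
  have [simp]: "n' \<in> Arr C" "Cod C n' = Dom C f" using e by (auto elim: factorsE)
  have "factors C (f \<cdot>\<^bsub>C\<^esub> n') m" using pb_factors[OF pb] e by simp
  then obtain q' where [simp]: "q' \<in> Arr C" and d: "Dom C q' = Dom C (f \<cdot>\<^bsub>C\<^esub> n')" and [simp]: "Cod C q' = Dom C m" and eq: "f \<cdot>\<^bsub>C\<^esub> n' = m \<cdot>\<^bsub>C\<^esub> q'"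
    by (elim factorsE)
  have [simp]: "Dom C q' = Dom C n'" using d by simp
  have "is_pullback C f m n' q'"
  proof (rule pbI)
    fix u v assume a: "u \<in> Arr C" "v \<in> Arr C" "Dom C u = Dom C v" "Cod C u = Dom C f" "Cod C v = Dom C m" "f \<cdot>\<^bsub>C\<^esub> u = m \<cdot>\<^bsub>C\<^esub> v"
    then have "factors C (f \<cdot>\<^bsub>C\<^esub> u) m" using factors_comp[of m v] by simp
    then have "factors C u n" using pb_factors[OF pb a(1,4)] by blast
    then have "factors C u n'" using factors_trans e(1) by blast
    then obtain k where k: "k \<in> Arr C" "Dom C k = Dom C u" "Cod C k = Dom C n'" "u = n' \<cdot>\<^bsub>C\<^esub> k"
      by (rule factorsE)
    have "m \<cdot>\<^bsub>C\<^esub> (q' \<cdot>\<^bsub>C\<^esub> k) = (m \<cdot>\<^bsub>C\<^esub> q') \<cdot>\<^bsub>C\<^esub> k"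
      by (rule assocA[symmetric]) (use k(1,3) in simp_all)
    also have "\<dots> = f \<cdot>\<^bsub>C\<^esub> (n' \<cdot>\<^bsub>C\<^esub> k)"
      unfolding eq[symmetric] by (rule assocA) (use k(1,3) in simp_all)
    also have "\<dots> = m \<cdot>\<^bsub>C\<^esub> v" using k(4) a(6) by simp
    finally have mm: "m \<cdot>\<^bsub>C\<^esub> (q' \<cdot>\<^bsub>C\<^esub> k) = m \<cdot>\<^bsub>C\<^esub> v" .
    have "q' \<cdot>\<^bsub>C\<^esub> k = v" by (rule monoD[OF m _ _ _ _ _ mm]) (use k(1-3) a(1-5) in simp_all)
    show "\<exists>!k. k \<in> Hom C (Dom C u) (Dom C n') \<and> n' \<cdot>\<^bsub>C\<^esub> k = u \<and> q' \<cdot>\<^bsub>C\<^esub> k = v"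
    proof (rule ex1I[of _ k])
      show "k \<in> Hom C (Dom C u) (Dom C n') \<and> n' \<cdot>\<^bsub>C\<^esub> k = u \<and> q' \<cdot>\<^bsub>C\<^esub> k = v"
        using k(1-3) unfolding k(4)[symmetric] \<open>q' \<cdot>\<^bsub>C\<^esub> k = v\<close> Hom_def by blast
      fix k' assume k': "k' \<in> Hom C (Dom C u) (Dom C n') \<and> n' \<cdot>\<^bsub>C\<^esub> k' = u \<and> q' \<cdot>\<^bsub>C\<^esub> k' = v"
      have nk: "n' \<cdot>\<^bsub>C\<^esub> k' = n' \<cdot>\<^bsub>C\<^esub> k" using k' unfolding k(4)[symmetric] by blast
      have "k' \<in> Arr C" "Dom C k' = Dom C u" "Cod C k' = Dom C n'" using k' by (simp_all add: Hom_def)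
      then show "k' = k" using k(1-3) by (intro monoD[OF n' _ _ _ _ _ nk]) simp_all
    qed
  qed (simp_all add: eq)
  then show ?thesis ..
qed

definition sc where "sc m = sub_equiv C (Cod C m) `` {m}"

lemma sub_carr: "carrier (Sub C x) = sc ` {m. is_mono C m \<and> Cod C m = x}"
  unfolding Sub_def sc_def quotient_def monos_into_def by auto

lemma sub_carrE:
  assumes "A \<in> carrier (Sub C x)" obtains m where "is_mono C m" "Cod C m = x" "A = sc m"
  using assms unfolding sub_carr by auto

lemma sc_carr [simp]: "is_mono C m \<Longrightarrow> Cod C m = x \<Longrightarrow> sc m \<in> carrier (Sub C x)"
  unfolding sub_carr by auto

lemma in_sc: "n \<in> sc m \<longleftrightarrow> is_mono C m \<and> is_mono C n \<and> factors C m n \<and> factors C n m"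
  unfolding sc_def sub_equiv_def monos_into_def by (auto elim: factorsE)

lemma sc_le: assumes "is_mono C m" "is_mono C n"
  shows "sc m \<sqsubseteq>\<^bsub>Sub C x\<^esub> sc n \<longleftrightarrow> factors C m n"
proof
  assume "sc m \<sqsubseteq>\<^bsub>Sub C x\<^esub> sc n"
  then obtain m' n' where "factors C m m'" "factors C m' n'" "factors C n' n"
    by (auto simp: Sub_def in_sc)
  then show "factors C m n" by (meson factors_trans)
next
  assume "factors C m n"
  moreover have "m \<in> sc m" "n \<in> sc n" using assms factors_refl mono_arr by (auto simp: in_sc)
  ultimately show "sc m \<sqsubseteq>\<^bsub>Sub C x\<^esub> sc n" unfolding Sub_def by auto
qed

lemma sc_eq: assumes "is_mono C m" "is_mono C n"
  shows "sc m = sc n \<longleftrightarrow> factors C m n \<and> factors C n m"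
proof
  assume "sc m = sc n"
  moreover have "m \<in> sc m" using assms factors_refl mono_arr by (auto simp: in_sc)
  ultimately have "m \<in> sc n" by simp
  then show "factors C m n \<and> factors C n m" by (simp add: in_sc)
next
  assume "factors C m n \<and> factors C n m"
  then show "sc m = sc n" using assms unfolding set_eq_iff in_sc by (meson factors_trans)
qed

lemma sub_po: "partial_order (Sub C x)"
proof
  fix X Y Z assume "X \<in> carrier (Sub C x)" "Y \<in> carrier (Sub C x)" "Z \<in> carrier (Sub C x)" "X \<sqsubseteq>\<^bsub>Sub C x\<^esub> Y" "Y \<sqsubseteq>\<^bsub>Sub C x\<^esub> Z"
  then show "X \<sqsubseteq>\<^bsub>Sub C x\<^esub> Z" by (elim sub_carrE) (auto simp: sc_le intro: factors_trans)
next
  fix X Y assume "X \<in> carrier (Sub C x)" "Y \<in> carrier (Sub C x)" "X \<sqsubseteq>\<^bsub>Sub C x\<^esub> Y" "Y \<sqsubseteq>\<^bsub>Sub C x\<^esub> X"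
  then have "X = Y" by (elim sub_carrE) (simp add: sc_le sc_eq)
  then show "X .=\<^bsub>Sub C x\<^esub> Y" by (simp add: Sub_def)
next
  fix X assume "X \<in> carrier (Sub C x)"
  then show "X \<sqsubseteq>\<^bsub>Sub C x\<^esub> X" by (elim sub_carrE) (simp add: sc_le factors_refl mono_arr)
qed (simp_all add: Sub_def)

lemma sub_pullback_sc:
  assumes pb: "is_pullback C f m n q" and m: "is_mono C m"
  shows "sub_pullback C f (sc m) = sc n"
proof
  have n: "is_mono C n" by (rule pb_mono[OF pb m])
  note [simp] = pbD(1-8)[OF pb]
  show "sub_pullback C f (sc m) \<subseteq> sc n"
  proof
    fix n' assume "n' \<in> sub_pullback C f (sc m)"
    then obtain m' q' where m': "m' \<in> sc m" and pb': "is_pullback C f m' n' q'" unfolding sub_pullback_def by blast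
    note [simp] = pbD(1-8)[OF pb']
    have mm: "factors C m m'" "factors C m' m" using m' by (simp_all add: in_sc)
    have "is_mono C n'" using pb_mono[OF pb'] m' by (simp add: in_sc)
    moreover have "factors C n n'"
      using pb_factors[OF pb', of n] pb_factors[OF pb, of n] factors_refl[of n] factors_trans[OF _ mm(1)] by simp
    moreover have "factors C n' n"
      using pb_factors[OF pb', of n'] pb_factors[OF pb, of n'] factors_refl[of n'] factors_trans[OF _ mm(2)] by simp
    ultimately show "n' \<in> sc n" using n by (simp add: in_sc)
  qed
  show "sc n \<subseteq> sub_pullback C f (sc m)"
  proof
    fix n' assume "n' \<in> sc n"
    then obtain q' where "is_pullback C f m n' q'" using pb_replace[OF pb m, of n'] by (auto simp: in_sc)
    moreover have "m \<in> sc m" using m factors_refl mono_arr by (auto simp: in_sc)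
    ultimately show "n' \<in> sub_pullback C f (sc m)" unfolding sub_pullback_def by blast
  qed
qed

end

context coherent_category begin

lemma pb_sc:
  assumes "f \<in> Arr C" "is_mono C m" "Cod C f = Cod C m"
  obtains n where "is_mono C n" "Cod C n = Dom C f" "sub_pullback C f (sc m) = sc n"
    "\<And>g. g \<in> Arr C \<Longrightarrow> Cod C g = Dom C f \<Longrightarrow> factors C g n \<longleftrightarrow> factors C (f \<cdot>\<^bsub>C\<^esub> g) m"
proof -
  obtain n q where pb: "is_pullback C f m n q" using has_pullbacks[of f m] assms mono_arr by blast
  show thesis using that[OF pb_mono[OF pb assms(2)] pbD(6)[OF pb] sub_pullback_sc[OF pb assms(2)] pb_factors[OF pb]] .
qed

lemma sub_glb:
  assumes "is_mono C m" "is_mono C n" "Cod C m = x" "Cod C n = x"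
  obtains k where "is_mono C k" "Cod C k = x" "is_glb (Sub C x) (sc k) {sc m, sc n}"
    "\<And>g. factors C g k \<longleftrightarrow> factors C g m \<and> factors C g n"
proof -
  obtain p where p: "is_mono C p" "Cod C p = Dom C m" 
    "\<And>g. g \<in> Arr C \<Longrightarrow> Cod C g = Dom C m \<Longrightarrow> factors C g p \<longleftrightarrow> factors C (m \<cdot>\<^bsub>C\<^esub> g) n"
    using pb_sc[of m n] assms mono_arr by metis
  note [simp] = mono_arr[OF assms(1)] mono_arr[OF assms(2)] mono_arr[OF p(1)] p(2) assms(3,4)
  let ?k = "m \<cdot>\<^bsub>C\<^esub> p"
  have k: "is_mono C ?k" by (rule mono_comp) (use assms p in auto)
  have km: "factors C ?k m" by (rule factors_comp) auto
  have kn: "factors C ?k n" using p(3)[of p] factors_refl[of p] by simp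
  have *: "factors C g ?k \<longleftrightarrow> factors C g m \<and> factors C g n" for g
  proof
    assume "factors C g ?k" then show "factors C g m \<and> factors C g n" using km kn factors_trans by blast
  next
    assume a: "factors C g m \<and> factors C g n"
    then obtain l where l: "l \<in> Arr C" "Cod C l = Dom C m" "g = m \<cdot>\<^bsub>C\<^esub> l" by (auto elim: factorsE)
    then have "factors C l p" using p(3)[of l] a by simp
    then show "factors C g ?k" unfolding l(3) by (rule factors_postcomp) auto
  qed
  have "is_glb (Sub C x) (sc ?k) {sc m, sc n}"
  proof (rule is_glbI)
    fix R assume "R \<in> carrier (Sub C x)" "R \<sqsubseteq>\<^bsub>Sub C x\<^esub> sc m" "R \<sqsubseteq>\<^bsub>Sub C x\<^esub> sc n"
    then show "R \<sqsubseteq>\<^bsub>Sub C x\<^esub> sc ?k" by (elim sub_carrE) (use assms k in \<open>simp add: sc_le *\<close>)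
  qed (use assms k km kn in \<open>simp_all add: sc_le\<close>)
  then show thesis using that[OF k _ _ *] by simp
qed

lemma sub_bl:
  assumes x: "x \<in> Obj C" shows "bounded_lattice (Sub C x)"
proof -
  interpret partial_order "Sub C x" by (rule sub_po)
  show ?thesis
  proof unfold_locales
    show "\<exists>s. is_lub (Sub C x) s {A, B}" if "A \<in> carrier (Sub C x)" "B \<in> carrier (Sub C x)" for A B
      using has_unions[OF x that] .
    show "\<exists>s. is_glb (Sub C x) s {A, B}" if "A \<in> carrier (Sub C x)" "B \<in> carrier (Sub C x)" for A B
      using that by (elim sub_carrE) (metis sub_glb)
    show "\<exists>Z. least (Sub C x) Z (carrier (Sub C x))" using has_least_sub[OF x] .
    have "A \<sqsubseteq>\<^bsub>Sub C x\<^esub> sc (Ident C x)" if "A \<in> carrier (Sub C x)" for A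
      using that
    proof (rule sub_carrE)
      fix m assume m: "is_mono C m" "Cod C m = x" "A = sc m"
      then show ?thesis using factors_comp[of "Ident C x" m] mono_arr[of m] mono_ident[OF x] x by (simp add: sc_le)
    qed
    then show "\<exists>x'. greatest (Sub C x) x' (carrier (Sub C x))"
      using mono_ident[OF x] x by (intro exI[of _ "sc (Ident C x)"]) (auto simp: greatest_def)
  qed
qed

lemma sub_top:
  assumes x: "x \<in> Obj C" shows "\<top>\<^bsub>Sub C x\<^esub> = sc (Ident C x)"
proof -
  interpret bounded_lattice "Sub C x" by (rule sub_bl[OF x])
  show ?thesis
  proof (rule top_eq[symmetric])
    show "sc (Ident C x) \<in> carrier (Sub C x)" using mono_ident[OF x] x by simp
    fix A assume "A \<in> carrier (Sub C x)"
    then show "A \<sqsubseteq>\<^bsub>Sub C x\<^esub> sc (Ident C x)"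
    proof (rule sub_carrE)
      fix m assume m: "is_mono C m" "Cod C m = x" "A = sc m"
      then show ?thesis using factors_comp[of "Ident C x" m] mono_arr[of m] mono_ident[OF x] x by (simp add: sc_le)
    qed
  qed
qed

lemma sub_meet:
  assumes "is_mono C m" "is_mono C n" "Cod C m = x" "Cod C n = x"
  obtains k where "is_mono C k" "Cod C k = x" "sc m \<sqinter>\<^bsub>Sub C x\<^esub> sc n = sc k"
    "\<And>g. factors C g k \<longleftrightarrow> factors C g m \<and> factors C g n"
proof -
  obtain k where k: "is_mono C k" "Cod C k = x" "is_glb (Sub C x) (sc k) {sc m, sc n}"
    "\<And>g. factors C g k \<longleftrightarrow> factors C g m \<and> factors C g n" using sub_glb[OF assms] by metis
  have x: "x \<in> Obj C" using assms cod_closed mono_arr by blast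
  interpret bounded_lattice "Sub C x" by (rule sub_bl[OF x])
  have "sc m \<sqinter>\<^bsub>Sub C x\<^esub> sc n = sc k"
    using inf_of_two_greatest[of "sc m" "sc n"] greatest_unique[OF _ k(3)] assms by (simp add: meet_def eq_is_equal)
  then show thesis using that k by blast
qed

lemma sub_join_eq:
  assumes x: "x \<in> Obj C" and "A \<in> carrier (Sub C x)" "B \<in> carrier (Sub C x)"
  shows "is_lub (Sub C x) U {A, B} \<longleftrightarrow> U = A \<squnion>\<^bsub>Sub C x\<^esub> B"
proof -
  interpret bounded_lattice "Sub C x" by (rule sub_bl[OF x])
  show ?thesis
    using sup_of_two_least[of A B] least_unique assms by (auto simp: join_def eq_is_equal)
qed

lemma pb_closed:
  assumes "f \<in> Hom C y x" "A \<in> carrier (Sub C x)"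
  shows "sub_pullback C f A \<in> carrier (Sub C y)"
  using assms(2)
proof (rule sub_carrE)
  fix m assume m: "is_mono C m" "Cod C m = x" "A = sc m"
  have fa: "f \<in> Arr C" "Cod C f = Cod C m" using assms(1) m by (simp_all add: Hom_def)
  obtain n where "is_mono C n" "Cod C n = Dom C f" "sub_pullback C f (sc m) = sc n"
    using pb_sc[OF fa(1) m(1) fa(2)] .
  then show ?thesis using m assms(1) by (simp add: Hom_def)
qed

lemma pb_join:
  assumes f: "f \<in> Hom C y x" and "A \<in> carrier (Sub C x)" "B \<in> carrier (Sub C x)"
  shows "sub_pullback C f (A \<squnion>\<^bsub>Sub C x\<^esub> B) = sub_pullback C f A \<squnion>\<^bsub>Sub C y\<^esub> sub_pullback C f B"
proof -
  have "x \<in> Obj C" "y \<in> Obj C" using f dom_closed cod_closed by (auto simp: Hom_def)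
  then show ?thesis using unions_stable[OF assms] sub_join_eq pb_closed assms by metis
qed

lemma sub_dlat:
  assumes x: "x \<in> Obj C" shows "dlat (Sub C x)"
proof -
  interpret bounded_lattice "Sub C x" by (rule sub_bl[OF x])
  show ?thesis
  proof
    fix A B E assume A: "A \<in> carrier (Sub C x)" and B: "B \<in> carrier (Sub C x)" and E: "E \<in> carrier (Sub C x)"
    let ?U = "(A \<sqinter>\<^bsub>Sub C x\<^esub> B) \<squnion>\<^bsub>Sub C x\<^esub> (A \<sqinter>\<^bsub>Sub C x\<^esub> E)"
    let ?V = "A \<sqinter>\<^bsub>Sub C x\<^esub> (B \<squnion>\<^bsub>Sub C x\<^esub> E)"
    have U: "?U \<in> carrier (Sub C x)" and BE: "B \<squnion>\<^bsub>Sub C x\<^esub> E \<in> carrier (Sub C x)" using A B E by simp_all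
    obtain m where m: "is_mono C m" "Cod C m = x" "A = sc m" using A by (rule sub_carrE)
    obtain w where w: "is_mono C w" "Cod C w = x" "B \<squnion>\<^bsub>Sub C x\<^esub> E = sc w" using BE by (rule sub_carrE)
    obtain u where u: "is_mono C u" "Cod C u = x" "?U = sc u" using U by (rule sub_carrE)
    have mh: "m \<in> Hom C (Dom C m) x" using m mono_arr by (auto simp: Hom_def)
    have y: "Dom C m \<in> Obj C" using m mono_arr dom_closed by blast
    interpret Y: bounded_lattice "Sub C (Dom C m)" by (rule sub_bl[OF y])
    have le: "sub_pullback C m B' \<sqsubseteq>\<^bsub>Sub C (Dom C m)\<^esub> sub_pullback C m ?U" if B': "B' = B \<or> B' = E" for B'
    proof -
      have "B' \<in> carrier (Sub C x)" using B E B' by auto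
      then obtain b where b: "is_mono C b" "Cod C b = x" "B' = sc b" by (rule sub_carrE)
      obtain b' where b': "is_mono C b'" "Cod C b' = Dom C m" "sub_pullback C m (sc b) = sc b'" 
         "\<And>g. g \<in> Arr C \<Longrightarrow> Cod C g = Dom C m \<Longrightarrow> factors C g b' \<longleftrightarrow> factors C (m \<cdot>\<^bsub>C\<^esub> g) b"
        using pb_sc[of m b] m b mono_arr by metis
      obtain u' where u': "is_mono C u'" "Cod C u' = Dom C m" "sub_pullback C m (sc u) = sc u'" 
         "\<And>g. g \<in> Arr C \<Longrightarrow> Cod C g = Dom C m \<Longrightarrow> factors C g u' \<longleftrightarrow> factors C (m \<cdot>\<^bsub>C\<^esub> g) u"
        using pb_sc[of m u] m u mono_arr by metis
      obtain k where k: "is_mono C k" "Cod C k = x" "sc m \<sqinter>\<^bsub>Sub C x\<^esub> sc b = sc k"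
         "\<And>g. factors C g k \<longleftrightarrow> factors C g m \<and> factors C g b" using sub_meet[OF m(1) b(1) m(2) b(2)] by metis
      have "A \<sqinter>\<^bsub>Sub C x\<^esub> B' \<sqsubseteq>\<^bsub>Sub C x\<^esub> ?U" using A B E B' join_left join_right by auto
      then have ku: "factors C k u" using u k b m by (simp add: sc_le)
      have "factors C (m \<cdot>\<^bsub>C\<^esub> b') k" using k(4) b'(4)[of b'] b'(1,2) factors_refl mono_arr m factors_comp by simp
      then have "factors C (m \<cdot>\<^bsub>C\<^esub> b') u" using ku factors_trans by blast
      then have "factors C b' u'" using u'(4)[of b'] b' mono_arr by simp
      then show ?thesis using u b u' b' by (simp add: sc_le)
    qed
    have "sub_pullback C m (B \<squnion>\<^bsub>Sub C x\<^esub> E) \<sqsubseteq>\<^bsub>Sub C (Dom C m)\<^esub> sub_pullback C m ?U"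
      unfolding pb_join[OF mh B E] using le[of B] le[of E] pb_closed[OF mh] B E U by (simp add: Y.join_le)
    moreover obtain w' where w': "is_mono C w'" "Cod C w' = Dom C m" "sub_pullback C m (sc w) = sc w'" 
         "\<And>g. g \<in> Arr C \<Longrightarrow> Cod C g = Dom C m \<Longrightarrow> factors C g w' \<longleftrightarrow> factors C (m \<cdot>\<^bsub>C\<^esub> g) w"
        using pb_sc[of m w] m w mono_arr by metis
    moreover obtain u' where u': "is_mono C u'" "Cod C u' = Dom C m" "sub_pullback C m (sc u) = sc u'" 
         "\<And>g. g \<in> Arr C \<Longrightarrow> Cod C g = Dom C m \<Longrightarrow> factors C g u' \<longleftrightarrow> factors C (m \<cdot>\<^bsub>C\<^esub> g) u"
        using pb_sc[of m u] m u mono_arr by metis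
    ultimately have wu: "factors C w' u'" using w u by (simp add: sc_le)
    obtain k where k: "is_mono C k" "Cod C k = x" "sc m \<sqinter>\<^bsub>Sub C x\<^esub> sc w = sc k"
         "\<And>g. factors C g k \<longleftrightarrow> factors C g m \<and> factors C g w" using sub_meet[OF m(1) w(1) m(2) w(2)] by metis
    have "factors C k m" "factors C k w" using k(4)[of k] factors_refl k(1) mono_arr by auto
    then obtain l where l: "l \<in> Arr C" "Cod C l = Dom C m" "k = m \<cdot>\<^bsub>C\<^esub> l" by (auto elim: factorsE)
    have "factors C l w'" using w'(4)[OF l(1,2)] \<open>factors C k w\<close> l(3) by simp
    then have "factors C l u'" using wu factors_trans by blast
    then have "factors C k u" using u'(4)[OF l(1,2)] l(3) by simp
    then have "?V \<sqsubseteq>\<^bsub>Sub C x\<^esub> ?U" using k u m w by (simp add: sc_le)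
    moreover have "?U \<sqsubseteq>\<^bsub>Sub C x\<^esub> ?V"
    proof -
      have "A \<sqinter>\<^bsub>Sub C x\<^esub> B \<sqsubseteq>\<^bsub>Sub C x\<^esub> ?V"
        by (rule meet_le) (use A B E in \<open>auto intro: meet_left le_trans[OF meet_right join_left]\<close>)
      moreover have "A \<sqinter>\<^bsub>Sub C x\<^esub> E \<sqsubseteq>\<^bsub>Sub C x\<^esub> ?V"
        by (rule meet_le) (use A B E in \<open>auto intro: meet_left le_trans[OF meet_right join_right]\<close>)
      ultimately show ?thesis using A B E by (simp add: join_le)
    qed
    ultimately show "?V = ?U" using le_antisym A B E by simp
  qed
qed

lemma pb_hom:
  assumes f: "f \<in> Hom C y x"
  shows "dlat_hom (Sub C x) (Sub C y) (sub_pullback C f)"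
proof -
  have fa: "f \<in> Arr C" "Dom C f = y" "Cod C f = x" and x: "x \<in> Obj C" and y: "y \<in> Obj C" using f dom_closed cod_closed by (auto simp: Hom_def)
  interpret X: bounded_lattice "Sub C x" by (rule sub_bl[OF x])
  interpret Y: bounded_lattice "Sub C y" by (rule sub_bl[OF y])
  have "sub_pullback C f \<bottom>\<^bsub>Sub C x\<^esub> = \<bottom>\<^bsub>Sub C y\<^esub>"
    using Y.least_unique[OF least_sub_stable[OF f X.bottom_least] Y.bottom_least] Y.eq_is_equal by simp
  moreover have "sub_pullback C f \<top>\<^bsub>Sub C x\<^esub> = \<top>\<^bsub>Sub C y\<^esub>"
  proof -
    obtain n where n: "is_mono C n" "Cod C n = y" "sub_pullback C f (sc (Ident C x)) = sc n" 
         "\<And>g. g \<in> Arr C \<Longrightarrow> Cod C g = y \<Longrightarrow> factors C g n \<longleftrightarrow> factors C (f \<cdot>\<^bsub>C\<^esub> g) (Ident C x)"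
      using pb_sc[of f "Ident C x"] mono_ident[OF x] x fa identA(3) by metis
    have "factors C f (Ident C x)" using factors_comp[of "Ident C x" f] fa x by simp
    then have "factors C (Ident C y) n" using n(4)[of "Ident C y"] y fa by simp
    moreover have "factors C n (Ident C y)" using factors_comp[of "Ident C y" n] n y mono_arr by simp
    ultimately show ?thesis using n mono_ident[OF y] by (simp add: sub_top x y sc_eq)
  qed
  moreover have "sub_pullback C f (A \<sqinter>\<^bsub>Sub C x\<^esub> B) = sub_pullback C f A \<sqinter>\<^bsub>Sub C y\<^esub> sub_pullback C f B"
    if A: "A \<in> carrier (Sub C x)" and B: "B \<in> carrier (Sub C x)" for A B
  proof -
    obtain a where a: "is_mono C a" "Cod C a = x" "A = sc a" using A by (rule sub_carrE)
    obtain b where b: "is_mono C b" "Cod C b = x" "B = sc b" using B by (rule sub_carrE)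
    obtain k where k: "is_mono C k" "Cod C k = x" "sc a \<sqinter>\<^bsub>Sub C x\<^esub> sc b = sc k"
      "\<And>g. factors C g k \<longleftrightarrow> factors C g a \<and> factors C g b" using sub_meet[OF a(1) b(1) a(2) b(2)] by metis
    obtain a' where a': "is_mono C a'" "Cod C a' = y" "sub_pullback C f (sc a) = sc a'" 
         "\<And>g. g \<in> Arr C \<Longrightarrow> Cod C g = y \<Longrightarrow> factors C g a' \<longleftrightarrow> factors C (f \<cdot>\<^bsub>C\<^esub> g) a"
      using pb_sc[of f a] fa a by metis
    obtain b' where b': "is_mono C b'" "Cod C b' = y" "sub_pullback C f (sc b) = sc b'" 
         "\<And>g. g \<in> Arr C \<Longrightarrow> Cod C g = y \<Longrightarrow> factors C g b' \<longleftrightarrow> factors C (f \<cdot>\<^bsub>C\<^esub> g) b"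
      using pb_sc[of f b] fa b by metis
    obtain k' where k': "is_mono C k'" "Cod C k' = y" "sub_pullback C f (sc k) = sc k'" 
         "\<And>g. g \<in> Arr C \<Longrightarrow> Cod C g = y \<Longrightarrow> factors C g k' \<longleftrightarrow> factors C (f \<cdot>\<^bsub>C\<^esub> g) k"
      using pb_sc[of f k] fa k by metis
    obtain l where l: "is_mono C l" "Cod C l = y" "sc a' \<sqinter>\<^bsub>Sub C y\<^esub> sc b' = sc l"
      "\<And>g. factors C g l \<longleftrightarrow> factors C g a' \<and> factors C g b'" using sub_meet[OF a'(1) b'(1) a'(2) b'(2)] by metis
    have *: "factors C g k' \<longleftrightarrow> factors C g l" if "g \<in> Arr C" "Cod C g = y" for g
      using that by (simp add: k'(4) l(4) a'(4) b'(4) k(4))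
    have "sc k' = sc l" using *[of k'] *[of l] l(1,2) k'(1,2) mono_arr factors_refl by (simp add: sc_eq)
    then show ?thesis using a b a'(3) b'(3) k(3) k'(3) l(3) by simp
  qed
  ultimately show ?thesis
    using pb_join[OF f] pb_closed[OF f] by (simp add: dlat_hom_def)
qed

lemma pb_ident:
  assumes x: "x \<in> Obj C" and A: "A \<in> carrier (Sub C x)"
  shows "sub_pullback C (Ident C x) A = A"
proof -
  obtain a where a: "is_mono C a" "Cod C a = x" "A = sc a" using A by (rule sub_carrE)
  obtain n where n: "is_mono C n" "Cod C n = x" "sub_pullback C (Ident C x) (sc a) = sc n" 
         "\<And>g. g \<in> Arr C \<Longrightarrow> Cod C g = x \<Longrightarrow> factors C g n \<longleftrightarrow> factors C (Ident C x \<cdot>\<^bsub>C\<^esub> g) a"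
    using pb_sc[of "Ident C x" a] x a by (metis identA)
  then show ?thesis using n(4)[of n] n(4)[of a] a mono_arr factors_refl by (simp add: sc_eq)
qed

lemma pb_comp:
  assumes f: "f \<in> Hom C z y" and g: "g \<in> Hom C y x" and A: "A \<in> carrier (Sub C x)"
  shows "sub_pullback C (g \<cdot>\<^bsub>C\<^esub> f) A = sub_pullback C f (sub_pullback C g A)"
proof -
  have [simp]: "f \<in> Arr C" "g \<in> Arr C" "Dom C f = z" "Cod C f = y" "Dom C g = y" "Cod C g = x" using f g by (auto simp: Hom_def)
  obtain a where a: "is_mono C a" "Cod C a = x" "A = sc a" using A by (rule sub_carrE)
  obtain n where n: "is_mono C n" "Cod C n = z" "sub_pullback C (g \<cdot>\<^bsub>C\<^esub> f) (sc a) = sc n" 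
         "\<And>h. h \<in> Arr C \<Longrightarrow> Cod C h = z \<Longrightarrow> factors C h n \<longleftrightarrow> factors C ((g \<cdot>\<^bsub>C\<^esub> f) \<cdot>\<^bsub>C\<^esub> h) a"
    using pb_sc[of "g \<cdot>\<^bsub>C\<^esub> f" a] a by auto
  obtain m where m: "is_mono C m" "Cod C m = y" "sub_pullback C g (sc a) = sc m" 
         "\<And>h. h \<in> Arr C \<Longrightarrow> Cod C h = y \<Longrightarrow> factors C h m \<longleftrightarrow> factors C (g \<cdot>\<^bsub>C\<^esub> h) a"
    using pb_sc[of g a] a by auto
  obtain l where l: "is_mono C l" "Cod C l = z" "sub_pullback C f (sc m) = sc l" 
         "\<And>h. h \<in> Arr C \<Longrightarrow> Cod C h = z \<Longrightarrow> factors C h l \<longleftrightarrow> factors C (f \<cdot>\<^bsub>C\<^esub> h) m"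
    using pb_sc[of f m] m by auto
  have *: "factors C h n \<longleftrightarrow> factors C h l" if "h \<in> Arr C" "Cod C h = z" for h
    using that by (simp add: n(4) l(4) m(4) assocA)
  have "sc n = sc l" using *[of n] *[of l] n(1,2) l(1,2) mono_arr factors_refl by (simp add: sc_eq)
  then show ?thesis using a n(3) m(3) l(3) by simp
qed

end

lemma category_op: "category C \<Longrightarrow> category (op_cat C)"
  unfolding category_def op_cat_def Hom_def by auto

lemma dlat_hom_comp:
  "dlat_hom L K h \<Longrightarrow> dlat_hom K N k \<Longrightarrow> dlat L \<Longrightarrow> dlat_hom L N (compose (carrier L) k h)"
proof -
  assume a: "dlat_hom L K h" "dlat_hom K N k" "dlat L"
  interpret dlat L by fact
  show ?thesis using a unfolding dlat_hom_def compose_def by (auto simp: Pi_iff)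
qed

lemma dlat_hom_id: "dlat L \<Longrightarrow> dlat_hom L L (restrict (\<lambda>a. a) (carrier L))"
proof -
  assume "dlat L"
  then interpret dlat L .
  show ?thesis unfolding dlat_hom_def by auto
qed

lemma category_DLat: "category DLat_cat"
proof
  fix L :: "'a gorder" and f assume "f \<in> Arr DLat_cat"
  then show "Dom DLat_cat f \<in> Obj DLat_cat" "Cod DLat_cat f \<in> Obj DLat_cat" by (auto simp: DLat_cat_def)
next
  fix L :: "'a gorder" assume "L \<in> Obj DLat_cat"
  then show "Ident DLat_cat L \<in> Hom DLat_cat L L" by (auto simp: DLat_cat_def Hom_def dlat_hom_id)
next
  fix L K N :: "'a gorder" and f g assume "f \<in> Hom DLat_cat L K" "g \<in> Hom DLat_cat K N"
  then show "g \<cdot>\<^bsub>DLat_cat\<^esub> f \<in> Hom DLat_cat L N"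
    by (auto simp: DLat_cat_def Hom_def compose_extensional intro: dlat_hom_comp)
next
  fix L K :: "'a gorder" and f assume f: "f \<in> Hom DLat_cat L K"
  then show "f \<cdot>\<^bsub>DLat_cat\<^esub> Ident DLat_cat L = f"
    by (auto simp: DLat_cat_def Hom_def compose_def restrict_def extensional_def)
  from f show "Ident DLat_cat K \<cdot>\<^bsub>DLat_cat\<^esub> f = f"
    by (auto simp: DLat_cat_def Hom_def dlat_hom_def intro!: Id_compose)
next
  fix L K N P :: "'a gorder" and f g h
  assume "f \<in> Hom DLat_cat L K" "g \<in> Hom DLat_cat K N" "h \<in> Hom DLat_cat N P"
  then show "(h \<cdot>\<^bsub>DLat_cat\<^esub> g) \<cdot>\<^bsub>DLat_cat\<^esub> f = h \<cdot>\<^bsub>DLat_cat\<^esub> (g \<cdot>\<^bsub>DLat_cat\<^esub> f)"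
    by (auto simp: DLat_cat_def Hom_def dlat_hom_def compose_assoc)
qed

lemma category_Set: "category Set_cat"
  by (unfold category_def Hom_def Set_cat_def)
    (auto simp: PiE_def extensional_def compose_def fun_eq_iff Pi_iff)

lemma (in coherent_category) Sub_functor: "is_functor (op_cat C) DLat_cat (Sub_functor C)"
proof -
  have "restrict (sub_pullback C (g \<cdot>\<^bsub>C\<^esub> f)) (carrier (Sub C (Cod C g))) =
      compose (carrier (Sub C (Cod C g))) (restrict (sub_pullback C f) (carrier (Sub C (Cod C f)))) (restrict (sub_pullback C g) (carrier (Sub C (Cod C g))))"
    if "f \<in> Arr C" "g \<in> Arr C" "Dom C g = Cod C f" for f g
    using that pb_closed[of g "Dom C g" "Cod C g"] pb_comp[of f "Dom C f" "Dom C g" g "Cod C g"]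
    by (auto simp: compose_def Hom_def fun_eq_iff restrict_def)
  moreover have "dlat_hom (Sub C (Cod C f)) (Sub C (Dom C f)) (restrict (sub_pullback C f) (carrier (Sub C (Cod C f))))"
    if f: "f \<in> Arr C" for f
  proof -
    interpret dlat "Sub C (Cod C f)" using sub_dlat cod_closed f by blast
    show ?thesis using pb_hom[of f "Dom C f" "Cod C f"] f unfolding dlat_hom_def by (auto simp: Hom_def)
  qed
  ultimately show ?thesis
    using category_op[OF category_axioms] category_DLat sub_dlat pb_ident dom_closed cod_closed
    unfolding is_functor_def
    by (auto simp: op_cat_def DLat_cat_def Sub_functor_def Hom_def cong: restrict_cong)
qed

lemma set_functorD:
  assumes "is_functor C Set_cat M"
  shows "x \<in> Obj C \<Longrightarrow> amap M (Ident C x) = (omap M x, omap M x, restrict (\<lambda>a. a) (omap M x))"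
    "f \<in> Hom C x y \<Longrightarrow> fn (amap M f) \<in> omap M x \<rightarrow>\<^sub>E omap M y"
    "f \<in> Hom C x y \<Longrightarrow> g \<in> Hom C y z \<Longrightarrow> a \<in> omap M x \<Longrightarrow> fn (amap M (g \<cdot>\<^bsub>C\<^esub> f)) a = fn (amap M g) (fn (amap M f) a)"
proof -
  show "x \<in> Obj C \<Longrightarrow> amap M (Ident C x) = (omap M x, omap M x, restrict (\<lambda>a. a) (omap M x))"
    using assms by (auto simp: is_functor_def Set_cat_def)
  have *: "f \<in> Hom C x y \<Longrightarrow> amap M f \<in> Hom Set_cat (omap M x) (omap M y)" for f x y
    using assms by (auto simp: is_functor_def Hom_def)
  show "f \<in> Hom C x y \<Longrightarrow> fn (amap M f) \<in> omap M x \<rightarrow>\<^sub>E omap M y"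
    using *[of f x y] by (auto simp: Set_cat_def Hom_def)
  assume f: "f \<in> Hom C x y" and g: "g \<in> Hom C y z" and a: "a \<in> omap M x"
  have "amap M (g \<cdot>\<^bsub>C\<^esub> f) = amap M g \<cdot>\<^bsub>Set_cat\<^esub> amap M f"
    using assms f g by (auto simp: is_functor_def Hom_def)
  moreover have "fst (amap M f) = omap M x" using *[OF f] by (auto simp: Set_cat_def Hom_def)
  ultimately show "fn (amap M (g \<cdot>\<^bsub>C\<^esub> f)) a = fn (amap M g) (fn (amap M f) a)"
    using a by (simp add: Set_cat_def compose_def)
qed

lemma category_elements:
  assumes M: "is_functor C Set_cat M" shows "category (elements_cat C M)"
proof -
  interpret category C using M by (simp add: is_functor_def)
  have [simp]: "f \<in> Arr C \<Longrightarrow> a \<in> omap M (Dom C f) \<Longrightarrow> fn (amap M f) a \<in> omap M (Cod C f)" for f a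
    using set_functorD(2)[OF M, of f "Dom C f" "Cod C f"] by (auto simp: Hom_def)
  have [simp]: "f \<in> Arr C \<Longrightarrow> g \<in> Arr C \<Longrightarrow> Dom C g = Cod C f \<Longrightarrow> a \<in> omap M (Dom C f) \<Longrightarrow> fn (amap M (g \<cdot>\<^bsub>C\<^esub> f)) a = fn (amap M g) (fn (amap M f) a)" for f g a
    using set_functorD(3)[OF M, of f "Dom C f" "Cod C f" g "Cod C g" a] by (auto simp: Hom_def)
  show ?thesis
    by (unfold_locales) (auto simp: elements_cat_def Hom_def dom_closed cod_closed set_functorD(1)[OF M] assocA)
qed

lemma functor_compI: "is_functor A B F \<Longrightarrow> is_functor B E G \<Longrightarrow> is_functor A E (functor_comp G F)"
  unfolding is_functor_def functor_comp_def Hom_def by auto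

lemma functor_op: "is_functor A B F \<Longrightarrow> is_functor (op_cat A) (op_cat B) F"
  using category_op[of A] category_op[of B] unfolding is_functor_def by (auto simp: op_cat_def Hom_def)

lemma elements_proj_functor:
  assumes M: "is_functor C Set_cat M" shows "is_functor (elements_cat C M) C elements_proj"
  using category_elements[OF M] M unfolding is_functor_def
  by (auto simp: elements_cat_def elements_proj_def Hom_def)

lemma (in coherent_category) LM_diagram:
  assumes M: "is_functor C Set_cat M"
  shows "is_functor (op_cat (elements_cat C M)) DLat_cat (functor_comp (Sub_functor C) elements_proj)"
  using functor_compI[OF functor_op[OF elements_proj_functor[OF M]] Sub_functor] .

end

theory Submission
  imports Defs
begin

text \<open>
  Write \<open>[x, a, \<phi>]\<close> for the element of the colimit \<open>LM\<close> given by a subobject \<open>\<phi>\<close> of \<open>x\<close> placed at the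
  element \<open>a \<in> M x\<close>. Since \<open>M\<close> preserves finite limits, least subobjects and unions, sending
  \<open>[x, a, \<phi>]\<close> to the truth value of \<open>a \<in> M \<phi>\<close> is a well-defined homomorphism from \<open>LM\<close> to the
  two-element lattice (\<open>evaluation_hom\<close>). So \<open>LM\<close> is never degenerate, and it is the two-element
  lattice iff all its elements are \<open>\<top>\<close> or \<open>\<bottom>\<close>; as the elements \<open>[x, a, \<phi>]\<close> generate, it suffices
  to look at those (\<open>LM_trivial_iff_cls\<close>).

  If \<open>a \<in> M \<phi>\<close>, then \<open>[x, a, \<phi>] = \<top>\<close>: moving along a monomorphism that represents \<open>\<phi>\<close> turns
  \<open>\<phi>\<close> into the whole object (\<open>cls_top\<close>). So positive closedness comes down to the question when
  \<open>[x, a, \<phi>] = \<bottom>\<close>, and \<open>cls_bottom_iff\<close> answers it: exactly when some \<open>\<psi>\<close> disjoint from \<open>\<phi>\<close>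
  has \<open>a \<in> M \<psi>\<close>. If there is such a \<open>\<psi>\<close>, then
  \<open>[x, a, \<phi>] = [x, a, \<psi>] \<sqinter> [x, a, \<phi>] = [x, a, \<psi> \<sqinter> \<phi>] = \<bottom>\<close>. The converse has two
  ingredients. As \<open>M\<close> preserves finite limits, its category of elements is cofiltered, so the
  colimit is filtered, and an element of a filtered colimit that is \<open>\<bottom>\<close> is already \<open>\<bottom>\<close> at some
  stage (\<open>coproj_eq_bottomD\<close>): there are \<open>f : y \<rightarrow> x\<close> and \<open>b \<in> M y\<close> with \<open>M f b = a\<close> and
  \<open>f\<^sup>* \<phi> = \<bottom>\<close>. Stability of covers then makes the image of \<open>f\<close> disjoint from \<open>\<phi>\<close>
  (\<open>image_disjoint\<close>), and \<open>a\<close> lies in the image under \<open>M\<close> of that image.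
\<close>


section \<open>Vanishing in a directed colimit\<close>

lemma finite_set_lterm: "finite (set_lterm t)"
  by (induction t) auto

text \<open>
  The index category is filtered, except that it may be empty. The aim is to compare the syntactic
  presentation of the colimit, whose order is an inductively generated preorder on lattice terms,
  with what happens at single stages of the diagram.
\<close>

locale directed_diagram = diagram J D
  for J :: "('i, 'j) cat" and D :: "('i, 'j, 'l) dlat_diagram" +
  assumes bound: "i \<in> Obj J \<Longrightarrow> j \<in> Obj J \<Longrightarrow> \<exists>k f g. f \<in> Hom J i k \<and> g \<in> Hom J j k"
    and coequalize: "f \<in> Hom J i j \<Longrightarrow> g \<in> Hom J i j \<Longrightarrow>
      \<exists>k h. h \<in> Hom J j k \<and> h \<cdot>\<^bsub>J\<^esub> f = h \<cdot>\<^bsub>J\<^esub> g"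
begin

sublocale category J
  using D by (simp add: is_functor_def)

abbreviation act :: "'j \<Rightarrow> 'l \<Rightarrow> 'l" where
  "act f \<equiv> fn (amap D f)"

lemma act_closed:
  "f \<in> Hom J i j \<Longrightarrow> u \<in> carrier (omap D i) \<Longrightarrow> act f u \<in> carrier (omap D j)"
  using arD[of f i j] by (auto simp: dlat_hom_def)

lemma act_comp:
  assumes "f \<in> Hom J i j" "g \<in> Hom J j k" "u \<in> carrier (omap D i)"
  shows "act (g \<cdot>\<^bsub>J\<^esub> f) u = act g (act f u)"
proof -
  have "amap D (g \<cdot>\<^bsub>J\<^esub> f) = amap D g \<cdot>\<^bsub>DLat_cat\<^esub> amap D f"
    using D assms by (auto simp: is_functor_def Hom_def)
  moreover have "amap D f \<in> Hom DLat_cat (omap D i) (omap D j)"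
    using D assms by (auto simp: is_functor_def Hom_def)
  ultimately show ?thesis
    using assms(3) by (auto simp: DLat_cat_def Hom_def compose_def)
qed

lemma act_ident:
  assumes "i \<in> Obj J" "u \<in> carrier (omap D i)"
  shows "act (Ident J i) u = u"
proof -
  have "amap D (Ident J i) = Ident DLat_cat (omap D i)"
    using D assms by (auto simp: is_functor_def)
  then show ?thesis using assms(2) by (simp add: DLat_cat_def)
qed

lemma act_mono:
  assumes f: "f \<in> Hom J i j" and u: "u \<in> carrier (omap D i)" and v: "v \<in> carrier (omap D i)"
    and le: "u \<sqsubseteq>\<^bsub>omap D i\<^esub> v"
  shows "act f u \<sqsubseteq>\<^bsub>omap D j\<^esub> act f v"
proof -
  have h: "i \<in> Obj J" "j \<in> Obj J" "dlat_hom (omap D i) (omap D j) (act f)"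
    using arD[OF f] by auto
  interpret I: dlat "omap D i" using obD h(1) .
  interpret K: dlat "omap D j" using obD h(2) .
  have "u = u \<sqinter>\<^bsub>omap D i\<^esub> v" using I.le_iff_join[OF u v] le by simp
  then have "act f u = act f u \<sqinter>\<^bsub>omap D j\<^esub> act f v"
    using h(3) u v by (metis dlat_hom_def)
  then show ?thesis
    using K.le_iff_join act_closed[OF f] u v by simp
qed

lemma span_completion:
  assumes f: "f \<in> Hom J i j" and g: "g \<in> Hom J i k"
  obtains m p q where "p \<in> Hom J j m" "q \<in> Hom J k m" "p \<cdot>\<^bsub>J\<^esub> f = q \<cdot>\<^bsub>J\<^esub> g"
proof -
  have "j \<in> Obj J" "k \<in> Obj J" using arD f g by blast+
  then obtain n a b where ab: "a \<in> Hom J j n" "b \<in> Hom J k n" using bound by blast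
  obtain m h where h: "h \<in> Hom J n m" "h \<cdot>\<^bsub>J\<^esub> (a \<cdot>\<^bsub>J\<^esub> f) = h \<cdot>\<^bsub>J\<^esub> (b \<cdot>\<^bsub>J\<^esub> g)"
    using coequalize[OF comp_closed[OF f ab(1)] comp_closed[OF g ab(2)]] by blast
  show thesis
  proof (rule that)
    show "h \<cdot>\<^bsub>J\<^esub> a \<in> Hom J j m" "h \<cdot>\<^bsub>J\<^esub> b \<in> Hom J k m"
      using comp_closed ab h(1) by blast+
    show "(h \<cdot>\<^bsub>J\<^esub> a) \<cdot>\<^bsub>J\<^esub> f = (h \<cdot>\<^bsub>J\<^esub> b) \<cdot>\<^bsub>J\<^esub> g"
      using h(2) comp_assoc[OF f ab(1) h(1)] comp_assoc[OF g ab(2) h(1)] by simp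
  qed
qed

text \<open>
  The order of the filtered colimit, seen from a stage \<open>k\<close>: the inequality holds after transport
  to some later stage.
\<close>

definition eventually_le :: "'i \<Rightarrow> 'l \<Rightarrow> 'l \<Rightarrow> bool" where
  "eventually_le k u v \<longleftrightarrow> (\<exists>m. \<exists>g\<in>Hom J k m. act g u \<sqsubseteq>\<^bsub>omap D m\<^esub> act g v)"

lemma eventually_leI:
  assumes "k \<in> Obj J" "u \<in> carrier (omap D k)" "v \<in> carrier (omap D k)" "u \<sqsubseteq>\<^bsub>omap D k\<^esub> v"
  shows "eventually_le k u v"
  unfolding eventually_le_def
  using assms ident_closed[OF assms(1)] by (intro exI[of _ k] bexI[of _ "Ident J k"]) (simp_all add: act_ident)

lemma eventually_le_later:
  assumes "g \<in> Hom J k m" "u \<in> carrier (omap D k)" "v \<in> carrier (omap D k)"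
    and "eventually_le m (act g u) (act g v)"
  shows "eventually_le k u v"
proof -
  obtain n h where h: "h \<in> Hom J m n" "act h (act g u) \<sqsubseteq>\<^bsub>omap D n\<^esub> act h (act g v)"
    using assms(4) unfolding eventually_le_def by blast
  then have "act (h \<cdot>\<^bsub>J\<^esub> g) u \<sqsubseteq>\<^bsub>omap D n\<^esub> act (h \<cdot>\<^bsub>J\<^esub> g) v"
    using act_comp[OF assms(1) h(1)] assms(2,3) by simp
  then show ?thesis unfolding eventually_le_def using comp_closed[OF assms(1) h(1)] by blast
qed

text \<open>
  Two inequalities that become true along different arrows out of \<open>k\<close> become true together,
  because the two arrows can be completed to a commutative square.
\<close>

lemma eventually_le_common:
  assumes uv: "eventually_le k u v" "u \<in> carrier (omap D k)" "v \<in> carrier (omap D k)"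
    and st: "eventually_le k s t" "s \<in> carrier (omap D k)" "t \<in> carrier (omap D k)"
  obtains m g where "g \<in> Hom J k m" "act g u \<sqsubseteq>\<^bsub>omap D m\<^esub> act g v" "act g s \<sqsubseteq>\<^bsub>omap D m\<^esub> act g t"
proof -
  obtain a f where f: "f \<in> Hom J k a" "act f u \<sqsubseteq>\<^bsub>omap D a\<^esub> act f v"
    using uv unfolding eventually_le_def by blast
  obtain b h where h: "h \<in> Hom J k b" "act h s \<sqsubseteq>\<^bsub>omap D b\<^esub> act h t"
    using st unfolding eventually_le_def by blast
  obtain m p q where pq: "p \<in> Hom J a m" "q \<in> Hom J b m" "p \<cdot>\<^bsub>J\<^esub> f = q \<cdot>\<^bsub>J\<^esub> h"
    using span_completion[OF f(1) h(1)] .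
  show thesis
  proof (rule that)
    show "p \<cdot>\<^bsub>J\<^esub> f \<in> Hom J k m" using comp_closed[OF f(1) pq(1)] .
    show "act (p \<cdot>\<^bsub>J\<^esub> f) u \<sqsubseteq>\<^bsub>omap D m\<^esub> act (p \<cdot>\<^bsub>J\<^esub> f) v"
      using act_mono[OF pq(1)] f uv act_closed[OF f(1)] act_comp[OF f(1) pq(1)] by simp
    show "act (p \<cdot>\<^bsub>J\<^esub> f) s \<sqsubseteq>\<^bsub>omap D m\<^esub> act (p \<cdot>\<^bsub>J\<^esub> f) t"
      unfolding pq(3)
      using act_mono[OF pq(2)] h st act_closed[OF h(1)] act_comp[OF h(1) pq(2)] by simp
  qed
qed

text \<open>
  At a stage that receives both ends of an arrow \<open>f\<close>, a generator and its transport along \<open>f\<close> may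
  have different values, as \<open>a\<close> and \<open>b \<cdot> f\<close> may differ; coequalizing these two arrows identifies
  the values at a later stage.
\<close>

lemma eventually_eq_along:
  assumes f: "f \<in> Hom J i j" and u: "u \<in> carrier (omap D i)"
    and a: "a \<in> Hom J i k" and b: "b \<in> Hom J j k"
  shows "eventually_le k (act a u) (act b (act f u))" "eventually_le k (act b (act f u)) (act a u)"
proof -
  have bf: "b \<cdot>\<^bsub>J\<^esub> f \<in> Hom J i k" using comp_closed[OF f b] .
  obtain m h where h: "h \<in> Hom J k m" "h \<cdot>\<^bsub>J\<^esub> a = h \<cdot>\<^bsub>J\<^esub> (b \<cdot>\<^bsub>J\<^esub> f)"
    using coequalize[OF a bf] by blast
  have "act h (act a u) = act h (act b (act f u))"
    using h(2) act_comp[OF a h(1) u] act_comp[OF bf h(1) u] act_comp[OF f b u] by simp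
  moreover interpret N: dlat "omap D m" using obD arD[OF h(1)] by blast
  have "act h (act a u) \<in> carrier (omap D m)" using act_closed[OF h(1) act_closed[OF a u]] .
  ultimately show "eventually_le k (act a u) (act b (act f u))" "eventually_le k (act b (act f u)) (act a u)"
    unfolding eventually_le_def using h(1) N.le_refl by metis+
qed

text \<open>
  A term mentions elements at finitely many indices. Once arrows from all these indices to one
  stage \<open>k\<close> have been chosen, the term has a value in the lattice at \<open>k\<close>. The arrows are given by
  a total function, of which only the values at the indices in the term matter.
\<close>

definition stage_value :: "'i \<Rightarrow> ('i \<Rightarrow> 'j) \<Rightarrow> ('i \<times> 'l) lterm \<Rightarrow> 'l" where
  "stage_value k l = lterm_eval (omap D k) (\<lambda>(i, u). act (l i) u)"

definition legs :: "'i \<Rightarrow> ('i \<Rightarrow> 'j) \<Rightarrow> ('i \<times> 'l) lterm \<Rightarrow> bool" where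
  "legs k l t \<longleftrightarrow> (\<forall>i\<in>fst ` set_lterm t. l i \<in> Hom J i k)"

lemma legs_simps [simp]:
  "legs k l (Gen (i, u)) \<longleftrightarrow> l i \<in> Hom J i k"
  "legs k l LBot" "legs k l LTop"
  "legs k l (LMeet s t) \<longleftrightarrow> legs k l s \<and> legs k l t"
  "legs k l (LJoin s t) \<longleftrightarrow> legs k l s \<and> legs k l t"
  by (auto simp: legs_def)

lemma stage_value_simps [simp]:
  "stage_value k l (Gen (i, u)) = act (l i) u"
  "stage_value k l LBot = \<bottom>\<^bsub>omap D k\<^esub>" "stage_value k l LTop = \<top>\<^bsub>omap D k\<^esub>"
  "stage_value k l (LMeet s t) = stage_value k l s \<sqinter>\<^bsub>omap D k\<^esub> stage_value k l t"
  "stage_value k l (LJoin s t) = stage_value k l s \<squnion>\<^bsub>omap D k\<^esub> stage_value k l t"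
  by (simp_all add: stage_value_def)

lemma stage_value_closed:
  assumes "k \<in> Obj J" "t \<in> colim_terms J D" "legs k l t"
  shows "stage_value k l t \<in> carrier (omap D k)"
  using assms(2,3)
proof (induction t)
  case (Gen g)
  then show ?case by (cases g) (auto intro: act_closed)
qed (use assms(1) in \<open>auto intro: botD topD meetD joinD\<close>)

lemma stage_value_later:
  assumes g: "g \<in> Hom J k m" and t: "t \<in> colim_terms J D" "legs k l t"
    and l': "\<And>i. i \<in> fst ` set_lterm t \<Longrightarrow> l' i = g \<cdot>\<^bsub>J\<^esub> l i"
  shows "act g (stage_value k l t) = stage_value m l' t"
proof -
  have h: "k \<in> Obj J" "dlat_hom (omap D k) (omap D m) (act g)" using arD[OF g] by auto
  show ?thesis
    using t l'
  proof (induction t)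
    case (Gen w)
    then show ?case by (cases w) (auto simp: act_comp[OF _ g])
  next
    case (LMeet s t)
    then show ?case
      using h stage_value_closed[OF h(1)] by (simp add: dlat_hom_def image_Un)
  next
    case (LJoin s t)
    then show ?case
      using h stage_value_closed[OF h(1)] by (simp add: dlat_hom_def image_Un)
  qed (use h in \<open>auto simp: dlat_hom_def\<close>)
qed

lemma legs_later:
  assumes "g \<in> Hom J k m" "legs k l t" "\<And>i. i \<in> fst ` set_lterm t \<Longrightarrow> l' i = g \<cdot>\<^bsub>J\<^esub> l i"
  shows "legs m l' t"
  using assms comp_closed unfolding legs_def by auto

lemma cocone_over_finite:
  assumes "finite I" "I \<subseteq> Obj J" "k \<in> Obj J"
  shows "\<exists>m. \<exists>g\<in>Hom J k m. \<exists>l. \<forall>i\<in>I. l i \<in> Hom J i m"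
  using assms(1,2)
proof (induction I)
  case empty
  then show ?case using ident_closed[OF assms(3)] by blast
next
  case (insert i I)
  then obtain m g l where m: "g \<in> Hom J k m" "\<forall>i\<in>I. l i \<in> Hom J i m" by blast
  have "m \<in> Obj J" "i \<in> Obj J" using arD[OF m(1)] insert.prems by auto
  then obtain n f h where n: "f \<in> Hom J m n" "h \<in> Hom J i n" using bound by blast
  have "f \<cdot>\<^bsub>J\<^esub> g \<in> Hom J k n" using comp_closed[OF m(1) n(1)] .
  moreover have "\<forall>j\<in>insert i I. (\<lambda>j. if j = i then h else f \<cdot>\<^bsub>J\<^esub> l j) j \<in> Hom J j n"
    using n m comp_closed by auto
  then have "\<exists>l. \<forall>j\<in>insert i I. l j \<in> Hom J j n"
    by (rule exI[of _ "\<lambda>j. if j = i then h else f \<cdot>\<^bsub>J\<^esub> l j"])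
  ultimately show ?case by blast
qed

text \<open>
  Soundness of the generated preorder for eventual inequality, whatever legs are used to evaluate
  the two terms. The axioms of bounded distributive lattices hold at every stage, and the relations
  for the arrows of the diagram hold eventually. For transitivity, the middle term may mention
  indices without a leg, so the stage is first moved to one that receives these indices too.
\<close>

lemma colim_le_imp_eventually_le:
  assumes "colim_le J D s t" "k \<in> Obj J" "legs k l s" "legs k l t"
  shows "eventually_le k (stage_value k l s) (stage_value k l t)"
  using assms
proof (induction arbitrary: k l rule: colim_le.induct)
  case (trans r s t)
  have terms: "r \<in> colim_terms J D" "s \<in> colim_terms J D" "t \<in> colim_terms J D"
    using trans.hyps le_terms by blast+
  \<comment> \<open>The old legs have to be continued along \<open>g\<close> on the outer terms, also at indices shared with \<open>s\<close>.\<close>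
  define I where "I = fst ` set_lterm r \<union> fst ` set_lterm t"
  have "finite (fst ` set_lterm s)" by (simp add: finite_set_lterm)
  moreover have "fst ` set_lterm s \<subseteq> Obj J" using terms(2) by (auto simp: colim_terms_def)
  ultimately obtain m g l0 where g: "g \<in> Hom J k m" and l0: "\<forall>i\<in>fst ` set_lterm s. l0 i \<in> Hom J i m"
    using cocone_over_finite[OF _ _ trans.prems(1)] by meson
  define l' where "l' = (\<lambda>i. if i \<in> I then g \<cdot>\<^bsub>J\<^esub> l i else l0 i)"
  have m: "m \<in> Obj J" using arD[OF g] by simp
  have lr: "legs m l' r" using legs_later[OF g trans.prems(2)] by (simp add: l'_def I_def)
  have lt: "legs m l' t" using legs_later[OF g trans.prems(3)] by (simp add: l'_def I_def)
  have ls: "legs m l' s"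
    using l0 comp_closed[OF _ g] trans.prems(2,3) unfolding legs_def l'_def I_def by auto
  let ?r = "stage_value m l' r" and ?s = "stage_value m l' s" and ?t = "stage_value m l' t"
  have c: "?r \<in> carrier (omap D m)" "?s \<in> carrier (omap D m)" "?t \<in> carrier (omap D m)"
    using stage_value_closed m terms lr ls lt by blast+
  obtain n h where h: "h \<in> Hom J m n" "act h ?r \<sqsubseteq>\<^bsub>omap D n\<^esub> act h ?s" "act h ?s \<sqsubseteq>\<^bsub>omap D n\<^esub> act h ?t"
    using eventually_le_common[OF trans.IH(1)[OF m lr ls] c(1,2) trans.IH(2)[OF m ls lt] c(2,3)] .
  interpret N: dlat "omap D n" using obD arD[OF h(1)] by blast
  have "act h ?r \<sqsubseteq>\<^bsub>omap D n\<^esub> act h ?t"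
    using N.le_trans[OF h(2,3)] act_closed[OF h(1)] c by simp
  then have "eventually_le m ?r ?t" unfolding eventually_le_def using h(1) by blast
  moreover have "act g (stage_value k l r) = ?r" "act g (stage_value k l t) = ?t"
    using stage_value_later[OF g terms(1) trans.prems(2), of l']
      stage_value_later[OF g terms(3) trans.prems(3), of l'] by (auto simp: l'_def I_def)
  ultimately show ?case
    using eventually_le_later[OF g] stage_value_closed trans.prems terms by simp
next
  case (meet r s t)
  have terms: "r \<in> colim_terms J D" "s \<in> colim_terms J D" "t \<in> colim_terms J D"
    using meet.hyps le_terms by blast+
  let ?r = "stage_value k l r" and ?s = "stage_value k l s" and ?t = "stage_value k l t"
  have c: "?r \<in> carrier (omap D k)" "?s \<in> carrier (omap D k)" "?t \<in> carrier (omap D k)"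
    using stage_value_closed terms meet.prems by simp_all
  have ih: "eventually_le k ?r ?s" "eventually_le k ?r ?t" using meet.IH meet.prems by simp_all
  obtain n h where h: "h \<in> Hom J k n" "act h ?r \<sqsubseteq>\<^bsub>omap D n\<^esub> act h ?s" "act h ?r \<sqsubseteq>\<^bsub>omap D n\<^esub> act h ?t"
    using eventually_le_common[OF ih(1) c(1,2) ih(2) c(1,3)] .
  interpret N: dlat "omap D n" using obD arD[OF h(1)] by blast
  have "act h ?r \<sqsubseteq>\<^bsub>omap D n\<^esub> act h (?s \<sqinter>\<^bsub>omap D k\<^esub> ?t)"
    using N.meet_le[OF h(2,3)] act_closed[OF h(1)] c arD[OF h(1)] by (simp add: dlat_hom_def)
  then show ?case unfolding eventually_le_def using h(1) by auto
next
  case (join s r t)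
  have terms: "r \<in> colim_terms J D" "s \<in> colim_terms J D" "t \<in> colim_terms J D"
    using join.hyps le_terms by blast+
  let ?r = "stage_value k l r" and ?s = "stage_value k l s" and ?t = "stage_value k l t"
  have c: "?r \<in> carrier (omap D k)" "?s \<in> carrier (omap D k)" "?t \<in> carrier (omap D k)"
    using stage_value_closed terms join.prems by simp_all
  have ih: "eventually_le k ?s ?r" "eventually_le k ?t ?r" using join.IH join.prems by simp_all
  obtain n h where h: "h \<in> Hom J k n" "act h ?s \<sqsubseteq>\<^bsub>omap D n\<^esub> act h ?r" "act h ?t \<sqsubseteq>\<^bsub>omap D n\<^esub> act h ?r"
    using eventually_le_common[OF ih(1) c(2,1) ih(2) c(3,1)] .
  interpret N: dlat "omap D n" using obD arD[OF h(1)] by blast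
  have "act h (?s \<squnion>\<^bsub>omap D k\<^esub> ?t) \<sqsubseteq>\<^bsub>omap D n\<^esub> act h ?r"
    using N.join_le[OF h(2,3)] act_closed[OF h(1)] c arD[OF h(1)] by (simp add: dlat_hom_def)
  then show ?case unfolding eventually_le_def using h(1) by auto
next
  case (gen_arr1 f i j u)
  show ?case using eventually_eq_along[of f i j u "l i" k "l j"] gen_arr1 by auto
next
  case (gen_arr2 f i j u)
  show ?case using eventually_eq_along[of f i j u "l i" k "l j"] gen_arr2 by auto
next
  case (refl t)
  interpret K: dlat "omap D k" using obD refl by blast
  show ?case using refl by (intro eventually_leI) (auto simp: stage_value_closed)
next
  case (bot t)
  interpret K: dlat "omap D k" using obD bot by blast
  show ?case using bot by (intro eventually_leI) (auto simp: stage_value_closed)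
next
  case (top t)
  interpret K: dlat "omap D k" using obD top by blast
  show ?case using top by (intro eventually_leI) (auto simp: stage_value_closed)
next
  case (meet1 s t)
  interpret K: dlat "omap D k" using obD meet1 by blast
  show ?case using meet1 by (intro eventually_leI) (auto simp: stage_value_closed K.meet_left)
next
  case (meet2 s t)
  interpret K: dlat "omap D k" using obD meet2 by blast
  show ?case using meet2 by (intro eventually_leI) (auto simp: stage_value_closed K.meet_right)
next
  case (join1 s t)
  interpret K: dlat "omap D k" using obD join1 by blast
  show ?case using join1 by (intro eventually_leI) (auto simp: stage_value_closed K.join_left)
next
  case (join2 s t)
  interpret K: dlat "omap D k" using obD join2 by blast
  show ?case using join2 by (intro eventually_leI) (auto simp: stage_value_closed K.join_right)
next
  case (distrib r s t)
  interpret K: dlat "omap D k" using obD distrib by blast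
  show ?case using distrib by (intro eventually_leI) (auto simp: stage_value_closed K.distrib)
next
  case (gen_mono i u v)
  then show ?case
    by (intro eventually_leI) (auto intro: act_closed act_mono)
next
  case (gen_bot i)
  interpret K: dlat "omap D k" using obD gen_bot by blast
  show ?case using gen_bot arD[of "l i" i k]
    by (intro eventually_leI) (auto simp: dlat_hom_def)
next
  case (gen_top i)
  interpret K: dlat "omap D k" using obD gen_top by blast
  show ?case using gen_top arD[of "l i" i k]
    by (intro eventually_leI) (auto simp: dlat_hom_def)
next
  case (gen_meet i u v)
  interpret K: dlat "omap D k" using obD gen_meet by blast
  show ?case using gen_meet arD[of "l i" i k] act_closed[of "l i" i k]
    by (intro eventually_leI) (auto simp: dlat_hom_def)
next
  case (gen_join i u v)
  interpret K: dlat "omap D k" using obD gen_join by blast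
  show ?case using gen_join arD[of "l i" i k] act_closed[of "l i" i k]
    by (intro eventually_leI) (auto simp: dlat_hom_def)
qed

text \<open>
  The case of a single generator against \<open>\<bottom>\<close>, evaluated at its own index with the identity as leg.
\<close>

lemma coproj_eq_bottomD:
  assumes i: "i \<in> Obj J" and u: "u \<in> carrier (omap D i)"
    and bot: "coproj J D i u = \<bottom>\<^bsub>dlat_colim J D\<^esub>"
  shows "\<exists>j. \<exists>g\<in>Hom J i j. act g u = \<bottom>\<^bsub>omap D j\<^esub>"
proof -
  let ?l = "\<lambda>_. Ident J i"
  have "colim_le J D (Gen (i, u)) LBot"
    using bot i u by (simp add: coproj_cl cl_bot cl_eq)
  then have "eventually_le i u \<bottom>\<^bsub>omap D i\<^esub>"
    using colim_le_imp_eventually_le[of "Gen (i, u)" LBot i ?l] i u ident_closed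
    by (simp add: act_ident)
  then obtain j g where g: "g \<in> Hom J i j" "act g u \<sqsubseteq>\<^bsub>omap D j\<^esub> act g \<bottom>\<^bsub>omap D i\<^esub>"
    unfolding eventually_le_def by blast
  interpret K: dlat "omap D j" using obD arD[OF g(1)] by blast
  have "act g \<bottom>\<^bsub>omap D i\<^esub> = \<bottom>\<^bsub>omap D j\<^esub>" using arD[OF g(1)] by (simp add: dlat_hom_def)
  then have "act g u = \<bottom>\<^bsub>omap D j\<^esub>"
    using g(2) act_closed[OF g(1) u] K.le_antisym[of "act g u" "\<bottom>\<^bsub>omap D j\<^esub>"] by simp
  then show ?thesis using g(1) by blast
qed

end


section \<open>Subobjects in the category of sets\<close>

lemma Set_cat_simps [simp]:
  "Dom Set_cat f = fst f" "Cod Set_cat f = fst (snd f)"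
  "f \<in> Arr Set_cat \<longleftrightarrow> fn f \<in> fst f \<rightarrow>\<^sub>E fst (snd f)"
  "X \<in> Obj Set_cat"
  "g \<cdot>\<^bsub>Set_cat\<^esub> f = (fst f, fst (snd g), compose (fst f) (fn g) (fn f))"
  by (cases f; auto simp: Set_cat_def)+

lemma Set_Hom_iff [simp]: "f \<in> Hom Set_cat X Y \<longleftrightarrow> fst f = X \<and> fst (snd f) = Y \<and> fn f \<in> X \<rightarrow>\<^sub>E Y"
  by (auto simp: Hom_def)

lemma Set_terminal_subsingleton:
  assumes T: "is_terminal Set_cat T" and bc: "b \<in> T" "c \<in> T"
  shows "b = c"
proof -
  have "({b}, T, \<lambda>x\<in>{b}. b) \<in> Hom Set_cat {b} T" "({b}, T, \<lambda>x\<in>{b}. c) \<in> Hom Set_cat {b} T"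
    using bc by auto
  then have "({b}, T, \<lambda>x\<in>{b}. b) = ({b}, T, \<lambda>x\<in>{b}. c)"
    using T unfolding is_terminal_def by (metis Set_cat_simps(4))
  then show ?thesis by (auto dest: fun_cong[of _ _ b])
qed

text \<open>
  The universal property is tested on the singleton \<open>{b}\<close>, whose maps into a set are its elements;
  in this way no one-point set has to be chosen in advance.
\<close>

lemma Set_pullback_elements:
  assumes pb: "is_pullback Set_cat f g p q"
    and bc: "b \<in> fst f" "c \<in> fst g" "fn f b = fn g c"
  shows "\<exists>!d. d \<in> fst p \<and> fn p d = b \<and> fn q d = c"
proof -
  let ?u = "({b}, fst f, \<lambda>x\<in>{b}. b)" and ?v = "({b}, fst g, \<lambda>x\<in>{b}. c)"
  have uv: "?u \<in> Hom Set_cat {b} (Dom Set_cat f)" "?v \<in> Hom Set_cat {b} (Dom Set_cat g)"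
    using bc by auto
  have "fst (snd f) = fst (snd g)" using pb by (simp add: is_pullback_def)
  then have square: "f \<cdot>\<^bsub>Set_cat\<^esub> ?u = g \<cdot>\<^bsub>Set_cat\<^esub> ?v"
    using bc by (auto simp: compose_def fun_eq_iff)
  define lift where "lift k \<longleftrightarrow> k \<in> Hom Set_cat {b} (Dom Set_cat p) \<and>
    p \<cdot>\<^bsub>Set_cat\<^esub> k = ?u \<and> q \<cdot>\<^bsub>Set_cat\<^esub> k = ?v" for k
  have ex1: "\<exists>!k. lift k"
    using pb uv square
    unfolding is_pullback_def lift_def by (metis Set_cat_simps(4))
  then obtain k where k: "lift k" by blast
  have fk: "fst k = {b}" "fn k b \<in> fst p" using k unfolding lift_def by auto
  have pk: "p \<cdot>\<^bsub>Set_cat\<^esub> k = ?u" "q \<cdot>\<^bsub>Set_cat\<^esub> k = ?v"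
    using k unfolding lift_def by blast+
  have val: "fn p (fn k b) = b" "fn q (fn k b) = c"
    using arg_cong[OF pk(1), of "\<lambda>h. fn h b"] arg_cong[OF pk(2), of "\<lambda>h. fn h b"]
    by (simp_all add: fk(1) compose_def)
  have cod: "fst (snd p) = fst f" "fst (snd q) = fst g"
    using pb by (simp_all add: is_pullback_def)
  show ?thesis
  proof (intro ex1I conjI)
    fix d assume d: "d \<in> fst p \<and> fn p d = b \<and> fn q d = c"
    let ?k = "({b}, fst p, \<lambda>x\<in>{b}. d)"
    have "lift ?k"
      unfolding lift_def
    proof (intro conjI)
      show "?k \<in> Hom Set_cat {b} (Dom Set_cat p)" using d by auto
    qed (use d cod in \<open>simp_all add: compose_def restrict_def fun_eq_iff\<close>)
    then have "?k = k" using ex1 k by blast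
    from arg_cong[OF this, of "\<lambda>h. fn h b"] show "d = fn k b" by simp
  qed (fact fk val)+
qed

interpretation Set: category Set_cat
  by (rule category_Set)

text \<open>
  All representatives of a subobject of a set have the same range; the union over the
  representatives avoids choosing one.
\<close>

definition image_set :: "('e set \<times> 'e set \<times> ('e \<Rightarrow> 'e)) set \<Rightarrow> 'e set" where
  "image_set V = (\<Union>n\<in>V. fn n ` fst n)"

lemma Set_factors_image:
  assumes "factors Set_cat f g" shows "fn f ` fst f \<subseteq> fn g ` fst g"
  using assms
proof (rule Set.factorsE)
  fix k
  assume k: "k \<in> Arr Set_cat" "Dom Set_cat k = Dom Set_cat f" "Cod Set_cat k = Dom Set_cat g"
    "f = g \<cdot>\<^bsub>Set_cat\<^esub> k"
  have "fn f a = fn g (fn k a)" if "a \<in> fst f" for a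
    using arg_cong[OF k(4), of "\<lambda>h. fn h a"] k(2) that by (simp add: compose_def)
  moreover have "fn k a \<in> fst g" if "a \<in> fst f" for a
    using k(1-3) that by (auto simp: PiE_iff)
  ultimately show ?thesis by blast
qed

lemma image_set_sc:
  assumes "is_mono Set_cat v" shows "image_set (Set.sc v) = fn v ` fst v"
proof -
  have "fn n ` fst n = fn v ` fst v" if "n \<in> Set.sc v" for n
    using that Set_factors_image unfolding Set.in_sc by blast
  moreover have "v \<in> Set.sc v"
    using assms Set.factors_refl Set.mono_arr unfolding Set.in_sc by blast
  ultimately show ?thesis unfolding image_set_def by blast
qed

lemma image_set_mono:
  assumes "V \<in> carrier (Sub Set_cat X)" "W \<in> carrier (Sub Set_cat X)" "V \<sqsubseteq>\<^bsub>Sub Set_cat X\<^esub> W"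
  shows "image_set V \<subseteq> image_set W"
proof -
  obtain v where v: "is_mono Set_cat v" "V = Set.sc v" using assms(1) by (rule Set.sub_carrE)
  obtain w where w: "is_mono Set_cat w" "W = Set.sc w" using assms(2) by (rule Set.sub_carrE)
  show ?thesis
    using assms(3) Set_factors_image v w by (simp add: Set.sc_le image_set_sc)
qed

definition inclusion_sub :: "'e set \<Rightarrow> 'e set \<Rightarrow> ('e set \<times> 'e set \<times> ('e \<Rightarrow> 'e)) set" where
  "inclusion_sub S X = Set.sc (S, X, \<lambda>a\<in>S. a)"

lemma mono_inclusion:
  assumes "S \<subseteq> X" shows "is_mono Set_cat (S, X, \<lambda>a\<in>S. a)"
proof (rule Set.monoI)
  fix u v :: "'a set \<times> 'a set \<times> ('a \<Rightarrow> 'a)"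
  assume "u \<in> Arr Set_cat" "v \<in> Arr Set_cat" "Dom Set_cat u = Dom Set_cat v"
    "Cod Set_cat u = Dom Set_cat (S, X, \<lambda>a\<in>S. a)" "Cod Set_cat v = Dom Set_cat (S, X, \<lambda>a\<in>S. a)"
    "(S, X, \<lambda>a\<in>S. a) \<cdot>\<^bsub>Set_cat\<^esub> u = (S, X, \<lambda>a\<in>S. a) \<cdot>\<^bsub>Set_cat\<^esub> v"
  then show "u = v"
    by (cases u; cases v) (simp add: Id_compose[of _ _ S] PiE_def)
qed (use assms in auto)

text \<open>
  Inclusions of subsets serve as upper bounds that force the subobjects given by the coherence of a
  functor to be as small as expected.
\<close>

lemma inclusion_sub:
  assumes S: "S \<subseteq> X"
  shows "inclusion_sub S X \<in> carrier (Sub Set_cat X)"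
    and "image_set (inclusion_sub S X) = S"
    and "V \<in> carrier (Sub Set_cat X) \<Longrightarrow> image_set V \<subseteq> S \<Longrightarrow> V \<sqsubseteq>\<^bsub>Sub Set_cat X\<^esub> inclusion_sub S X"
proof -
  show "inclusion_sub S X \<in> carrier (Sub Set_cat X)"
    unfolding inclusion_sub_def using mono_inclusion[OF S] by (intro Set.sc_carr) simp_all
  show "image_set (inclusion_sub S X) = S"
    unfolding inclusion_sub_def image_set_sc[OF mono_inclusion[OF S]] by auto
  assume V: "V \<in> carrier (Sub Set_cat X)" "image_set V \<subseteq> S"
  obtain v where v: "is_mono Set_cat v" "Cod Set_cat v = X" "V = Set.sc v"
    using V(1) by (rule Set.sub_carrE)
  have im: "fn v ` fst v \<subseteq> S" using V(2) v(1) by (simp add: v(3) image_set_sc)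
  have arr: "fn v \<in> fst v \<rightarrow>\<^sub>E X" using Set.mono_arr[OF v(1)] v(2) by simp
  have "factors Set_cat v (S, X, \<lambda>a\<in>S. a)"
    unfolding factors_def
  proof (intro conjI bexI)
    show "v = (S, X, \<lambda>a\<in>S. a) \<cdot>\<^bsub>Set_cat\<^esub> (fst v, S, fn v)"
      using im arr v(2) by (cases v) (auto simp: compose_def fun_eq_iff PiE_def extensional_def)
  qed (use im arr v S in \<open>auto simp: PiE_def Pi_iff\<close>)
  then show "V \<sqsubseteq>\<^bsub>Sub Set_cat X\<^esub> inclusion_sub S X"
    unfolding inclusion_sub_def v(3) using v(1) mono_inclusion[OF S] by (simp add: Set.sc_le)
qed


section \<open>Lattices isomorphic to the two-element lattice\<close>

lemma two_simps [simp]: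
  "\<bottom>\<^bsub>two\<^esub> = False" "\<top>\<^bsub>two\<^esub> = True"
  "p \<sqinter>\<^bsub>two\<^esub> q = (p \<and> q)" "p \<squnion>\<^bsub>two\<^esub> q = (p \<or> q)" "carrier two = UNIV"
proof -
  interpret dlat two by (rule dlat_two)
  have c: "r \<in> carrier two" for r by (simp add: two_def)
  have le: "r \<sqsubseteq>\<^bsub>two\<^esub> s \<longleftrightarrow> (r \<longrightarrow> s)" for r s by (auto simp: two_def)
  show "carrier two = UNIV" by (simp add: two_def)
  show "\<bottom>\<^bsub>two\<^esub> = False" by (rule bottom_eq[symmetric]) (auto simp: two_def)
  show "\<top>\<^bsub>two\<^esub> = True" by (rule top_eq[symmetric]) (auto simp: two_def)
  have "p \<sqinter>\<^bsub>two\<^esub> q \<sqsubseteq>\<^bsub>two\<^esub> p" "p \<sqinter>\<^bsub>two\<^esub> q \<sqsubseteq>\<^bsub>two\<^esub> q" "(p \<and> q) \<sqsubseteq>\<^bsub>two\<^esub> p \<sqinter>\<^bsub>two\<^esub> q"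
    using meet_left[of p q, OF c c] meet_right[of p q, OF c c] meet_le[of "p \<and> q" p q, OF _ _ c c c]
    unfolding le by blast+
  then show "p \<sqinter>\<^bsub>two\<^esub> q = (p \<and> q)" unfolding le by blast
  have "p \<sqsubseteq>\<^bsub>two\<^esub> p \<squnion>\<^bsub>two\<^esub> q" "q \<sqsubseteq>\<^bsub>two\<^esub> p \<squnion>\<^bsub>two\<^esub> q" "p \<squnion>\<^bsub>two\<^esub> q \<sqsubseteq>\<^bsub>two\<^esub> (p \<or> q)"
    using join_left[of p q, OF c c] join_right[of p q, OF c c] join_le[of p "p \<or> q" q, OF _ _ c c c]
    unfolding le by blast+
  then show "p \<squnion>\<^bsub>two\<^esub> q = (p \<or> q)" unfolding le by blast
qed

text \<open>
  The homomorphism to \<open>two\<close> keeps \<open>\<bottom>\<close> and \<open>\<top>\<close> of \<open>K\<close> apart; without it the degenerate lattice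
  would satisfy the right-hand side.
\<close>

lemma dlat_isomorphic_two_iff:
  assumes K: "dlat K" and nontrivial: "dlat_hom K two k"
  shows "dlat_isomorphic K two \<longleftrightarrow> (\<forall>X\<in>carrier K. X = \<top>\<^bsub>K\<^esub> \<or> X = \<bottom>\<^bsub>K\<^esub>)"
proof
  interpret K: dlat K by (rule K)
  assume "dlat_isomorphic K two"
  then obtain h where h: "dlat_hom K two h" "bij_betw h (carrier K) (carrier two)"
    unfolding dlat_isomorphic_def by blast
  show "\<forall>X\<in>carrier K. X = \<top>\<^bsub>K\<^esub> \<or> X = \<bottom>\<^bsub>K\<^esub>"
  proof
    fix X assume X: "X \<in> carrier K"
    have "h X = h \<top>\<^bsub>K\<^esub> \<or> h X = h \<bottom>\<^bsub>K\<^esub>" using h(1) by (simp add: dlat_hom_def)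
    then show "X = \<top>\<^bsub>K\<^esub> \<or> X = \<bottom>\<^bsub>K\<^esub>"
      using bij_betw_imp_inj_on[OF h(2)] X K.top_closed K.bottom_closed unfolding inj_on_def by blast
  qed
next
  interpret K: dlat K by (rule K)
  assume t: "\<forall>X\<in>carrier K. X = \<top>\<^bsub>K\<^esub> \<or> X = \<bottom>\<^bsub>K\<^esub>"
  have k: "k \<top>\<^bsub>K\<^esub>" "\<not> k \<bottom>\<^bsub>K\<^esub>" using nontrivial by (auto simp: dlat_hom_def)
  have "inj_on k (carrier K)" using t k unfolding inj_on_def by metis
  moreover have "k ` carrier K = carrier two"
  proof -
    have "b \<in> k ` carrier K" for b
      using imageI[OF K.top_closed, of k] imageI[OF K.bottom_closed, of k] k by (cases b) simp_all
    then show ?thesis by auto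
  qed
  ultimately show "dlat_isomorphic K two"
    unfolding dlat_isomorphic_def bij_betw_def using K dlat_two nontrivial by blast
qed


section \<open>Elements of subobjects under a coherent functor\<close>

locale coherent_model = coherent_category C
  for C :: "('o, 'a) cat" and M :: "('o, 'a, 'e) set_functor" +
  assumes coherent: "coherent_functor C Set_cat M"
begin

abbreviation ev :: "'a \<Rightarrow> 'e \<Rightarrow> 'e" where
  "ev f \<equiv> fn (amap M f)"

lemma M_functor: "is_functor C Set_cat M"
  using coherent by (simp add: coherent_functor_def)

lemma fst_amap: "f \<in> Arr C \<Longrightarrow> fst (amap M f) = omap M (Dom C f)"
  using M_functor by (simp add: is_functor_def)

lemma ev_closed: "f \<in> Hom C x y \<Longrightarrow> a \<in> omap M x \<Longrightarrow> ev f a \<in> omap M y"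
  using set_functorD(2)[OF M_functor] by blast

lemma ev_comp:
  "f \<in> Hom C x y \<Longrightarrow> g \<in> Hom C y z \<Longrightarrow> a \<in> omap M x \<Longrightarrow> ev (g \<cdot>\<^bsub>C\<^esub> f) a = ev g (ev f a)"
  using set_functorD(3)[OF M_functor] .

lemma ev_ident: "x \<in> Obj C \<Longrightarrow> a \<in> omap M x \<Longrightarrow> ev (Ident C x) a = a"
  using set_functorD(1)[OF M_functor] by simp

lemma terminal_elements:
  assumes "is_terminal C t" "b \<in> omap M t" "c \<in> omap M t" shows "b = c"
proof (rule Set_terminal_subsingleton)
  show "is_terminal Set_cat (omap M t)"
    using coherent assms(1) unfolding coherent_functor_def by blast
qed (fact assms)+

text \<open>
  Existence says that elements of pullbacks can be constructed, uniqueness that the projections are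
  jointly injective on elements.
\<close>

lemma pullback_elements:
  assumes pb: "is_pullback C f g p q"
    and "b \<in> omap M (Dom C f)" "c \<in> omap M (Dom C g)" "ev f b = ev g c"
  shows "\<exists>!d. d \<in> omap M (Dom C p) \<and> ev p d = b \<and> ev q d = c"
proof -
  have "is_pullback Set_cat (amap M f) (amap M g) (amap M p) (amap M q)"
    using coherent pb unfolding coherent_functor_def by blast
  from Set_pullback_elements[OF this, of b c] show ?thesis
    using assms(2-4) pbD[OF pb] by (simp add: fst_amap)
qed

lemma factors_elements:
  assumes "factors C f m" shows "ev f ` omap M (Dom C f) \<subseteq> ev m ` omap M (Dom C m)"
  using assms
proof (rule factorsE)
  fix k assume k: "f \<in> Arr C" "m \<in> Arr C" "k \<in> Arr C" "Dom C k = Dom C f" "Cod C k = Dom C m" "f = m \<cdot>\<^bsub>C\<^esub> k"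
  then have *: "k \<in> Hom C (Dom C f) (Dom C m)" "m \<in> Hom C (Dom C m) (Cod C m)"
    by (auto simp: Hom_def)
  then have "ev f a = ev m (ev k a)" if "a \<in> omap M (Dom C f)" for a
    using ev_comp[OF * that] by (simp flip: k(6))
  then show ?thesis using ev_closed[OF *(1)] by auto
qed

lemma sub_elements_sc:
  assumes m: "is_mono C m"
  shows "sub_elements C M (sc m) = ev m ` omap M (Dom C m)"
proof -
  have "ev n ` omap M (Dom C n) = ev m ` omap M (Dom C m)" if "n \<in> sc m" for n
    using that factors_elements unfolding in_sc by blast
  moreover have "m \<in> sc m" using m factors_refl mono_arr unfolding in_sc by blast
  ultimately show ?thesis unfolding sub_elements_def by blast
qed

lemma sub_elements_subset:
  assumes "A \<in> carrier (Sub C x)" shows "sub_elements C M A \<subseteq> omap M x"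
proof -
  obtain m where m: "is_mono C m" "Cod C m = x" "A = sc m" using assms by (rule sub_carrE)
  then have "m \<in> Hom C (Dom C m) x" using mono_arr by (simp add: Hom_def)
  then show ?thesis using ev_closed m by (auto simp: sub_elements_sc)
qed

lemma sub_elements_mono:
  assumes A: "A \<in> carrier (Sub C x)" and B: "B \<in> carrier (Sub C x)" and le: "A \<sqsubseteq>\<^bsub>Sub C x\<^esub> B"
  shows "sub_elements C M A \<subseteq> sub_elements C M B"
proof -
  obtain m where m: "is_mono C m" "A = sc m" using A by (rule sub_carrE)
  obtain n where n: "is_mono C n" "B = sc n" using B by (rule sub_carrE)
  show ?thesis using le factors_elements m n by (simp add: sc_le sub_elements_sc)
qed

lemma sub_elements_top:
  assumes x: "x \<in> Obj C" shows "sub_elements C M \<top>\<^bsub>Sub C x\<^esub> = omap M x"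
  using x mono_ident[OF x] ev_ident[OF x] by (simp add: sub_top sub_elements_sc)

lemma sub_elements_meet:
  assumes A: "A \<in> carrier (Sub C x)" and B: "B \<in> carrier (Sub C x)"
  shows "sub_elements C M (A \<sqinter>\<^bsub>Sub C x\<^esub> B) = sub_elements C M A \<inter> sub_elements C M B"
proof -
  obtain m where m: "is_mono C m" "Cod C m = x" "A = sc m" using A by (rule sub_carrE)
  obtain n where n: "is_mono C n" "Cod C n = x" "B = sc n" using B by (rule sub_carrE)
  obtain k where k: "is_mono C k" "A \<sqinter>\<^bsub>Sub C x\<^esub> B = sc k"
    "\<And>g. factors C g k \<longleftrightarrow> factors C g m \<and> factors C g n"
    using sub_meet[OF m(1) n(1) m(2) n(2)] m(3) n(3) by metis
  note arr = mono_arr[OF m(1)] mono_arr[OF n(1)] mono_arr[OF k(1)]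
  have "factors C k m" "factors C k n" using k(3) factors_refl arr by blast+
  then have "sub_elements C M (sc k) \<subseteq> sub_elements C M A \<inter> sub_elements C M B"
    using factors_elements m n k(1) by (simp add: sub_elements_sc)
  moreover have "a \<in> sub_elements C M (sc k)" if ab: "a \<in> sub_elements C M A \<inter> sub_elements C M B" for a
  proof -
    obtain b c where bc: "b \<in> omap M (Dom C m)" "c \<in> omap M (Dom C n)" "a = ev m b" "a = ev n c"
      using ab unfolding m(3) n(3) sub_elements_sc[OF m(1)] sub_elements_sc[OF n(1)] by blast
    obtain p q where pb: "is_pullback C m n p q" using has_pullbacks[OF arr(1,2)] m(2) n(2) by auto
    note [simp] = pbD(1-8)[OF pb]
    obtain d where d: "d \<in> omap M (Dom C p)" "ev p d = b"
      using pullback_elements[OF pb bc(1,2)] bc(3,4) by auto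
    have "factors C (m \<cdot>\<^bsub>C\<^esub> p) m" by (simp add: factors_comp)
    moreover have "factors C (m \<cdot>\<^bsub>C\<^esub> p) n" unfolding pbD(9)[OF pb] by (simp add: factors_comp)
    ultimately have "factors C (m \<cdot>\<^bsub>C\<^esub> p) k" using k(3) by blast
    then have "ev (m \<cdot>\<^bsub>C\<^esub> p) ` omap M (Dom C p) \<subseteq> sub_elements C M (sc k)"
      using factors_elements[of "m \<cdot>\<^bsub>C\<^esub> p" k] k(1) by (simp add: sub_elements_sc)
    moreover have "ev (m \<cdot>\<^bsub>C\<^esub> p) d = a"
      using ev_comp[of p "Dom C p" "Dom C m" m x d] d bc(3) m(2) by (simp add: Hom_def)
    ultimately show ?thesis using d(1) by blast
  qed
  ultimately show ?thesis using k(2) by auto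
qed

text \<open>
  Each member of the class on the left has the same range as the image under \<open>M\<close> of a representative
  of \<open>A\<close>, and there is a member because elements of \<open>Sub\<close> are nonempty classes.
\<close>

lemma image_set_functor_sub:
  assumes A: "A \<in> carrier (Sub C x)"
    and V: "functor_sub Set_cat M x A \<in> carrier (Sub Set_cat (omap M x))"
  shows "image_set (functor_sub Set_cat M x A) = sub_elements C M A"
proof -
  obtain m where m: "is_mono C m" "A = sc m" using A by (rule sub_carrE)
  have "fn n ` fst n = sub_elements C M A" if n: "n \<in> functor_sub Set_cat M x A" for n
  proof -
    obtain m' where m': "m' \<in> A" "(amap M m', n) \<in> sub_equiv Set_cat (omap M x)"
      using n unfolding functor_sub_def by blast
    then have "fn n ` fst n = ev m' ` fst (amap M m')"
      using Set_factors_image unfolding sub_equiv_def by blast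
    moreover have mm: "is_mono C m'" "factors C m m'" "factors C m' m" using m' m by (auto simp: in_sc)
    ultimately show ?thesis
      using factors_elements[OF mm(2)] factors_elements[OF mm(3)] m mono_arr[OF mm(1)]
      by (auto simp: sub_elements_sc fst_amap)
  qed
  moreover have "functor_sub Set_cat M x A \<noteq> {}"
  proof -
    obtain v where v: "is_mono Set_cat v" "functor_sub Set_cat M x A = Set.sc v"
      using V by (rule Set.sub_carrE)
    then have "v \<in> functor_sub Set_cat M x A"
      using Set.factors_refl[OF Set.mono_arr[OF v(1)]] by (simp add: Set.in_sc)
    then show ?thesis by blast
  qed
  ultimately show ?thesis unfolding image_set_def by blast
qed

text \<open>
  The least subobject of \<open>M x\<close> lies below the inclusion of the empty set.
\<close>

lemma sub_elements_bottom:
  assumes x: "x \<in> Obj C" shows "sub_elements C M \<bottom>\<^bsub>Sub C x\<^esub> = {}"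
proof -
  interpret X: bounded_lattice "Sub C x" by (rule sub_bl[OF x])
  let ?V = "functor_sub Set_cat M x \<bottom>\<^bsub>Sub C x\<^esub>" and ?S = "Sub Set_cat (omap M x)"
  have V: "least ?S ?V (carrier ?S)"
    using coherent x X.bottom_least unfolding coherent_functor_def by blast
  then have Vc: "?V \<in> carrier ?S" by (simp add: least_def)
  have e: "inclusion_sub {} (omap M x) \<in> carrier ?S" by (rule inclusion_sub(1)) simp
  then have "?V \<sqsubseteq>\<^bsub>?S\<^esub> inclusion_sub {} (omap M x)" using V by (simp add: least_def)
  from image_set_mono[OF Vc e this] show ?thesis
    using image_set_functor_sub[OF _ Vc] inclusion_sub(2)[of "{}" "omap M x"] by simp
qed

text \<open>
  The inclusion of \<open>M A \<union> M B\<close> is an upper bound of \<open>M A\<close> and \<open>M B\<close>, hence lies above the least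
  upper bound \<open>M (A \<squnion> B)\<close>.
\<close>

lemma sub_elements_join:
  assumes x: "x \<in> Obj C" and A: "A \<in> carrier (Sub C x)" and B: "B \<in> carrier (Sub C x)"
  shows "sub_elements C M (A \<squnion>\<^bsub>Sub C x\<^esub> B) = sub_elements C M A \<union> sub_elements C M B"
proof -
  interpret X: dlat "Sub C x" by (rule sub_dlat[OF x])
  let ?U = "A \<squnion>\<^bsub>Sub C x\<^esub> B" and ?F = "functor_sub Set_cat M x" and ?S = "Sub Set_cat (omap M x)"
  let ?E = "sub_elements C M A \<union> sub_elements C M B"
  have U: "?U \<in> carrier (Sub C x)" using A B by simp
  have lub: "is_lub ?S (?F ?U) {?F A, ?F B}"
    using coherent x A B sub_join_eq[OF x A B, of ?U] unfolding coherent_functor_def by blast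
  then have Uc: "?F ?U \<in> carrier ?S" by (auto simp: least_def Upper_def)
  have E: "?E \<subseteq> omap M x" using sub_elements_subset A B by blast
  have "V \<sqsubseteq>\<^bsub>?S\<^esub> inclusion_sub ?E (omap M x)" if "V \<in> {?F A, ?F B}" "V \<in> carrier ?S" for V
    using that image_set_functor_sub[OF A] image_set_functor_sub[OF B]
    by (intro inclusion_sub(3)[OF E]) auto
  then have "?F ?U \<sqsubseteq>\<^bsub>?S\<^esub> inclusion_sub ?E (omap M x)"
    using lub inclusion_sub(1)[OF E] unfolding least_def Upper_def by auto
  from image_set_mono[OF Uc inclusion_sub(1)[OF E] this]
  have "sub_elements C M ?U \<subseteq> ?E"
    using image_set_functor_sub[OF U Uc] inclusion_sub(2)[OF E] by simp
  moreover have "?E \<subseteq> sub_elements C M ?U"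
    using sub_elements_mono[OF A U] sub_elements_mono[OF B U] X.join_left[OF A B] X.join_right[OF A B]
    by simp
  ultimately show ?thesis by blast
qed

lemma sub_elements_hom:
  assumes "x \<in> Obj C" "a \<in> omap M x"
  shows "dlat_hom (Sub C x) two (\<lambda>A. a \<in> sub_elements C M A)"
  unfolding dlat_hom_def using assms
  by (auto simp: sub_elements_bottom sub_elements_top sub_elements_meet sub_elements_join)

lemma sub_elements_pullback:
  assumes f: "f \<in> Hom C y x" and b: "b \<in> omap M y" and A: "A \<in> carrier (Sub C x)"
  shows "b \<in> sub_elements C M (sub_pullback C f A) \<longleftrightarrow> ev f b \<in> sub_elements C M A"
proof -
  have [simp]: "f \<in> Arr C" "Dom C f = y" "Cod C f = x" using f by (auto simp: Hom_def)
  obtain m where m: "is_mono C m" "Cod C m = x" "A = sc m" using A by (rule sub_carrE)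
  obtain n q where pb: "is_pullback C f m n q" using has_pullbacks[of f m] m mono_arr by auto
  note [simp] = pbD(1-8)[OF pb]
  have "b \<in> ev n ` omap M (Dom C n) \<longleftrightarrow> ev f b \<in> ev m ` omap M (Dom C m)"
  proof
    assume "b \<in> ev n ` omap M (Dom C n)"
    then obtain d where d: "d \<in> omap M (Dom C n)" "b = ev n d" by blast
    have "ev f b = ev (m \<cdot>\<^bsub>C\<^esub> q) d"
      using d ev_comp[of n "Dom C n" y f x d] f by (simp add: Hom_def pbD(9)[OF pb, symmetric])
    also have "\<dots> = ev m (ev q d)"
      using ev_comp[of q "Dom C n" "Dom C m" m x d] d m by (simp add: Hom_def)
    finally show "ev f b \<in> ev m ` omap M (Dom C m)"
      using ev_closed[of q "Dom C n" "Dom C m" d] d by (simp add: Hom_def)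
  next
    assume "ev f b \<in> ev m ` omap M (Dom C m)"
    then obtain c where "c \<in> omap M (Dom C m)" "ev f b = ev m c" by blast
    then show "b \<in> ev n ` omap M (Dom C n)" using pullback_elements[OF pb, of b c] b by auto
  qed
  then show ?thesis
    using sub_pullback_sc[OF pb m(1)] pb_mono[OF pb m(1)] m by (simp add: sub_elements_sc)
qed

end


section \<open>Disjoint images\<close>

context coherent_category
begin

lemma sub_pullback_top_iff:
  assumes f: "f \<in> Hom C y x" and m: "is_mono C m" "Cod C m = x"
  shows "sub_pullback C f (sc m) = \<top>\<^bsub>Sub C y\<^esub> \<longleftrightarrow> factors C f m"
proof -
  have fa: "f \<in> Arr C" "Dom C f = y" "Cod C f = x" using f by (auto simp: Hom_def)
  have y: "y \<in> Obj C" using fa dom_closed by blast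
  obtain n where n: "is_mono C n" "Cod C n = y" "sub_pullback C f (sc m) = sc n"
    "\<And>g. g \<in> Arr C \<Longrightarrow> Cod C g = y \<Longrightarrow> factors C g n \<longleftrightarrow> factors C (f \<cdot>\<^bsub>C\<^esub> g) m"
    using pb_sc[of f m] fa m by metis
  have "factors C n (Ident C y)"
    using factors_comp[of "Ident C y" n] n(1,2) y mono_arr by simp
  then have "sub_pullback C f (sc m) = \<top>\<^bsub>Sub C y\<^esub> \<longleftrightarrow> factors C (Ident C y) n"
    unfolding n(3) sub_top[OF y] using sc_eq[OF n(1) mono_ident[OF y]] by blast
  also have "\<dots> \<longleftrightarrow> factors C f m" using n(4)[of "Ident C y"] y fa by simp
  finally show ?thesis .
qed

text \<open>
  An object whose least and greatest subobjects agree plays the role of an initial object. If the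
  domain of a cover \<open>p\<close> is of this kind, \<open>p\<close> factors through the least subobject of its codomain,
  which is therefore invertible.
\<close>

lemma cover_reflects_degenerate:
  assumes p: "is_cover C p" and deg: "\<bottom>\<^bsub>Sub C (Dom C p)\<^esub> = \<top>\<^bsub>Sub C (Dom C p)\<^esub>"
  shows "\<bottom>\<^bsub>Sub C (Cod C p)\<^esub> = \<top>\<^bsub>Sub C (Cod C p)\<^esub>"
proof -
  let ?k = "Cod C p"
  have pa: "p \<in> Hom C (Dom C p) ?k" using p by (simp add: is_cover_def Hom_def)
  then have k: "?k \<in> Obj C" using cod_closed by (simp add: Hom_def)
  interpret K: bounded_lattice "Sub C ?k" by (rule sub_bl[OF k])
  obtain w where w: "is_mono C w" "Cod C w = ?k" "\<bottom>\<^bsub>Sub C ?k\<^esub> = sc w"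
    using K.bottom_closed by (rule sub_carrE)
  have "sub_pullback C p (sc w) = \<top>\<^bsub>Sub C (Dom C p)\<^esub>"
    using pb_hom[OF pa] deg w(3) by (simp add: dlat_hom_def)
  then have "factors C p w" using sub_pullback_top_iff[OF pa w(1,2)] by simp
  then have "is_iso C w" using p w(1) unfolding is_cover_def by blast
  then obtain g where g: "g \<in> Hom C ?k (Dom C w)" "w \<cdot>\<^bsub>C\<^esub> g = Ident C ?k"
    unfolding is_iso_def w(2) by blast
  then have "factors C (Ident C ?k) w"
    using factors_comp[of w g] mono_arr[OF w(1)] by (simp add: Hom_def)
  moreover have "factors C w (Ident C ?k)"
    using factors_comp[of "Ident C ?k" w] w(1,2) k mono_arr by simp
  ultimately show ?thesis
    using w k mono_ident[OF k] by (simp add: sub_top sc_eq)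
qed

text \<open>
  A subobject \<open>m\<close> of the image through which \<open>e\<close> factors gives the subobject \<open>n \<cdot> m\<close> of the codomain
  through which \<open>f\<close> factors. By minimality of the image, \<open>n\<close> factors through \<open>n \<cdot> m\<close>, which yields an
  inverse of \<open>m\<close>.
\<close>

lemma cover_onto_image:
  assumes im: "is_image C f n" and e: "e \<in> Hom C (Dom C f) (Dom C n)" "f = n \<cdot>\<^bsub>C\<^esub> e"
  shows "is_cover C e"
  unfolding is_cover_def
proof (intro conjI allI impI)
  have n: "is_mono C n" "n \<in> Arr C" using im mono_arr by (auto simp: is_image_def)
  show ea: "e \<in> Arr C" using e(1) by (simp add: Hom_def)
  fix m assume m: "is_mono C m \<and> factors C e m"
  then have ma: "m \<in> Arr C" "Cod C m = Dom C n"
    using e(1) by (simp_all add: Hom_def factors_def)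
  have "is_mono C (n \<cdot>\<^bsub>C\<^esub> m)" using mono_comp[OF n(1)] m ma by simp
  moreover have "factors C f (n \<cdot>\<^bsub>C\<^esub> m)"
    using factors_postcomp[of e m n] m n(2) ma e(2) by simp
  ultimately have "factors C n (n \<cdot>\<^bsub>C\<^esub> m)" using im by (simp add: is_image_def)
  then obtain l where l: "l \<in> Arr C" "Dom C l = Dom C n" "Cod C l = Dom C (n \<cdot>\<^bsub>C\<^esub> m)"
    "n = (n \<cdot>\<^bsub>C\<^esub> m) \<cdot>\<^bsub>C\<^esub> l"
    by (rule factorsE)
  have l3: "Cod C l = Dom C m" using l(3) n ma by simp
  have nO: "Dom C n \<in> Obj C" and mO: "Dom C m \<in> Obj C" using dom_closed n(2) ma(1) by blast+
  have "n \<cdot>\<^bsub>C\<^esub> (m \<cdot>\<^bsub>C\<^esub> l) = (n \<cdot>\<^bsub>C\<^esub> m) \<cdot>\<^bsub>C\<^esub> l"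
    using assocA[OF l(1) ma(1) n(2)] l3 ma(2) by simp
  also have "\<dots> = n" using l(4) by (rule sym)
  also have "\<dots> = n \<cdot>\<^bsub>C\<^esub> Ident C (Dom C n)" using n(2) by simp
  finally have "n \<cdot>\<^bsub>C\<^esub> (m \<cdot>\<^bsub>C\<^esub> l) = n \<cdot>\<^bsub>C\<^esub> Ident C (Dom C n)" .
  then have ml: "m \<cdot>\<^bsub>C\<^esub> l = Ident C (Dom C n)"
    using monoD[OF n(1), of "m \<cdot>\<^bsub>C\<^esub> l" "Ident C (Dom C n)"] l(1,2) l3 ma nO by simp
  have "m \<cdot>\<^bsub>C\<^esub> (l \<cdot>\<^bsub>C\<^esub> m) = m \<cdot>\<^bsub>C\<^esub> Ident C (Dom C m)"
    using assocA[OF ma(1) l(1) ma(1)] l(2) l3 ma ml by simp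
  then have "l \<cdot>\<^bsub>C\<^esub> m = Ident C (Dom C m)"
    using monoD[of m "l \<cdot>\<^bsub>C\<^esub> m" "Ident C (Dom C m)"] m l(1,2) l3 ma mO by simp
  then show "is_iso C m"
    unfolding is_iso_def using ml l(1,2) l3 ma by (auto simp: Hom_def)
qed

text \<open>
  Let \<open>k\<close> represent the intersection of the image of \<open>f\<close> with \<open>A\<close>, and pull the cover from \<open>y\<close>
  onto the image back to the domain of \<open>k\<close>. This gives a cover \<open>p\<close> and an arrow \<open>q\<close> to \<open>y\<close> with
  \<open>f q = k p\<close>. The pullback of \<open>A\<close> along this arrow is \<open>\<bottom>\<close> when computed through \<open>f\<close> and \<open>\<top>\<close> when
  computed through \<open>k\<close>, so the domain of \<open>p\<close> is degenerate, hence so is that of \<open>k\<close>, and \<open>k\<close> is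
  the least subobject.
\<close>

lemma image_disjoint:
  assumes f: "f \<in> Hom C y x" and A: "A \<in> carrier (Sub C x)"
    and bot: "sub_pullback C f A = \<bottom>\<^bsub>Sub C y\<^esub>" and im: "is_image C f n"
  shows "sc n \<sqinter>\<^bsub>Sub C x\<^esub> A = \<bottom>\<^bsub>Sub C x\<^esub>"
proof -
  have fa: "f \<in> Arr C" "Dom C f = y" "Cod C f = x" using f by (auto simp: Hom_def)
  have x: "x \<in> Obj C" using fa cod_closed by blast
  interpret X: bounded_lattice "Sub C x" by (rule sub_bl[OF x])
  have n: "is_mono C n" "factors C f n" using im by (auto simp: is_image_def)
  obtain e where e: "e \<in> Hom C (Dom C f) (Dom C n)" "f = n \<cdot>\<^bsub>C\<^esub> e" and na: "n \<in> Arr C" "Cod C n = x"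
    using n(2) fa(3) by (auto simp: factors_def)
  have ecov: "is_cover C e" using cover_onto_image[OF im e] .
  obtain m where m: "is_mono C m" "Cod C m = x" "A = sc m" using A by (rule sub_carrE)
  obtain k where k: "is_mono C k" "Cod C k = x" "sc n \<sqinter>\<^bsub>Sub C x\<^esub> sc m = sc k"
    "\<And>g. factors C g k \<longleftrightarrow> factors C g n \<and> factors C g m"
    using sub_meet[OF n(1) m(1) na(2) m(2)] by metis
  have ka: "k \<in> Arr C" using mono_arr[OF k(1)] .
  have kn: "factors C k n" "factors C k m" using k(4)[of k] factors_refl[OF ka] by blast+
  obtain l where l: "l \<in> Arr C" "Dom C l = Dom C k" "Cod C l = Dom C n" "k = n \<cdot>\<^bsub>C\<^esub> l"
    using kn(1) by (rule factorsE)
  have ea: "e \<in> Arr C" "Dom C e = y" "Cod C e = Dom C n" using e(1) fa(2) by (auto simp: Hom_def)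
  obtain p q where pb: "is_pullback C l e p q" using has_pullbacks[OF l(1) ea(1)] l(3) ea(3) by auto
  have pa: "p \<in> Arr C" "Cod C p = Dom C k" "q \<in> Arr C" "Cod C q = y" "Dom C q = Dom C p"
    using pbD[OF pb] l(2) ea(2) by auto
  have pcov: "is_cover C p" using covers_stable[OF ecov pb] .
  have ph: "p \<in> Hom C (Dom C p) (Dom C k)" and qh: "q \<in> Hom C (Dom C p) y" and kh: "k \<in> Hom C (Dom C k) x"
    using pa ka k(2) by (auto simp: Hom_def)
  have "f \<cdot>\<^bsub>C\<^esub> q = n \<cdot>\<^bsub>C\<^esub> (e \<cdot>\<^bsub>C\<^esub> q)" using e(2) assocA[of q e n] pa ea na(1) by simp
  also have "\<dots> = n \<cdot>\<^bsub>C\<^esub> (l \<cdot>\<^bsub>C\<^esub> p)" using pbD(9)[OF pb] by simp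
  also have "\<dots> = k \<cdot>\<^bsub>C\<^esub> p" using assocA[of p l n] l(1,3) pa pbD(6)[OF pb] na(1) by (simp flip: l(4))
  finally have fq: "f \<cdot>\<^bsub>C\<^esub> q = k \<cdot>\<^bsub>C\<^esub> p" .
  have "\<bottom>\<^bsub>Sub C (Dom C p)\<^esub> = sub_pullback C q (sub_pullback C f A)"
    using pb_hom[OF qh] bot by (simp add: dlat_hom_def)
  also have "\<dots> = sub_pullback C p (sub_pullback C k A)"
    using pb_comp[OF qh f A] pb_comp[OF ph kh A] fq by simp
  also have "sub_pullback C k A = \<top>\<^bsub>Sub C (Dom C k)\<^esub>"
    using sub_pullback_top_iff[OF kh m(1,2)] kn(2) m(3) by simp
  also have "sub_pullback C p \<top>\<^bsub>Sub C (Dom C k)\<^esub> = \<top>\<^bsub>Sub C (Dom C p)\<^esub>"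
    using pb_hom[OF ph] by (simp add: dlat_hom_def)
  finally have "\<bottom>\<^bsub>Sub C (Dom C k)\<^esub> = \<top>\<^bsub>Sub C (Dom C k)\<^esub>"
    using cover_reflects_degenerate[OF pcov] pa(2) by simp
  obtain b where b: "is_mono C b" "Cod C b = x" "\<bottom>\<^bsub>Sub C x\<^esub> = sc b"
    using X.bottom_closed by (rule sub_carrE)
  have "sub_pullback C k (sc b) = \<top>\<^bsub>Sub C (Dom C k)\<^esub>"
    using pb_hom[OF kh] b(3) \<open>\<bottom>\<^bsub>Sub C (Dom C k)\<^esub> = \<top>\<^bsub>Sub C (Dom C k)\<^esub>\<close> by (simp add: dlat_hom_def)
  then have "factors C k b" using sub_pullback_top_iff[OF kh b(1,2)] by simp
  then have "sc k \<sqsubseteq>\<^bsub>Sub C x\<^esub> \<bottom>\<^bsub>Sub C x\<^esub>" using sc_le[OF k(1) b(1)] b(3) by simp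
  then have "sc k = \<bottom>\<^bsub>Sub C x\<^esub>"
    using X.le_antisym[of "sc k" "\<bottom>\<^bsub>Sub C x\<^esub>"] k(1,2) by simp
  then show ?thesis using k(3) m(3) by simp
qed

end


section \<open>The category of elements is cofiltered\<close>

context coherent_model
begin

lemma cone_over_two_elements:
  assumes a: "x \<in> Obj C" "a \<in> omap M x" and b: "y \<in> Obj C" "b \<in> omap M y"
  shows "\<exists>z p q d. p \<in> Hom C z x \<and> q \<in> Hom C z y \<and> d \<in> omap M z \<and> ev p d = a \<and> ev q d = b"
proof -
  obtain t where t: "is_terminal C t" using has_terminal by blast
  obtain f g where fg: "f \<in> Hom C x t" "g \<in> Hom C y t" using t a(1) b(1) unfolding is_terminal_def by blast
  obtain p q where pb: "is_pullback C f g p q"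
    using has_pullbacks[of f g] fg by (auto simp: Hom_def)
  have "ev f a = ev g b"
    using terminal_elements[OF t] ev_closed fg a b by blast
  then obtain d where "d \<in> omap M (Dom C p)" "ev p d = a" "ev q d = b"
    using pullback_elements[OF pb, of a b] fg a b by (auto simp: Hom_def)
  moreover have "p \<in> Hom C (Dom C p) x" "q \<in> Hom C (Dom C p) y"
    using pbD[OF pb] fg by (auto simp: Hom_def)
  ultimately show ?thesis by blast
qed

text \<open>
  The equalizer of \<open>f\<close> and \<open>g\<close> is built from pullbacks only, so that its preservation by \<open>M\<close>
  follows from that of pullbacks: \<open>p\<close> and \<open>q\<close> are the projections of \<open>y \<times> y\<close>, obtained over the
  terminal object, \<open>h\<close> is the pairing of \<open>f\<close> and \<open>g\<close>, \<open>i\<close> is the diagonal, and the equalizer is the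
  pullback of \<open>h\<close> and \<open>i\<close>.
\<close>

lemma equalizing_element:
  assumes f: "f \<in> Hom C x y" and g: "g \<in> Hom C x y" and a: "a \<in> omap M x" and eq: "ev f a = ev g a"
  shows "\<exists>z e d. e \<in> Hom C z x \<and> d \<in> omap M z \<and> ev e d = a \<and> f \<cdot>\<^bsub>C\<^esub> e = g \<cdot>\<^bsub>C\<^esub> e"
proof -
  have fa: "f \<in> Arr C" "Dom C f = x" "Cod C f = y" and ga: "g \<in> Arr C" "Dom C g = x" "Cod C g = y"
    using f g by (auto simp: Hom_def)
  have x: "x \<in> Obj C" and y: "y \<in> Obj C" using fa dom_closed cod_closed by blast+
  obtain t where t: "is_terminal C t" using has_terminal by blast
  obtain u where u: "u \<in> Hom C y t" using t y unfolding is_terminal_def by blast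
  have ua: "u \<in> Arr C" "Dom C u = y" "Cod C u = t" using u by (auto simp: Hom_def)
  obtain p q where P: "is_pullback C u u p q" using has_pullbacks[OF ua(1) ua(1)] by blast
  let ?P = "Dom C p"
  have pq: "p \<in> Hom C ?P y" "q \<in> Hom C ?P y" using pbD[OF P] ua by (auto simp: Hom_def)
  have "u \<cdot>\<^bsub>C\<^esub> f = u \<cdot>\<^bsub>C\<^esub> g"
    using t x comp_closed[OF f u] comp_closed[OF g u] unfolding is_terminal_def by blast
  then obtain h where h: "h \<in> Hom C x ?P" "p \<cdot>\<^bsub>C\<^esub> h = f" "q \<cdot>\<^bsub>C\<^esub> h = g"
    using pb_ex[OF P fa(1) ga(1)] fa ga ua by auto
  obtain i where i: "i \<in> Hom C y ?P" "p \<cdot>\<^bsub>C\<^esub> i = Ident C y" "q \<cdot>\<^bsub>C\<^esub> i = Ident C y"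
    using pb_ex[OF P, of "Ident C y" "Ident C y"] y ua by auto
  have hi: "h \<in> Arr C" "Dom C h = x" "Cod C h = ?P" "i \<in> Arr C" "Dom C i = y" "Cod C i = ?P"
    using h(1) i(1) by (auto simp: Hom_def)
  obtain e k where E: "is_pullback C h i e k" using has_pullbacks[OF hi(1,4)] hi by auto
  have ek: "e \<in> Hom C (Dom C e) x" "k \<in> Hom C (Dom C e) y" using pbD[OF E] hi by (auto simp: Hom_def)
  have fe: "f \<cdot>\<^bsub>C\<^esub> e = k" and ge: "g \<cdot>\<^bsub>C\<^esub> e = k"
  proof -
    have "f \<cdot>\<^bsub>C\<^esub> e = p \<cdot>\<^bsub>C\<^esub> (i \<cdot>\<^bsub>C\<^esub> k)"
      using comp_assoc[OF ek(1) h(1) pq(1)] h(2) pbD(9)[OF E] by simp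
    also have "\<dots> = k" using comp_assoc[OF ek(2) i(1) pq(1)] i(2) ident_comp[OF ek(2)] by simp
    finally show "f \<cdot>\<^bsub>C\<^esub> e = k" .
    have "g \<cdot>\<^bsub>C\<^esub> e = q \<cdot>\<^bsub>C\<^esub> (i \<cdot>\<^bsub>C\<^esub> k)"
      using comp_assoc[OF ek(1) h(1) pq(2)] h(3) pbD(9)[OF E] by simp
    also have "\<dots> = k" using comp_assoc[OF ek(2) i(1) pq(2)] i(3) ident_comp[OF ek(2)] by simp
    finally show "g \<cdot>\<^bsub>C\<^esub> e = k" .
  qed
  let ?b = "ev f a"
  have b: "?b \<in> omap M y" using ev_closed[OF f a] .
  have "ev p (ev h a) = ?b" "ev q (ev h a) = ?b" "ev p (ev i ?b) = ?b" "ev q (ev i ?b) = ?b"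
    using ev_comp[OF h(1) pq(1) a] ev_comp[OF h(1) pq(2) a] ev_comp[OF i(1) pq(1) b] ev_comp[OF i(1) pq(2) b]
      h(2,3) i(2,3) eq ev_ident[OF y b] by simp_all
  then have "ev h a = ev i ?b"
    using pullback_elements[OF P, of ?b ?b] b ua ev_closed[OF h(1) a] ev_closed[OF i(1) b] by auto
  then obtain d where "d \<in> omap M (Dom C e)" "ev e d = a"
    using pullback_elements[OF E, of a ?b] hi a b by auto
  then show ?thesis
    using ek(1) fe ge by (intro exI[of _ "Dom C e"] exI[of _ e] exI[of _ d]) simp
qed

abbreviation elements_op :: "('o \<times> 'e, ('o \<times> 'e) \<times> 'a \<times> ('o \<times> 'e)) cat" where
  "elements_op \<equiv> op_cat (elements_cat C M)"
abbreviation sub_diagram :: "('o \<times> 'e, ('o \<times> 'e) \<times> 'a \<times> ('o \<times> 'e), 'a set) dlat_diagram" where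
  "sub_diagram \<equiv> functor_comp (Sub_functor C) elements_proj"

lemma elements_op_Obj [simp]: "(x, a) \<in> Obj elements_op \<longleftrightarrow> x \<in> Obj C \<and> a \<in> omap M x"
  by (simp add: op_cat_def elements_cat_def)

text \<open>
  In the opposite category an arrow is still stored as the triple of the category of elements, so
  that its first component is its codomain.
\<close>

lemma elements_op_Hom:
  "w \<in> Hom elements_op (x, a) (y, b) \<longleftrightarrow>
    (\<exists>f. w = ((y, b), f, (x, a)) \<and> f \<in> Hom C y x \<and> b \<in> omap M y \<and> a \<in> omap M x \<and> ev f b = a)"
  by (auto simp: op_cat_def elements_cat_def Hom_def)

lemma elements_op_comp: "(p', g, q') \<cdot>\<^bsub>elements_op\<^esub> (p, f, q) = (p', f \<cdot>\<^bsub>C\<^esub> g, q)"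
  by (simp add: op_cat_def elements_cat_def)

lemma omap_sub_diagram [simp]: "omap sub_diagram (x, a) = Sub C x"
  by (simp add: functor_comp_def Sub_functor_def elements_proj_def)

lemma amap_sub_diagram [simp]:
  assumes "f \<in> Hom C y x" "A \<in> carrier (Sub C x)"
  shows "fn (amap sub_diagram (p, f, q)) A = sub_pullback C f A"
  using assms by (auto simp: functor_comp_def Sub_functor_def elements_proj_def Hom_def)

sublocale LM: directed_diagram elements_op sub_diagram
proof
  show "is_functor elements_op DLat_cat sub_diagram" by (rule LM_diagram[OF M_functor])
next
  fix i j assume ij: "i \<in> Obj elements_op" "j \<in> Obj elements_op"
  obtain x a y b where [simp]: "i = (x, a)" "j = (y, b)" by (cases i; cases j)
  obtain z p q d where d: "p \<in> Hom C z x" "q \<in> Hom C z y" "d \<in> omap M z" "ev p d = a" "ev q d = b"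
    using cone_over_two_elements[of x a y b] ij by auto
  then have "((z, d), p, (x, a)) \<in> Hom elements_op i (z, d)" "((z, d), q, (y, b)) \<in> Hom elements_op j (z, d)"
    using ij by (auto simp: elements_op_Hom)
  then show "\<exists>k f g. f \<in> Hom elements_op i k \<and> g \<in> Hom elements_op j k" by blast
next
  fix v w i j assume vw: "v \<in> Hom elements_op i j" "w \<in> Hom elements_op i j"
  obtain x a y b where [simp]: "i = (x, a)" "j = (y, b)" by (cases i; cases j)
  obtain f g where fg: "v = ((y, b), f, (x, a))" "f \<in> Hom C y x" "w = ((y, b), g, (x, a))" "g \<in> Hom C y x"
    "b \<in> omap M y" "ev f b = ev g b"
    using vw by (auto simp: elements_op_Hom)
  obtain z e d where e: "e \<in> Hom C z y" "d \<in> omap M z" "ev e d = b" "f \<cdot>\<^bsub>C\<^esub> e = g \<cdot>\<^bsub>C\<^esub> e"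
    using equalizing_element[OF fg(2,4,5,6)] by blast
  have "((z, d), e, (y, b)) \<in> Hom elements_op j (z, d)" using e fg(5) by (auto simp: elements_op_Hom)
  moreover have "((z, d), e, (y, b)) \<cdot>\<^bsub>elements_op\<^esub> v = ((z, d), e, (y, b)) \<cdot>\<^bsub>elements_op\<^esub> w"
    using e(4) fg(1,3) by (simp add: elements_op_comp)
  ultimately show "\<exists>k h. h \<in> Hom elements_op j k \<and> h \<cdot>\<^bsub>elements_op\<^esub> v = h \<cdot>\<^bsub>elements_op\<^esub> w" by blast
qed


section \<open>The classes of subobjects in the colimit\<close>

abbreviation cls :: "'o \<Rightarrow> 'e \<Rightarrow> 'a set \<Rightarrow> (('o \<times> 'e) \<times> 'a set) lterm set" where
  "cls x a \<equiv> coproj elements_op sub_diagram (x, a)"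

lemma LM_eq: "LM C M = dlat_colim elements_op sub_diagram"
  by (simp add: LM_def)

lemma cls_hom:
  assumes "x \<in> Obj C" "a \<in> omap M x" shows "dlat_hom (Sub C x) (LM C M) (cls x a)"
  using LM.coproj_hom[of "(x, a)"] assms by (simp add: LM_eq)

lemma cls_arrow:
  assumes f: "f \<in> Hom C y x" and b: "b \<in> omap M y" and A: "A \<in> carrier (Sub C x)"
  shows "cls y b (sub_pullback C f A) = cls x (ev f b) A"
proof -
  have "((y, b), f, (x, ev f b)) \<in> Hom elements_op (x, ev f b) (y, b)"
    using ev_closed[OF f b] f b by (simp add: elements_op_Hom)
  from LM.coproj_arr[OF this, of A] show ?thesis using A amap_sub_diagram[OF f A] by simp
qed

text \<open>
  Membership in \<open>M A\<close> is a homomorphism in \<open>A\<close> for each element, and these homomorphisms are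
  compatible with pullback, so the universal property of the colimit applies.
\<close>

lemma evaluation_hom:
  "\<exists>k. dlat_hom (LM C M) two k \<and> (\<forall>x\<in>Obj C. \<forall>a\<in>omap M x. \<forall>A\<in>carrier (Sub C x).
    k (cls x a A) = (a \<in> sub_elements C M A))"
proof -
  let ?h = "\<lambda>(x, a) A. a \<in> sub_elements C M A"
  have "\<exists>!k. k \<in> extensional (carrier (dlat_colim elements_op sub_diagram)) \<and>
      dlat_hom (dlat_colim elements_op sub_diagram) two k \<and>
      (\<forall>i\<in>Obj elements_op. \<forall>u\<in>carrier (omap sub_diagram i). k (coproj elements_op sub_diagram i u) = ?h i u)"
  proof (rule LM.colim_universal[OF dlat_two])
    fix i assume "i \<in> Obj elements_op"
    then show "dlat_hom (omap sub_diagram i) two (?h i)"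
      by (cases i) (auto intro: sub_elements_hom)
  next
    fix w i j u assume w: "w \<in> Hom elements_op i j" and u: "u \<in> carrier (omap sub_diagram i)"
    obtain x a y b where ij: "i = (x, a)" "j = (y, b)" by (cases i; cases j)
    obtain f where f: "w = ((y, b), f, (x, a))" "f \<in> Hom C y x" "b \<in> omap M y" "ev f b = a"
      using w unfolding ij elements_op_Hom by blast
    show "?h j (fn (amap sub_diagram w) u) = ?h i u"
      using sub_elements_pullback[OF f(2,3), of u] amap_sub_diagram[OF f(2), of u] u f(1,4)
      by (simp add: ij)
  qed
  then obtain k where "dlat_hom (LM C M) two k"
    "\<forall>i\<in>Obj elements_op. \<forall>u\<in>carrier (omap sub_diagram i). k (coproj elements_op sub_diagram i u) = ?h i u"
    unfolding LM_eq by blast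
  then show ?thesis by force
qed

text \<open>
  Choose a monomorphism \<open>m\<close> for \<open>A\<close> and \<open>b\<close> with \<open>M m b = a\<close>: then \<open>m\<close> is an arrow of the category of
  elements along which \<open>A\<close> pulls back to the greatest subobject.
\<close>

lemma cls_top:
  assumes A: "A \<in> carrier (Sub C x)" and a: "a \<in> sub_elements C M A"
  shows "cls x a A = \<top>\<^bsub>LM C M\<^esub>"
proof -
  obtain m where m: "is_mono C m" "Cod C m = x" "A = sc m" using A by (rule sub_carrE)
  have mh: "m \<in> Hom C (Dom C m) x" using mono_arr[OF m(1)] m(2) by (simp add: Hom_def)
  obtain b where b: "b \<in> omap M (Dom C m)" "a = ev m b"
    using a unfolding m(3) sub_elements_sc[OF m(1)] by blast
  have "sub_pullback C m A = \<top>\<^bsub>Sub C (Dom C m)\<^esub>"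
    using sub_pullback_top_iff[OF mh m(1,2)] factors_refl[OF mono_arr[OF m(1)]] m(3) by simp
  then have "cls x a A = cls (Dom C m) b \<top>\<^bsub>Sub C (Dom C m)\<^esub>"
    using cls_arrow[OF mh b(1) A] b(2) by simp
  also have "\<dots> = \<top>\<^bsub>LM C M\<^esub>"
    using cls_hom[OF dom_closed[OF mono_arr[OF m(1)]] b(1)] by (simp add: dlat_hom_def)
  finally show ?thesis .
qed

text \<open>
  From left to right, the disjoint subobject is the image of an arrow that pulls \<open>A\<close> back to \<open>\<bottom>\<close>.
  From right to left, \<open>B\<close> has class \<open>\<top>\<close>, so the class of \<open>A\<close> equals that of \<open>B \<sqinter> A\<close>.
\<close>

lemma cls_bottom_iff:
  assumes x: "x \<in> Obj C" and a: "a \<in> omap M x" and A: "A \<in> carrier (Sub C x)"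
  shows "cls x a A = \<bottom>\<^bsub>LM C M\<^esub> \<longleftrightarrow>
    (\<exists>B\<in>carrier (Sub C x). B \<sqinter>\<^bsub>Sub C x\<^esub> A = \<bottom>\<^bsub>Sub C x\<^esub> \<and> a \<in> sub_elements C M B)"
proof
  assume "cls x a A = \<bottom>\<^bsub>LM C M\<^esub>"
  then have "\<exists>j. \<exists>w\<in>Hom elements_op (x, a) j. fn (amap sub_diagram w) A = \<bottom>\<^bsub>omap sub_diagram j\<^esub>"
    using LM.coproj_eq_bottomD[of "(x, a)" A] x a A by (simp add: LM_eq)
  then obtain j w where w: "w \<in> Hom elements_op (x, a) j"
    "fn (amap sub_diagram w) A = \<bottom>\<^bsub>omap sub_diagram j\<^esub>"
    by blast
  obtain y b where j: "j = (y, b)" by (cases j)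
  obtain f where f: "w = ((y, b), f, (x, a))" "f \<in> Hom C y x" "b \<in> omap M y" "ev f b = a"
    using w(1) unfolding j elements_op_Hom by blast
  have fa: "f \<in> Arr C" "Dom C f = y" "Cod C f = x" using f(2) by (auto simp: Hom_def)
  have bot: "sub_pullback C f A = \<bottom>\<^bsub>Sub C y\<^esub>"
    using w(2) amap_sub_diagram[OF f(2) A] by (simp add: f(1) j)
  obtain n where n: "is_image C f n" using has_images[OF fa(1)] by blast
  then have nf: "is_mono C n" "factors C f n" by (auto simp: is_image_def)
  then have "Cod C n = x" using fa(3) by (simp add: factors_def)
  then have "sc n \<in> carrier (Sub C x)" using nf(1) by simp
  moreover have "sc n \<sqinter>\<^bsub>Sub C x\<^esub> A = \<bottom>\<^bsub>Sub C x\<^esub>" using image_disjoint[OF f(2) A bot n] .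
  moreover have "a \<in> sub_elements C M (sc n)"
    using factors_elements[OF nf(2)] f(3,4) fa(2) by (auto simp: sub_elements_sc[OF nf(1)])
  ultimately show "\<exists>B\<in>carrier (Sub C x). B \<sqinter>\<^bsub>Sub C x\<^esub> A = \<bottom>\<^bsub>Sub C x\<^esub> \<and> a \<in> sub_elements C M B"
    by blast
next
  assume "\<exists>B\<in>carrier (Sub C x). B \<sqinter>\<^bsub>Sub C x\<^esub> A = \<bottom>\<^bsub>Sub C x\<^esub> \<and> a \<in> sub_elements C M B"
  then obtain B where B: "B \<in> carrier (Sub C x)" "B \<sqinter>\<^bsub>Sub C x\<^esub> A = \<bottom>\<^bsub>Sub C x\<^esub>" "a \<in> sub_elements C M B"
    by blast
  interpret K: dlat "LM C M" unfolding LM_eq by (rule LM.dlat_colim)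
  have h: "dlat_hom (Sub C x) (LM C M) (cls x a)" using cls_hom[OF x a] .
  have c: "cls x a A \<in> carrier (LM C M)" using h A by (auto simp: dlat_hom_def)
  have "\<bottom>\<^bsub>LM C M\<^esub> = cls x a B \<sqinter>\<^bsub>LM C M\<^esub> cls x a A"
    using h A B(1,2) unfolding dlat_hom_def by metis
  also have "\<dots> = \<top>\<^bsub>LM C M\<^esub> \<sqinter>\<^bsub>LM C M\<^esub> cls x a A" using cls_top[OF B(1,3)] by simp
  finally have "\<top>\<^bsub>LM C M\<^esub> \<sqinter>\<^bsub>LM C M\<^esub> cls x a A = \<bottom>\<^bsub>LM C M\<^esub>" by simp
  moreover have "cls x a A \<sqsubseteq>\<^bsub>LM C M\<^esub> \<top>\<^bsub>LM C M\<^esub> \<sqinter>\<^bsub>LM C M\<^esub> cls x a A"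
    using c by (intro K.meet_le) simp_all
  ultimately show "cls x a A = \<bottom>\<^bsub>LM C M\<^esub>"
    using K.le_antisym[of "cls x a A" "\<bottom>\<^bsub>LM C M\<^esub>"] c by simp
qed

text \<open>
  The evaluation homomorphism shows that only the subobjects containing \<open>a\<close> have class \<open>\<top>\<close>, so the
  two alternatives say that \<open>a\<close> lies in \<open>M A\<close> or in \<open>M B\<close> for some \<open>B\<close> disjoint from \<open>A\<close>.
\<close>

lemma positively_closed_iff_cls:
  "positively_closed C M \<longleftrightarrow> (\<forall>x\<in>Obj C. \<forall>a\<in>omap M x. \<forall>A\<in>carrier (Sub C x).
    cls x a A = \<top>\<^bsub>LM C M\<^esub> \<or> cls x a A = \<bottom>\<^bsub>LM C M\<^esub>)"
proof -
  obtain k where k: "dlat_hom (LM C M) two k"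
    "\<And>x a A. x \<in> Obj C \<Longrightarrow> a \<in> omap M x \<Longrightarrow> A \<in> carrier (Sub C x) \<Longrightarrow>
      k (cls x a A) = (a \<in> sub_elements C M A)"
    using evaluation_hom by blast
  have is_top: "cls x a A = \<top>\<^bsub>LM C M\<^esub> \<longleftrightarrow> a \<in> sub_elements C M A"
    if "x \<in> Obj C" "a \<in> omap M x" "A \<in> carrier (Sub C x)" for x a A
    using cls_top[OF that(3)] k(1) k(2)[OF that] by (auto simp: dlat_hom_def)
  let ?U = "\<lambda>x A. \<Union>B\<in>{B \<in> carrier (Sub C x). B \<sqinter>\<^bsub>Sub C x\<^esub> A = \<bottom>\<^bsub>Sub C x\<^esub>}. sub_elements C M B"
  have covered: "omap M x = sub_elements C M A \<union> ?U x A \<longleftrightarrow>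
    (\<forall>a\<in>omap M x. cls x a A = \<top>\<^bsub>LM C M\<^esub> \<or> cls x a A = \<bottom>\<^bsub>LM C M\<^esub>)"
    if x: "x \<in> Obj C" and A: "A \<in> carrier (Sub C x)" for x A
  proof -
    define S where "S = sub_elements C M A \<union> ?U x A"
    have "S \<subseteq> omap M x" unfolding S_def using sub_elements_subset A by blast
    moreover have "a \<in> S \<longleftrightarrow> cls x a A = \<top>\<^bsub>LM C M\<^esub> \<or> cls x a A = \<bottom>\<^bsub>LM C M\<^esub>"
      if a: "a \<in> omap M x" for a
      unfolding S_def is_top[OF x a A] cls_bottom_iff[OF x a A] by blast
    ultimately have "omap M x = S \<longleftrightarrow>
        (\<forall>a\<in>omap M x. cls x a A = \<top>\<^bsub>LM C M\<^esub> \<or> cls x a A = \<bottom>\<^bsub>LM C M\<^esub>)"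
      by (metis subsetI subset_antisym)
    then show ?thesis unfolding S_def .
  qed
  have "positively_closed C M \<longleftrightarrow> (\<forall>x\<in>Obj C. \<forall>A\<in>carrier (Sub C x). \<forall>a\<in>omap M x.
      cls x a A = \<top>\<^bsub>LM C M\<^esub> \<or> cls x a A = \<bottom>\<^bsub>LM C M\<^esub>)"
    unfolding positively_closed_def by (intro ball_cong HOL.refl covered)
  then show ?thesis by blast
qed

text \<open>
  The classes of subobjects generate the colimit, and \<open>{\<top>, \<bottom>}\<close> is a sublattice.
\<close>

lemma LM_trivial_iff_cls:
  "(\<forall>X\<in>carrier (LM C M). X = \<top>\<^bsub>LM C M\<^esub> \<or> X = \<bottom>\<^bsub>LM C M\<^esub>) \<longleftrightarrow>
    (\<forall>x\<in>Obj C. \<forall>a\<in>omap M x. \<forall>A\<in>carrier (Sub C x).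
      cls x a A = \<top>\<^bsub>LM C M\<^esub> \<or> cls x a A = \<bottom>\<^bsub>LM C M\<^esub>)" (is "?L \<longleftrightarrow> ?R")
proof
  assume ?L
  show ?R
  proof (intro ballI)
    fix x a A assume "x \<in> Obj C" "a \<in> omap M x" "A \<in> carrier (Sub C x)"
    then have "cls x a A \<in> carrier (LM C M)" using cls_hom[of x a] by (auto simp: dlat_hom_def)
    then show "cls x a A = \<top>\<^bsub>LM C M\<^esub> \<or> cls x a A = \<bottom>\<^bsub>LM C M\<^esub>" using \<open>?L\<close> by blast
  qed
next
  assume R: ?R
  interpret K: dlat "LM C M" unfolding LM_eq by (rule LM.dlat_colim)
  have two_closed: "X \<sqinter>\<^bsub>LM C M\<^esub> Y \<in> {\<top>\<^bsub>LM C M\<^esub>, \<bottom>\<^bsub>LM C M\<^esub>}" "X \<squnion>\<^bsub>LM C M\<^esub> Y \<in> {\<top>\<^bsub>LM C M\<^esub>, \<bottom>\<^bsub>LM C M\<^esub>}"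
    if "X \<in> {\<top>\<^bsub>LM C M\<^esub>, \<bottom>\<^bsub>LM C M\<^esub>}" "Y \<in> {\<top>\<^bsub>LM C M\<^esub>, \<bottom>\<^bsub>LM C M\<^esub>}" for X Y
  proof -
    have X: "X \<in> carrier (LM C M)" and Y: "Y \<in> carrier (LM C M)" using that by auto
    have "X \<sqsubseteq>\<^bsub>LM C M\<^esub> Y \<or> Y \<sqsubseteq>\<^bsub>LM C M\<^esub> X" using that X Y by auto
    then have "X \<sqinter>\<^bsub>LM C M\<^esub> Y \<in> {X, Y} \<and> X \<squnion>\<^bsub>LM C M\<^esub> Y \<in> {X, Y}"
      using K.le_iff_join[OF X Y] K.le_iff_join[OF Y X] K.le_iff_meet[OF X Y] K.le_iff_meet[OF Y X]
      by (metis insertI1 insertI2 meet_comm join_comm)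
    then show "X \<sqinter>\<^bsub>LM C M\<^esub> Y \<in> {\<top>\<^bsub>LM C M\<^esub>, \<bottom>\<^bsub>LM C M\<^esub>}" "X \<squnion>\<^bsub>LM C M\<^esub> Y \<in> {\<top>\<^bsub>LM C M\<^esub>, \<bottom>\<^bsub>LM C M\<^esub>}"
      using that by blast+
  qed
  have "LM.cl t \<in> {\<top>\<^bsub>LM C M\<^esub>, \<bottom>\<^bsub>LM C M\<^esub>}" if "t \<in> colim_terms elements_op sub_diagram" for t
    using that
  proof (induction t)
    case (Gen g)
    obtain x a A where g: "g = ((x, a), A)" by (cases g) auto
    have "cls x a A = \<top>\<^bsub>LM C M\<^esub> \<or> cls x a A = \<bottom>\<^bsub>LM C M\<^esub>" using R Gen by (simp add: g)
    then show ?case by (simp add: g LM.coproj_cl)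
  next
    case LBot
    then show ?case by (simp add: LM_eq LM.cl_bot)
  next
    case LTop
    then show ?case by (simp add: LM_eq LM.cl_top)
  next
    case (LMeet s t)
    then show ?case using two_closed(1)[of "LM.cl s" "LM.cl t"] LM.cl_meet[of s t] by (simp add: LM_eq)
  next
    case (LJoin s t)
    then show ?case using two_closed(2)[of "LM.cl s" "LM.cl t"] LM.cl_join[of s t] by (simp add: LM_eq)
  qed
  then show ?L unfolding LM_eq LM.carr by (auto simp: LM_eq)
qed

end

theorem proposition6p12:
  fixes C :: "('o, 'a) cat" and M :: "('o, 'a, 'e) set_functor"
  assumes "coherent_category C" and "coherent_functor C Set_cat M"
  shows "positively_closed C M \<longleftrightarrow> dlat_isomorphic (LM C M) two"
proof -
  interpret coherent_model C M
    using assms by (simp add: coherent_model_def coherent_model_axioms_def)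
  obtain k where k: "dlat_hom (LM C M) two k" using evaluation_hom by blast
  have "dlat (LM C M)" unfolding LM_eq by (rule LM.dlat_colim)
  from dlat_isomorphic_two_iff[OF this k] show ?thesis
    using positively_closed_iff_cls LM_trivial_iff_cls by simp
qed

end
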